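(* Let $(M_n,S_n)_{n\ge0}$ be a Markov random walk whose driving chain $(M_n)_{n\ge0}$ is null recurrent with at most countable state space $\mathcal S$ and essentially unique stationary measure $\pi=(\pi_i)_{i\in\mathcal S}$. Put $\xi:=\mathbb P_\pi((M_1,X_1)\in\cdot)$. Suppose that the dual walk is positive divergent, i.e. $\lim_{n\to\infty}{}^{\#}S_n=\infty$ a.s. Define $$c:=\begin{cases}\mathbb E_\xi\big((\sigma_1-\sigma_0)^{-1}\big)=\mathbb P_\xi(\sigma_0=0),&\text{if these expressions are finite},\\ 1,&\text{otherwise.}\end{cases}$$ Then the ladder chain $M^{>}=(M_n^{>})_{n\ge0}$ possesses an essentially unique stationary measure $\pi^{>}=(\pi_i^{>})_{i\in\mathcal S}$, defined by $$\pi_i^{>}:=\frac1c\,\mathbb E_\xi\Big(\frac1{\sigma_1-\sigma_0}\mathbf 1_{\{M_{\sigma_0}=i\}}\Big)=\frac1c\,\mathbb P_\xi(M_0=i,\sigma_0=0),\qquad i\in\mathcal S,$$ and $\pi^{>}$ has $\pi$-density $f(i)=c^{-1}\,\mathbb P_\xi(\sigma_0=0\mid M_0=i)$, $i\in\mathcal S$. Moreover, the ladder chain is recurrent on $\mathcal S^{>}:=\{i\in\mathcal S:\pi_i^{>}>0\}$, and $$\mathbb P_i\big(\tau^{>}(\mathcal S^{>})<\infty\big)=1\quad\text{for all } i\in\mathcal S,$$ where $\tau^{>}(\mathcal S^{>}):=\inf\{n\ge1:M_n^{>}\in\mathcal S^{>}\}$. Finally, the ladder chain is positive recurrent on $\mathcal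 S^{>}$ if and only if $$\mathbb E_\xi\Big(\frac1{\sigma_1-\sigma_0}\Big)=\mathbb P_\xi(\sigma_0=0)<\infty .$$
   Context: Setting. $(M_n)_{n\ge 0}$ is an irreducible Markov chain on the at most countable set $\mathcal S$ with transition matrix $P=(p_{ij})$; it is null recurrent, and $\pi$ is its stationary measure, $0<\pi_i<\infty$ for all $i$, with infinite total mass. A stationary measure is "essentially unique" if it is unique up to multiplication by positive scalars (among nonzero stationary measures with finite weights). $(X_n)_{n\ge1}$ are real random variables, conditionally independent given $(M_n)_{n\ge0}$, with the conditional law of $X_n$ given $(M_k)_{k\ge0}$ equal to $F_{M_{n-1},M_n}$, where $(F_{ij})_{i,j\in\mathcal S}$ are given probability laws on $\mathbb R$. With $S_0:=0$, $S_n:=\sum_{k=1}^nX_k$, the process $(M_n,S_n)_{n\ge0}$ is called a Markov random walk with driving chain $(M_n)_{n\ge0}$. Write $\mathbb P_i=\mathbb P(\cdot\mid M_0=i)$ and $\mathbb P_\lambda=\sum_i\lambda_i\mathbb P_i$ for a (possibly infinite) measure $\lambda$ on $\mathcal S$. "A.s." means $\mathbb P_i$-a.s. for all $i\in\mathcal S$. Two-sided stationary version. $\mathbb P_\xi$ is the ($\sigma$-finite, infinite) shift-invariant measure governing the doubly infinite sequence $(M_n,X_n)_{n\in\mathbb Z}$, given by $$\mathbb P_\xi(M_m=i_m,\dots,M_n=i_n,\,X_{m+1}\in B_{m+1},\dots,X_n\in B_n)=\pi_{i_m}\prod_{k=m+1}^np_{i_{k-1}i_k}F_{i_{k-1}i_k}(B_k)$$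 for integers $m\le n$, states $i_k\in\mathcal S$ and Borel sets $B_k$; its one-dimensional marginal is $\xi$. $\mathbb E_\xi$ is integration with respect to $\mathbb P_\xi$, and $\mathbb P_\xi(\cdot\mid M_0=i)=\mathbb P_\xi(\cdot\cap\{M_0=i\})/\pi_i$. Put $S_0=0$, $S_n=\sum_{k=1}^nX_k$ for $n\ge1$, $S_n=-\sum_{k=n+1}^0X_k$ for $n\le-1$. Dual. ${}^{\#}M_n:=M_{-n}$, ${}^{\#}X_n:=X_{-n+1}$, ${}^{\#}S_n:=-S_{-n}$. The dual sequence $({}^{\#}M_n,{}^{\#}X_n)$ is a Markov chain with transition kernel ${}^{\#}Q((i,x),\{j\}\times(-\infty,t])=\frac{\pi_jp_{ji}}{\pi_i}F_{ji}(t)$, and $({}^{\#}M_n,{}^{\#}S_n)_{n\ge0}$ is the corresponding Markov random walk. Two-sided ladder epochs. When the dual walk is positive divergent, there is, $\mathbb P_\xi$-almost everywhere, a doubly infinite sequence $\dots<\sigma_{-1}<\sigma_0\le0<\sigma_1<\sigma_2<\dots$ enumerating all $k\in\mathbb Z$ with $S_k>\sup_{j<k}S_j$. In particular $\sigma_1=\inf\{k\ge1:S_k>\sup_{j<k}S_j\}$ and $\sigma_0=\sup\{k\le0:S_k>\sup_{j<k}S_j\}$. Ladder chain. $\sigma_0^{>}:=0$ and $\sigma_n^{>}:=\inf\{k>\sigma_{n-1}^{>}:S_k>S_{\sigma_{n-1}^{>}}\}$ for $n\ge1$ (equal to $\infty$ if $\sigma_{n-1}^{>}=\infty$ or if there is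 no such $k$). $M_n^{>}:=M_{\sigma_n^{>}}$ on $\{\sigma_n^{>}<\infty\}$. The ladder chain $(M_n^{>})_{n\ge0}$ is Markov with (a priori possibly substochastic) transition matrix $\big(\mathbb P_i(M_1^{>}=j,\sigma_1^{>}<\infty)\big)_{i,j\in\mathcal S}$; the event $\{M_n^{>}\in A\}$ is understood to include $\{\sigma_n^{>}<\infty\}$. "(Positive) recurrent on $\mathcal S^{>}$" means that the chain restricted to $\mathcal S^{>}$ is an irreducible (positive) recurrent Markov chain on $\mathcal S^{>}$. *)

theory Defs
  imports "HOL-Probability.Probability"
begin

section \<open>Chains on a countable state space\<close>

text \<open>The state space is a type of class \<open>countable\<close>, carrying the discrete \<open>\<sigma>\<close>-algebra.
  Measures on it are given by their weights.\<close>

definition stochastic_matrix :: "('a \<Rightarrow> 'a \<Rightarrow> real) \<Rightarrow> bool" where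
  "stochastic_matrix p \<longleftrightarrow>
     (\<forall>i j. 0 \<le> p i j) \<and> (\<forall>i. (\<integral>\<^sup>+ j. ennreal (p i j) \<partial>count_space UNIV) = 1)"

definition stationary_measure :: "('a \<Rightarrow> 'a \<Rightarrow> real) \<Rightarrow> ('a \<Rightarrow> ennreal) \<Rightarrow> bool" where
  "stationary_measure q \<mu> \<longleftrightarrow>
     (\<forall>i. \<mu> i < \<infinity>) \<and> (\<exists>i. \<mu> i \<noteq> 0) \<and>
     (\<forall>j. (\<integral>\<^sup>+ i. \<mu> i * ennreal (q i j) \<partial>count_space UNIV) = \<mu> j)"

definition ess_unique_stationary_measure :: "('a \<Rightarrow> 'a \<Rightarrow> real) \<Rightarrow> ('a \<Rightarrow> ennreal) \<Rightarrow> bool" where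
  "ess_unique_stationary_measure q \<mu> \<longleftrightarrow>
     stationary_measure q \<mu> \<and>
     (\<forall>\<nu>. stationary_measure q \<nu> \<longrightarrow> (\<exists>a>0. \<forall>i. \<nu> i = ennreal a * \<mu> i))"

text \<open>The following notions are used for the driving chain and for its ladder chain. The latter may
  a priori be killed, so a chain is a process \<open>Y\<close> with values in \<open>'a option\<close>, where \<open>None\<close> means
  that the chain is undefined at that time; \<open>P i\<close> is the law with initial state \<open>i\<close>.\<close>

definition return_time :: "(nat \<Rightarrow> 'w \<Rightarrow> 'a option) \<Rightarrow> 'a set \<Rightarrow> 'w \<Rightarrow> enat" where
  "return_time Y A w = Inf {enat n | n. 1 \<le> n \<and> Y n w \<in> Some ` A}"

definition recurrent_on ::
  "('a \<Rightarrow> 'w measure) \<Rightarrow> (nat \<Rightarrow> 'w \<Rightarrow> 'a option) \<Rightarrow> 'a set \<Rightarrow> bool" where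
  "recurrent_on P Y A \<longleftrightarrow>
     A \<noteq> {} \<and>
     (\<forall>i\<in>A. measure (P i) {w \<in> space (P i). Y 1 w \<in> Some ` A} = 1) \<and>
     (\<forall>i\<in>A. \<forall>j\<in>A. \<exists>n. measure (P i) {w \<in> space (P i). Y n w = Some j} > 0) \<and>
     (\<forall>i\<in>A. measure (P i) {w \<in> space (P i). return_time Y {i} w < \<infinity>} = 1)"

definition mean_return_time ::
  "('a \<Rightarrow> 'w measure) \<Rightarrow> (nat \<Rightarrow> 'w \<Rightarrow> 'a option) \<Rightarrow> 'a \<Rightarrow> ennreal" where
  "mean_return_time P Y i = (\<integral>\<^sup>+ w. ennreal_of_enat (return_time Y {i} w) \<partial>P i)"

definition positive_recurrent_on ::
  "('a \<Rightarrow> 'w measure) \<Rightarrow> (nat \<Rightarrow> 'w \<Rightarrow> 'a option) \<Rightarrow> 'a set \<Rightarrow> bool" where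
  "positive_recurrent_on P Y A \<longleftrightarrow>
     recurrent_on P Y A \<and> (\<forall>i\<in>A. mean_return_time P Y i < \<infinity>)"

definition null_recurrent_on ::
  "('a \<Rightarrow> 'w measure) \<Rightarrow> (nat \<Rightarrow> 'w \<Rightarrow> 'a option) \<Rightarrow> 'a set \<Rightarrow> bool" where
  "null_recurrent_on P Y A \<longleftrightarrow>
     recurrent_on P Y A \<and> (\<forall>i\<in>A. mean_return_time P Y i = \<infinity>)"

section \<open>Markov random walks\<close>

text \<open>The last clause says that, given the whole sequence \<open>(M\<^sub>k)\<close>, the \<open>X\<^sub>k\<close> (\<open>k \<ge> 1\<close>) are conditionally
  independent with conditional laws \<open>F (M\<^sub>k\<^sub>-\<^sub>1) (M\<^sub>k)\<close>. The variable \<open>X 0\<close> is never used.\<close>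

definition markov_random_walk ::
  "('a::countable \<Rightarrow> 'a \<Rightarrow> real) \<Rightarrow> ('a \<Rightarrow> 'a \<Rightarrow> real measure) \<Rightarrow>
   ('a \<Rightarrow> 'w measure) \<Rightarrow> (nat \<Rightarrow> 'w \<Rightarrow> 'a) \<Rightarrow> (nat \<Rightarrow> 'w \<Rightarrow> real) \<Rightarrow> bool" where
  "markov_random_walk p F P M X \<longleftrightarrow>
     stochastic_matrix p \<and>
     (\<forall>i j. prob_space (F i j) \<and> sets (F i j) = sets borel) \<and>
     (\<forall>i. prob_space (P i)) \<and>
     (\<forall>i n. M n \<in> measurable (P i) (count_space UNIV)) \<and>
     (\<forall>i n. X n \<in> borel_measurable (P i)) \<and>
     (\<forall>i n x. measure (P i) {w \<in> space (P i). \<forall>k\<le>n. M k w = x k}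
        = (if x 0 = i then \<Prod>k=1..n. p (x (k - 1)) (x k) else 0)) \<and>
     (\<forall>i n B. (\<forall>k. B k \<in> sets borel) \<longrightarrow>
        (AE w in P i.
           real_cond_exp (P i)
             (vimage_algebra (space (P i)) (\<lambda>w k. M k w) (Pi\<^sub>M UNIV (\<lambda>_. count_space UNIV)))
             (indicator {w \<in> space (P i). \<forall>k\<in>{1..n}. X k w \<in> B k}) w
           = (\<Prod>k=1..n. measure (F (M (k - 1) w) (M k w)) (B k))))"

definition walk :: "(nat \<Rightarrow> 'w \<Rightarrow> real) \<Rightarrow> nat \<Rightarrow> 'w \<Rightarrow> real" where
  "walk X n w = (\<Sum>k=1..n. X k w)"

primrec ladder_epoch :: "(nat \<Rightarrow> real) \<Rightarrow> nat \<Rightarrow> enat" where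
  "ladder_epoch s 0 = 0"
| "ladder_epoch s (Suc n) =
     (case ladder_epoch s n of
        \<infinity> \<Rightarrow> \<infinity>
      | enat m \<Rightarrow> Inf {enat k | k. m < k \<and> s m < s k})"

definition ladder_chain ::
  "(nat \<Rightarrow> 'w \<Rightarrow> 'a) \<Rightarrow> (nat \<Rightarrow> 'w \<Rightarrow> real) \<Rightarrow> nat \<Rightarrow> 'w \<Rightarrow> 'a option" where
  "ladder_chain M X n w =
     (case ladder_epoch (\<lambda>k. walk X k w) n of
        \<infinity> \<Rightarrow> None
      | enat k \<Rightarrow> Some (M k w))"

definition ladder_matrix ::
  "('a \<Rightarrow> 'w measure) \<Rightarrow> (nat \<Rightarrow> 'w \<Rightarrow> 'a) \<Rightarrow> (nat \<Rightarrow> 'w \<Rightarrow> real) \<Rightarrow> 'a \<Rightarrow> 'a \<Rightarrow> real" where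
  "ladder_matrix P M X i j = measure (P i) {w \<in> space (P i). ladder_chain M X 1 w = Some j}"

section \<open>The two-sided stationary version\<close>

text \<open>\<open>Q\<close> is the measure \<open>\<P>\<^sub>\<xi>\<close> (of infinite total mass in the null recurrent case). The
  cylinder formula determines the law of \<open>(M\<^sub>n, X\<^sub>n)\<close>, \<open>n \<in> \<int>\<close>, under \<open>Q\<close>, including its shift invariance
  and its one-dimensional marginal \<open>\<xi>\<close>, the law of \<open>(M\<^sub>1, X\<^sub>1)\<close> of the random walk with initial
  measure \<open>\<pi>\<close>.\<close>

definition two_sided_stationary ::
  "('a::countable \<Rightarrow> 'a \<Rightarrow> real) \<Rightarrow> ('a \<Rightarrow> 'a \<Rightarrow> real measure) \<Rightarrow> ('a \<Rightarrow> ennreal) \<Rightarrow>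
   'v measure \<Rightarrow> (int \<Rightarrow> 'v \<Rightarrow> 'a) \<Rightarrow> (int \<Rightarrow> 'v \<Rightarrow> real) \<Rightarrow> bool" where
  "two_sided_stationary p F \<pi> Q M X \<longleftrightarrow>
     (\<forall>n. M n \<in> measurable Q (count_space UNIV)) \<and>
     (\<forall>n. X n \<in> borel_measurable Q) \<and>
     (\<forall>m n x B. m \<le> n \<longrightarrow> (\<forall>k. B k \<in> sets borel) \<longrightarrow>
        emeasure Q {w \<in> space Q. (\<forall>k\<in>{m..n}. M k w = x k) \<and> (\<forall>k\<in>{m+1..n}. X k w \<in> B k)}
        = \<pi> (x m) * (\<Prod>k\<in>{m+1..n}.
            ennreal (p (x (k - 1)) (x k)) * emeasure (F (x (k - 1)) (x k)) (B k)))"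

definition two_sided_walk :: "(int \<Rightarrow> 'v \<Rightarrow> real) \<Rightarrow> int \<Rightarrow> 'v \<Rightarrow> real" where
  "two_sided_walk X n w =
     (if n \<ge> 0 then \<Sum>k\<in>{1..n}. X k w else - (\<Sum>k\<in>{n+1..0}. X k w))"

definition dual_walk :: "(int \<Rightarrow> 'v \<Rightarrow> real) \<Rightarrow> nat \<Rightarrow> 'v \<Rightarrow> real" where
  "dual_walk X n w = - two_sided_walk X (- int n) w"

text \<open>\<open>\<P>\<^sub>\<xi>(\<cdot> | M\<^sub>0 = i)\<close>\<close>

definition cond_start :: "'v measure \<Rightarrow> (int \<Rightarrow> 'v \<Rightarrow> 'a) \<Rightarrow> 'a \<Rightarrow> 'v measure" where
  "cond_start Q M i = uniform_measure Q {w \<in> space Q. M 0 w = i}"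

text \<open>Under \<open>\<P>\<^sub>\<xi>(\<cdot> | M\<^sub>0 = i)\<close> the dual walk is the Markov random walk with the dual kernel and
  initial state \<open>i\<close>, so that the quantification over all \<open>i\<close> is what ``almost surely'' means for it.\<close>

definition dual_positive_divergent ::
  "'v measure \<Rightarrow> (int \<Rightarrow> 'v \<Rightarrow> 'a) \<Rightarrow> (int \<Rightarrow> 'v \<Rightarrow> real) \<Rightarrow> bool" where
  "dual_positive_divergent Q M X \<longleftrightarrow>
     (\<forall>i. AE w in cond_start Q M i. filterlim (\<lambda>n. dual_walk X n w) at_top sequentially)"

text \<open>The supremum is taken in \<open>ereal\<close> because the past of the walk may be unbounded above.\<close>

definition is_record :: "(int \<Rightarrow> 'v \<Rightarrow> real) \<Rightarrow> int \<Rightarrow> 'v \<Rightarrow> bool" where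
  "is_record X k w \<longleftrightarrow>
     ereal (two_sided_walk X k w) > (SUP j\<in>{..<k}. ereal (two_sided_walk X j w))"

text \<open>These are infimum and supremum in \<open>int\<close>, hence meaningful only if the sets are nonempty, which
  is the case almost everywhere if the dual walk is positive divergent.\<close>

definition sigma1 :: "(int \<Rightarrow> 'v \<Rightarrow> real) \<Rightarrow> 'v \<Rightarrow> int" where
  "sigma1 X w = Inf {k. 1 \<le> k \<and> is_record X k w}"

definition sigma0 :: "(int \<Rightarrow> 'v \<Rightarrow> real) \<Rightarrow> 'v \<Rightarrow> int" where
  "sigma0 X w = Sup {k. k \<le> 0 \<and> is_record X k w}"

definition mean_inverse_gap :: "'v measure \<Rightarrow> (int \<Rightarrow> 'v \<Rightarrow> real) \<Rightarrow> ennreal" where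
  "mean_inverse_gap Q X = (\<integral>\<^sup>+ w. ennreal (1 / real_of_int (sigma1 X w - sigma0 X w)) \<partial>Q)"

definition ladder_const :: "'v measure \<Rightarrow> (int \<Rightarrow> 'v \<Rightarrow> real) \<Rightarrow> ennreal" where
  "ladder_const Q X = (if mean_inverse_gap Q X < \<infinity> then mean_inverse_gap Q X else 1)"

definition ladder_measure ::
  "'v measure \<Rightarrow> (int \<Rightarrow> 'v \<Rightarrow> 'a) \<Rightarrow> (int \<Rightarrow> 'v \<Rightarrow> real) \<Rightarrow> 'a \<Rightarrow> ennreal" where
  "ladder_measure Q M X i =
     inverse (ladder_const Q X) *
     (\<integral>\<^sup>+ w. ennreal (1 / real_of_int (sigma1 X w - sigma0 X w))
            * indicator {w. M (sigma0 X w) w = i} w \<partial>Q)"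

end

theory Submission
  imports Defs
begin

text \<open>
  All statements are read off the two-sided stationary walk by the mass transport principle
  \<open>\<integral> (\<Sum>\<^sub>n f n \<omega>) = \<integral> (\<Sum>\<^sub>n f n (\<theta>\<^sub>-\<^sub>n \<omega>))\<close>, where \<open>\<theta>\<close> is the shift. Since the dual walk diverges, records
  exist arbitrarily far in the past; since the driving chain is recurrent, an event that forces \<open>M\<^sub>0 = i\<close>
  recurs in both directions as soon as it occurs, so records exist arbitrarily far in the future as well.
  Starting at a record, the ladder epochs are the subsequent records, and the future given the past depends on
  \<open>M\<^sub>0\<close> only. Hence \<open>\<rho> i = W(M\<^sub>0 = i, 0 is a record)\<close> is stationary for the ladder chain. Essential
  uniqueness of \<open>\<pi>\<close> forces records at each state \<open>j\<close> with \<open>\<rho> j > 0\<close> to occur almost everywhere, so from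
  every initial state the ladder chain visits \<open>j\<close> infinitely often. This gives recurrence, and also uniqueness,
  because an excessive measure is then invariant. Positive recurrence is decided by Kac's formula: the mean return
  time to \<open>j\<close> is \<open>W(0 is a record) / \<rho> j\<close>.
\<close>

section \<open>Path spaces and cylinder sets\<close>

text \<open>The two given processes live on unrelated sample spaces, neither of which carries a
  shift. Only their cylinder probabilities are related, so both are replaced by their laws
  \<open>W\<close> and \<open>L i\<close> on spaces of paths. Records are used instead of ladder
  epochs because being a record does not depend on the origin of time, and because the event that
  \<open>0\<close> is a record concerns the past alone and so factors off in the Markov property.

  Such arguments are therefore run inside an event that fixes the state at time \<open>0\<close>,
  whose mass is at most \<open>\<pi> i < \<infinity>\<close>.

  The Markov property is needed at the fixed time \<open>0\<close> only. The first ladder epoch is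
  handled by splitting according to its value and shifting that value to the origin.\<close>

definition path_space :: "('k \<Rightarrow> 'a \<times> real) measure" where
  "path_space = Pi\<^sub>M UNIV (\<lambda>_. count_space UNIV \<Otimes>\<^sub>M borel)"

lemma space_path_space [simp]: "space path_space = UNIV"
  by (simp add: path_space_def space_PiM space_pair_measure)

lemma measurable_coord [measurable]: "(\<lambda>\<omega>. \<omega> k) \<in> measurable path_space (count_space UNIV \<Otimes>\<^sub>M borel)"
  unfolding path_space_def by measurable

lemma measurable_fst_coord [measurable]:
  "(\<lambda>\<omega>. fst (\<omega> k)) \<in> measurable path_space (count_space UNIV)"
  by measurable

lemma measurable_snd_coord [measurable]: "(\<lambda>\<omega>. snd (\<omega> k)) \<in> borel_measurable path_space"
  by measurable

lemma measurable_path_spaceI: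
  assumes [measurable]: "\<And>k. (\<lambda>w. fst (f w k)) \<in> measurable N (count_space UNIV)"
    "\<And>k. (\<lambda>w. snd (f w k)) \<in> borel_measurable N"
  shows "f \<in> measurable N path_space"
  unfolding path_space_def
proof (rule measurable_PiM_single')
  fix k
  have "(\<lambda>w. (fst (f w k), snd (f w k))) \<in> N \<rightarrow>\<^sub>M count_space UNIV \<Otimes>\<^sub>M borel"
    by measurable
  then show "(\<lambda>w. f w k) \<in> N \<rightarrow>\<^sub>M count_space UNIV \<Otimes>\<^sub>M borel"
    by simp
qed (auto simp: space_pair_measure)

text \<open>States and increments get separate index sets, since between \<open>n + 1\<close>
  successive states lie only \<open>n\<close> increments.\<close>

definition cylinder ::
  "'k set \<Rightarrow> 'k set \<Rightarrow> ('k \<Rightarrow> 'a) \<Rightarrow> ('k \<Rightarrow> real set) \<Rightarrow> ('k \<Rightarrow> 'a \<times> real) set" where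
  "cylinder K J x B = {\<omega>. (\<forall>k\<in>K. fst (\<omega> k) = x k) \<and> (\<forall>k\<in>J. snd (\<omega> k) \<in> B k)}"

lemma cylinder_Int:
  assumes "K \<subseteq> K'" "J \<subseteq> J'"
  shows "cylinder K J x B \<inter> cylinder K' J' x' B' =
    (if \<forall>k\<in>K. x k = x' k then cylinder K' J' x' (\<lambda>k. if k \<in> J then B k \<inter> B' k else B' k) else {})"
  using assms unfolding cylinder_def by (auto split: if_splits simp: subset_iff) (metis+)?

lemma countable_PiE_UNIV:
  "finite K \<Longrightarrow> countable (PiE K (\<lambda>_. UNIV :: 'a::countable set))"
  by (intro countable_PiE) auto

text \<open>Cylinders over increasing windows are stable under intersection, because of two windows
  one contains the other. As there are countably many words over \<open>K 0\<close>, the cylinders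
  at stage \<open>0\<close> form a countable cover by sets of finite measure. This admits infinite
  measures such as \<open>W\<close>.\<close>

lemma cylinder_measure_eqI:
  fixes \<mu> \<nu> :: "('k \<Rightarrow> 'a::countable \<times> real) measure"
  assumes sets: "sets \<mu> = sets path_space" "sets \<nu> = sets path_space"
    and K: "incseq K" "\<And>n. finite (K n)" "(\<Union>n. K n) = UNIV"
    and J: "incseq J" "\<And>n. countable (J n)" "(\<Union>n. J n) = UNIV"
    and eq: "\<And>n x B. (\<And>k. B k \<in> sets borel) \<Longrightarrow>
      emeasure \<mu> (cylinder (K n) (J n) x B) = emeasure \<nu> (cylinder (K n) (J n) x B)"
    and fin: "\<And>x. emeasure \<mu> (cylinder (K 0) (J 0) x (\<lambda>_. UNIV)) \<noteq> \<infinity>"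
  shows "\<mu> = \<nu>"
proof -
  \<comment> \<open>The empty set is added because cylinders with contradictory states do not
    meet.\<close>
  define E :: "('k \<Rightarrow> 'a \<times> real) set set" where "E = insert {} {cylinder (K n) (J n) x B | n x B. \<forall>k. B k \<in> sets borel}"
  have cylE: "cylinder (K n) (J n) x B \<in> E" if "\<And>k. B k \<in> sets borel" for n x B
    using that unfolding E_def by auto
  have Int_le: "cylinder (K n) (J n) x B \<inter> cylinder (K n') (J n') x' B' \<in> E"
    if "n \<le> n'" "\<And>k. B k \<in> sets borel" "\<And>k. B' k \<in> sets borel" for n n' x x' B B'
  proof -
    have *: "K n \<subseteq> K n'" "J n \<subseteq> J n'" using K(1) J(1) that(1) by (auto simp: incseq_def)
    show ?thesis
      unfolding cylinder_Int[OF *] using that(2,3) by (auto intro!: cylE) (auto simp: E_def)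
  qed
  have stable: "Int_stable E"
  proof (rule Int_stableI)
    fix a b assume "a \<in> E" "b \<in> E"
    then consider "a = {} \<or> b = {}" | n x B n' x' B' where
      "a = cylinder (K n) (J n) x B" "b = cylinder (K n') (J n') x' B'"
      "\<And>k. B k \<in> sets borel" "\<And>k. B' k \<in> sets borel"
      unfolding E_def by auto
    then show "a \<inter> b \<in> E"
    proof cases
      case 1 then show ?thesis by (auto simp: E_def)
    next
      case 2 then show ?thesis
        by (cases n n' rule: linorder_le_cases) (metis Int_le, metis Int_le Int_commute)
    qed
  qed
  have "E \<subseteq> sets path_space"
  proof
    fix a assume "a \<in> E"
    then consider "a = {}" | n x B where
      "a = cylinder (K n) (J n) x B" "\<And>k. B k \<in> sets borel"
      unfolding E_def by auto
    then show "a \<in> sets path_space"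
    proof cases
      case (2 n x B)
      have [measurable]: "B k \<in> sets borel" for k by (rule 2)
      have "{\<omega>\<in>space path_space. (\<forall>k\<in>K n. fst (\<omega> k) = x k) \<and> (\<forall>k\<in>J n. snd (\<omega> k) \<in> B k)}
          \<in> sets (path_space :: ('k \<Rightarrow> 'a \<times> real) measure)"
        using K(2)[of n] J(2)[of n] by (measurable; simp add: countable_finite)
      then show ?thesis using 2 by (simp add: cylinder_def)
    qed auto
  qed
  then have sub: "sigma_sets UNIV E \<subseteq> sets path_space"
    using sets.sigma_sets_subset[of E path_space] by simp
  define N where "N = sigma UNIV E"
  have N: "space N = UNIV" "sets N = sigma_sets UNIV E" by (auto simp: N_def)
  have cylN: "cylinder (K n) (J n) x B \<in> sets N" if "\<And>k. B k \<in> sets borel" for n x B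
    using cylE[OF that] by (auto simp: N)
  \<comment> \<open>Measurability of the identity is the inclusion of
    \<open>\<sigma>\<close>-algebras that remains: the cylinders generate. It can be checked on
    single coordinates.\<close>
  have "(\<lambda>\<omega>. \<omega>) \<in> measurable N path_space"
  proof (rule measurable_path_spaceI)
    fix k
    obtain n where n: "k \<in> K n" using K(3) by auto
    have "(\<lambda>\<omega>. fst (\<omega> k)) -` {a} \<inter> space N \<in> sets N" for a
    proof -
      \<comment> \<open>Words restricted to \<open>K n\<close> are countable in number, so the union
        over the unspecified states stays measurable.\<close>
      have "(\<lambda>\<omega>. fst (\<omega> k)) -` {a} \<inter> space N =
         (\<Union>x\<in>{x\<in>PiE (K n) (\<lambda>_. UNIV). x k = a}. cylinder (K n) (J n) x (\<lambda>_. UNIV))" (is "?l = ?r")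
      proof
        show "?l \<subseteq> ?r"
        proof
          fix \<omega> assume "\<omega> \<in> ?l"
          then have "restrict (\<lambda>k. fst (\<omega> k)) (K n) \<in> {x\<in>PiE (K n) (\<lambda>_. UNIV). x k = a}"
            "\<omega> \<in> cylinder (K n) (J n) (restrict (\<lambda>k. fst (\<omega> k)) (K n)) (\<lambda>_. UNIV)"
            using n by (auto simp: cylinder_def)
          then show "\<omega> \<in> ?r" by blast
        qed
      qed (use n in \<open>auto simp: cylinder_def N\<close>)
      also have "\<dots> \<in> sets N"
        by (rule sets.countable_UN'')
          (auto intro!: cylN countable_subset[OF _ countable_PiE_UNIV[OF K(2), of n]])
      finally show ?thesis .
    qed
    then show "(\<lambda>\<omega>. fst (\<omega> k)) \<in> N \<rightarrow>\<^sub>M count_space UNIV"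
      by (auto simp: measurable_count_space_eq_countable)
  next
    fix k
    obtain n where n: "k \<in> J n" using J(3) by auto
    have "(\<lambda>\<omega>. snd (\<omega> k)) -` B \<inter> space N \<in> sets N" if B: "B \<in> sets borel" for B
    proof -
      have "(\<lambda>\<omega>. snd (\<omega> k)) -` B \<inter> space N =
         (\<Union>x\<in>PiE (K n) (\<lambda>_. UNIV). cylinder (K n) (J n) x (\<lambda>k'. if k' = k then B else UNIV))" (is "?l = ?r")
      proof
        show "?l \<subseteq> ?r"
        proof
          fix \<omega> assume "\<omega> \<in> ?l"
          then have "restrict (\<lambda>k. fst (\<omega> k)) (K n) \<in> PiE (K n) (\<lambda>_. UNIV)"
            "\<omega> \<in> cylinder (K n) (J n) (restrict (\<lambda>k. fst (\<omega> k)) (K n)) (\<lambda>k'. if k' = k then B else UNIV)"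
            using n by (auto simp: cylinder_def)
          then show "\<omega> \<in> ?r" by blast
        qed
      qed (use n in \<open>force simp: cylinder_def N\<close>)
      also have "\<dots> \<in> sets N"
        by (rule sets.countable_UN'')
          (auto intro!: cylN countable_PiE_UNIV K(2) simp: B)
      finally show ?thesis .
    qed
    then show "(\<lambda>\<omega>. snd (\<omega> k)) \<in> borel_measurable N"
      by (auto intro!: measurableI simp: N)
  qed
  then have "a \<in> sets path_space \<Longrightarrow> (\<lambda>\<omega>. \<omega>) -` a \<inter> space N \<in> sets N" for a
    by (rule measurable_sets)
  then have gen: "sets (path_space :: ('k \<Rightarrow> 'a \<times> real) measure) = sigma_sets UNIV E"
    using sub by (auto simp: N)
  show ?thesis
  proof (rule measure_eqI_generator_eq_countable[OF stable, of UNIV])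
    show "emeasure \<mu> Y = emeasure \<nu> Y" if "Y \<in> E" for Y
      using that eq by (auto simp: E_def)
    show "sets \<mu> = sigma_sets UNIV E" "sets \<nu> = sigma_sets UNIV E" using sets gen by auto
    let ?A = "(\<lambda>x :: 'k \<Rightarrow> 'a. cylinder (K 0) (J 0) x (\<lambda>_. UNIV)) ` PiE (K 0) (\<lambda>_. UNIV)"
    show "?A \<subseteq> E" by (auto intro!: cylE)
    show "countable ?A" by (intro countable_image countable_PiE_UNIV K(2))
    show "emeasure \<mu> a \<noteq> \<infinity>" if "a \<in> ?A" for a using that fin by auto
    show "\<Union>?A = UNIV"
    proof (rule UNIV_eq_I[symmetric])
      fix \<omega> :: "'k \<Rightarrow> 'a \<times> real"
      have "\<omega> \<in> cylinder (K 0) (J 0) (restrict (\<lambda>k. fst (\<omega> k)) (K 0)) (\<lambda>_. UNIV)"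
        by (auto simp: cylinder_def)
      then show "\<omega> \<in> \<Union>?A" by (intro UnionI[OF imageI]) auto
    qed
  qed simp
qed

lemma UN_atMost_nat: "(\<Union>n. {..n}) = (UNIV :: nat set)" and UN_lessThan_nat: "(\<Union>n. {..<n}) = (UNIV :: nat set)"
  by auto

lemma UN_symmetric_int:
  "(\<Union>n. {- int n..int n}) = UNIV" "(\<Union>n. {1 - int n..int n}) = UNIV"
proof -
  have "k \<in> (\<Union>n. {- int n..int n})" for k :: int
    by (rule UN_I[of "nat \<bar>k\<bar>"]) auto
  then show "(\<Union>n. {- int n..int n}) = UNIV" by (intro set_eqI iffI UNIV_I)
  have "k \<in> (\<Union>n. {1 - int n..int n})" for k :: int
    by (rule UN_I[of "nat \<bar>k\<bar> + 1"]) auto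
  then show "(\<Union>n. {1 - int n..int n}) = UNIV" by (intro set_eqI iffI UNIV_I)
qed

section \<open>Two-sided paths and their records\<close>

definition path_shift :: "int \<Rightarrow> (int \<Rightarrow> 'b) \<Rightarrow> int \<Rightarrow> 'b" where
  "path_shift m \<omega> = (\<lambda>k. \<omega> (k + m))"

text \<open>A one-sided path has coordinates \<open>(M\<^sub>n, X\<^sub>n\<^sub>+\<^sub>1)\<close>. With this convention \<open>past\<close> is a path of the dual
  walk, because \<open>(M\<^sub>-\<^sub>n, X\<^sub>-\<^sub>n)\<close> consists of the dual state at time \<open>n\<close> and the dual increment at
  time \<open>n + 1\<close>. The state at time \<open>0\<close> belongs to both \<open>past\<close> and \<open>fut\<close>.\<close>

definition past :: "(int \<Rightarrow> 'b) \<Rightarrow> nat \<Rightarrow> 'b" where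
  "past \<omega> = (\<lambda>n. \<omega> (- int n))"

definition fut :: "(int \<Rightarrow> 'a \<times> real) \<Rightarrow> nat \<Rightarrow> 'a \<times> real" where
  "fut \<omega> = (\<lambda>n. (fst (\<omega> (int n)), snd (\<omega> (int n + 1))))"

lemma measurable_path_shift [measurable]: "path_shift m \<in> measurable path_space path_space"
  by (rule measurable_path_spaceI) (simp_all add: path_shift_def)

lemma measurable_past [measurable]: "past \<in> measurable path_space path_space"
  by (rule measurable_path_spaceI) (simp_all add: past_def)

lemma measurable_fut [measurable]: "fut \<in> measurable path_space path_space"
  by (rule measurable_path_spaceI) (simp_all add: fut_def)

lemma path_shift_apply: "path_shift m \<omega> k = \<omega> (k + m)"
  by (simp add: path_shift_def)

lemma path_shift_shift [simp]: "path_shift m (path_shift n \<omega>) = path_shift (m + n) \<omega>"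
  by (simp add: path_shift_def ac_simps)

lemma path_shift_0 [simp]: "path_shift 0 \<omega> = \<omega>"
  by (simp add: path_shift_def)

definition level :: "(int \<Rightarrow> 'a \<times> real) \<Rightarrow> int \<Rightarrow> real" where
  "level \<omega> k = two_sided_walk (\<lambda>k \<omega>. snd (\<omega> k)) k \<omega>"

text \<open>On \<open>fut \<omega>\<close> this is the walk itself and on
  \<open>past \<omega>\<close> the dual walk; in both cases the sum starts at coordinate
  \<open>0\<close>.\<close>

definition psum :: "(nat \<Rightarrow> 'a \<times> real) \<Rightarrow> nat \<Rightarrow> real" where
  "psum \<eta> n = (\<Sum>k<n. snd (\<eta> k))"

lemma measurable_level [measurable]: "(\<lambda>\<omega>. level \<omega> k) \<in> borel_measurable path_space"
  unfolding level_def two_sided_walk_def by measurable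

lemma measurable_psum [measurable]: "(\<lambda>\<eta>. psum \<eta> n) \<in> borel_measurable path_space"
  unfolding psum_def by measurable

lemma level_0 [simp]: "level \<omega> 0 = 0"
  by (simp add: level_def two_sided_walk_def)

lemma level_plus_1: "level \<omega> (k + 1) = level \<omega> k + snd (\<omega> (k + 1))"
proof -
  consider "k \<ge> 0" | "k = -1" | "k < -1" by linarith
  then show ?thesis
  proof cases
    case 1
    then have "{1..k + 1} = insert (k + 1) {1..k}" by auto
    with 1 show ?thesis by (simp add: level_def two_sided_walk_def)
  next
    case 3
    then have "{k + 1..0} = insert (k + 1) {k + 2..0}" by auto
    with 3 show ?thesis by (simp add: level_def two_sided_walk_def add.commute)
  qed (simp add: level_def two_sided_walk_def)
qed

lemma level_shift: "level (path_shift m \<omega>) k = level \<omega> (k + m) - level \<omega> m"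
proof (induction k rule: int_induct[where k=0])
  case (step1 k)
  then show ?case
    using level_plus_1[of \<omega> "k + m"] level_plus_1[of "path_shift m \<omega>" k]
    by (simp add: path_shift_def ac_simps)
next
  case (step2 k)
  then show ?case
    using level_plus_1[of \<omega> "k - 1 + m"] level_plus_1[of "path_shift m \<omega>" "k - 1"]
    by (simp add: path_shift_def ac_simps)
qed simp

lemma level_past: "level \<omega> (- int n) = - psum (past \<omega>) n"
proof (induction n)
  case (Suc n)
  then show ?case
    using level_plus_1[of \<omega> "- int (Suc n)"] by (simp add: psum_def past_def)
qed (simp add: psum_def)

lemma level_fut: "level \<omega> (int n) = psum (fut \<omega>) n"
proof (induction n)
  case (Suc n)
  then show ?case
    using level_plus_1[of \<omega> "int n"] by (simp add: psum_def fut_def ac_simps)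
qed (simp add: psum_def)

text \<open>Compares with each earlier level instead of their supremum. This always follows from
  \<open>is_record\<close>; the converse holds when the past diverges.\<close>

definition strict_record :: "(int \<Rightarrow> 'a \<times> real) \<Rightarrow> int \<Rightarrow> bool" where
  "strict_record \<omega> k \<longleftrightarrow> (\<forall>j<k. level \<omega> j < level \<omega> k)"

lemma measurable_strict_record [measurable]: "Measurable.pred path_space (\<lambda>\<omega>. strict_record \<omega> k)"
  unfolding strict_record_def by measurable

text \<open>Records depend on differences of levels only, so moving the origin of time merely
  renames them.\<close>

lemma strict_record_shift [simp]: "strict_record (path_shift m \<omega>) k \<longleftrightarrow> strict_record \<omega> (k + m)"
  unfolding strict_record_def level_shift
  by (auto simp: algebra_simps) (metis add.commute diff_add_cancel diff_less_eq)

lemma strict_record_past: "strict_record \<omega> (- int n) \<longleftrightarrow> (\<forall>m>n. psum (past \<omega>) n < psum (past \<omega>) m)"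
proof
  assume r: "strict_record \<omega> (- int n)"
  show "\<forall>m>n. psum (past \<omega>) n < psum (past \<omega>) m"
  proof (intro allI impI)
    fix m assume "n < m"
    then have "level \<omega> (- int m) < level \<omega> (- int n)" using r by (auto simp: strict_record_def)
    then show "psum (past \<omega>) n < psum (past \<omega>) m" by (simp add: level_past)
  qed
next
  assume *: "\<forall>m>n. psum (past \<omega>) n < psum (past \<omega>) m"
  show "strict_record \<omega> (- int n)"
    unfolding strict_record_def
  proof (intro allI impI)
    fix j assume j: "j < - int n"
    then have "level \<omega> (- int (nat (- j))) < level \<omega> (- int n)"
      unfolding level_past using * by (auto simp: zless_nat_eq_int_zless)
    with j show "level \<omega> j < level \<omega> (- int n)" by simp
  qed
qed

text \<open>The dual walk stays positive: this expresses the record event through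
  \<open>past\<close> alone, as the Markov property at time \<open>0\<close> requires.\<close>

lemma strict_record_past_0: "strict_record \<omega> 0 \<longleftrightarrow> (\<forall>m>0. 0 < psum (past \<omega>) m)"
  using strict_record_past[of \<omega> 0] by (simp add: psum_def)

text \<open>Divergence of the dual walk, written with countable quantifiers so that measurability is
  immediate.\<close>

definition past_divergent :: "(int \<Rightarrow> 'a \<times> real) \<Rightarrow> bool" where
  "past_divergent \<omega> \<longleftrightarrow> (\<forall>N::nat. \<exists>m::nat. \<forall>n\<ge>m. level \<omega> (- int n) < - real N)"

lemma past_divergent_below:
  assumes "past_divergent \<omega>"
  shows "\<exists>m. \<forall>j\<le>m. level \<omega> j < x"
proof -
  obtain N :: nat where N: "- x \<le> real N" using real_arch_simple by blast
  obtain m :: nat where m: "\<And>n. n \<ge> m \<Longrightarrow> level \<omega> (- int n) < - real N"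
    using assms by (auto simp: past_divergent_def)
  show ?thesis
  proof (intro exI allI impI)
    fix j assume "j \<le> - int m"
    then have "m \<le> nat (- j)" "- int (nat (- j)) = j" by auto
    with m[of "nat (- j)"] N show "level \<omega> j < x" by simp
  qed
qed

lemma ex_least_int:
  assumes "P (k :: int)" "\<And>j. P j \<Longrightarrow> b \<le> j"
  obtains l where "P l" "\<And>j. P j \<Longrightarrow> l \<le> j" "l \<le> k"
proof -
  define n where "n = (LEAST n. P (b + int n))"
  have "P (b + int (nat (k - b)))" using assms by auto
  then have "P (b + int n)" unfolding n_def by (rule LeastI)
  moreover have "b + int n \<le> j" if "P j" for j
  proof -
    have "P (b + int (nat (j - b)))" "b \<le> j" using assms that by auto
    then show ?thesis unfolding n_def
      using Least_le[of "\<lambda>n. P (b + int n)" "nat (j - b)"] by linarith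
  qed
  ultimately show ?thesis using that assms(1) by blast
qed

lemma ex_greatest_int:
  assumes "P (k :: int)" "\<And>j. P j \<Longrightarrow> j \<le> b"
  obtains l where "P l" "\<And>j. P j \<Longrightarrow> j \<le> l" "k \<le> l"
proof -
  obtain l where "P (- l)" "\<And>j. P (- j) \<Longrightarrow> l \<le> j" "l \<le> - k"
    using ex_least_int[of "\<lambda>j. P (- j)" "- k" "- b"] assms by (auto simp: minus_le_iff)
  then show ?thesis using that[of "- l"] by (metis minus_le_iff minus_minus)
qed

text \<open>A first passage over a threshold is a record. For the threshold
  \<open>level \<omega> m - 1\<close> a first passage exists because the past diverges, and the
  subtracted \<open>1\<close> ensures that it happens by time \<open>m\<close>.\<close>

lemma past_divergent_record:
  assumes "past_divergent \<omega>"
  shows "\<exists>k\<le>m. strict_record \<omega> k"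
proof -
  obtain b where b: "\<And>j. j \<le> b \<Longrightarrow> level \<omega> j < level \<omega> m - 1"
    using past_divergent_below[OF assms] by blast
  then have "level \<omega> j > level \<omega> m - 1 \<Longrightarrow> b \<le> j" for j
    by (meson linear not_less_iff_gr_or_eq)
  then obtain k where k: "level \<omega> k > level \<omega> m - 1"
      "\<And>j. level \<omega> j > level \<omega> m - 1 \<Longrightarrow> k \<le> j" "k \<le> m"
    using ex_least_int[of "\<lambda>j. level \<omega> j > level \<omega> m - 1" m b] by auto
  have "strict_record \<omega> k"
    unfolding strict_record_def using k by (smt (verit))
  then show ?thesis using k(3) by blast
qed

lemma is_record_iff_strict_record:
  assumes "past_divergent \<omega>"
  shows "is_record (\<lambda>k \<omega>. snd (\<omega> k)) k \<omega> \<longleftrightarrow> strict_record \<omega> k"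
proof -
  let ?h = "\<lambda>j. ereal (level \<omega> j)"
  have "(SUP j\<in>{..<k}. ?h j) < ?h k \<longleftrightarrow> strict_record \<omega> k"
  proof
    assume "(SUP j\<in>{..<k}. ?h j) < ?h k"
    then show "strict_record \<omega> k"
      unfolding strict_record_def by (metis SUP_upper ereal_less_ereal_Ex le_less_trans less_ereal.simps(1) lessThan_iff)
  next
    assume r: "strict_record \<omega> k"
    obtain b where b: "\<And>j. j \<le> b \<Longrightarrow> level \<omega> j < level \<omega> k - 1"
      using past_divergent_below[OF assms] by blast
    \<comment> \<open>All times up to \<open>b\<close> lie below \<open>?h k - 1\<close>, so only a
      finite window is left for the supremum; a maximum over it stays strictly below
      \<open>?h k\<close>.\<close>
    define x where "x = Max (insert (?h k - 1) (?h ` {b..<k}))"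
    have "x < ?h k"
      unfolding x_def using r by (subst Max_less_iff) (auto simp: strict_record_def one_ereal_def)
    moreover have "?h j \<le> x" if "j < k" for j
    proof (cases "j \<le> b")
      case True
      then have "?h j \<le> ?h k - 1" using b[OF True] by (simp add: one_ereal_def)
      also have "\<dots> \<le> x" unfolding x_def by (rule Max_ge) auto
      finally show ?thesis .
    next
      case False
      then show ?thesis unfolding x_def by (intro Max_ge) (auto simp: that)
    qed
    ultimately show "(SUP j\<in>{..<k}. ?h j) < ?h k"
      by (meson SUP_least lessThan_iff le_less_trans)
  qed
  then show ?thesis by (simp add: is_record_def level_def)
qed

section \<open>The stationary two-sided walk\<close>

lemma borel_measurable_of_bool [measurable]:
  "Measurable.pred N P \<Longrightarrow> (\<lambda>x. of_bool (P x) :: ennreal) \<in> borel_measurable N"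
  unfolding of_bool_def by measurable

lemma Collect_in_path_space [measurable (raw)]:
  "Measurable.pred path_space P \<Longrightarrow> {\<omega>. P \<omega>} \<in> sets path_space"
  by (simp add: pred_def)

lemma nn_integral_of_bool:
  "Measurable.pred N P \<Longrightarrow> (\<integral>\<^sup>+ x. of_bool (P x) \<partial>N) = emeasure N {x \<in> space N. P x}"
  using nn_integral_indicator[of "{x \<in> space N. P x}" N]
  by (simp add: indicator_def cong: nn_integral_cong)

lemma emeasure_distr_density_of_bool:
  assumes [measurable]: "Measurable.pred N C" "f \<in> measurable N N'" "D \<in> sets N'"
  shows "emeasure (distr (density N (\<lambda>x. of_bool (C x))) N' f) D = emeasure N {x \<in> space N. C x \<and> f x \<in> D}"
proof -
  have "f \<in> measurable (density N (\<lambda>x. of_bool (C x))) N'" by simp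
  then have "emeasure (distr (density N (\<lambda>x. of_bool (C x))) N' f) D =
      emeasure (density N (\<lambda>x. of_bool (C x))) (f -` D \<inter> space N)"
    by (simp add: emeasure_distr)
  also have "\<dots> = (\<integral>\<^sup>+ x. of_bool (C x) * indicator (f -` D \<inter> space N) x \<partial>N)"
    by (rule emeasure_density) measurable
  also have "\<dots> = (\<integral>\<^sup>+ x. of_bool (C x \<and> f x \<in> D) \<partial>N)"
    by (rule nn_integral_cong) (auto simp: indicator_def)
  also have "\<dots> = emeasure N {x \<in> space N. C x \<and> f x \<in> D}"
    by (rule nn_integral_of_bool) measurable
  finally show ?thesis .
qed

lemma borel_measurable_nn_integral_count:
  fixes f :: "'i::countable \<Rightarrow> 'b \<Rightarrow> ennreal"
  assumes [measurable]: "\<And>n. f n \<in> borel_measurable N"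
  shows "(\<lambda>x. \<integral>\<^sup>+ n. f n x \<partial>count_space UNIV) \<in> borel_measurable N"
proof -
  interpret sigma_finite_measure "count_space (UNIV :: 'i set)"
    by (rule sigma_finite_measure_count_space)
  have "(\<lambda>z. f (snd z) (fst z)) \<in> borel_measurable (N \<Otimes>\<^sub>M count_space UNIV)"
    by (rule measurable_compose_countable[where f = "\<lambda>n z. f n (fst z)"]) measurable
  then show ?thesis
    by (intro borel_measurable_nn_integral) (simp add: case_prod_beta')
qed

lemma nn_integral_count_of_bool_unique:
  assumes "\<And>m n. P m \<Longrightarrow> P n \<Longrightarrow> m = n"
  shows "(\<integral>\<^sup>+ n. of_bool (P n) \<partial>count_space UNIV) = (of_bool (\<exists>n. P n) :: ennreal)"
proof (cases "\<exists>n. P n")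
  case True
  then obtain n where "P n" by blast
  with assms have "P = (\<lambda>m. m \<in> {n})" by auto
  then have "(\<integral>\<^sup>+ n. of_bool (P n) \<partial>count_space UNIV) = (\<integral>\<^sup>+ m. indicator {n} m \<partial>count_space UNIV)"
    by (simp add: indicator_def)
  also have "\<dots> = 1" by (subst nn_integral_indicator) auto
  finally show ?thesis using True by simp
qed simp

lemma nn_integral_count_of_bool_infinite:
  assumes "infinite {n. P n}"
  shows "(\<integral>\<^sup>+ n. of_bool (P n) \<partial>count_space UNIV) = (\<infinity> :: ennreal)"
proof -
  have "(\<integral>\<^sup>+ n. of_bool (P n) \<partial>count_space UNIV) = (\<integral>\<^sup>+ n. indicator {n. P n} n \<partial>count_space UNIV)"
    by (simp add: indicator_def)
  also have "\<dots> = \<infinity>" using assms by (subst nn_integral_indicator) auto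
  finally show ?thesis .
qed

lemma unbounded_above_if_no_greatest:
  fixes P :: "int \<Rightarrow> bool"
  assumes "P k" "\<And>n. P n \<Longrightarrow> \<exists>m>n. P m"
  shows "\<exists>m>n. P m"
proof (rule ccontr)
  assume "\<not> ?thesis"
  then have "m \<le> n" if "P m" for m using that by (auto simp: not_less)
  then obtain l where "P l" "\<And>j. P j \<Longrightarrow> j \<le> l"
    using ex_greatest_int[of P k n] assms(1) by metis
  with assms(2)[of l] show False by (meson not_less)
qed

lemma unbounded_below_if_no_least:
  fixes P :: "int \<Rightarrow> bool"
  assumes "P k" "\<And>n. P n \<Longrightarrow> \<exists>m<n. P m"
  shows "\<exists>m<n. P m"
proof (rule ccontr)
  assume "\<not> ?thesis"
  then have "n \<le> m" if "P m" for m using that by (auto simp: not_less)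
  then obtain l where "P l" "\<And>j. P j \<Longrightarrow> l \<le> j"
    using ex_least_int[of P k n] assms(1) by metis
  with assms(2)[of l] show False by (meson not_less)
qed

lemma infinite_if_unbounded_above:
  fixes P :: "int \<Rightarrow> bool"
  assumes "\<And>n. \<exists>m>n. P m"
  shows "infinite {m. m \<ge> b \<and> P m}"
proof
  assume fin: "finite {m. m \<ge> b \<and> P m}"
  obtain m where m: "m > max b (Max (insert b {m. m \<ge> b \<and> P m}))" "P m" using assms by blast
  then have "m \<in> {m. m \<ge> b \<and> P m}" by auto
  then have "m \<le> Max (insert b {m. m \<ge> b \<and> P m})" using fin by (intro Max_ge) auto
  with m show False by simp
qed

text \<open>Everything that the argument draws on, stated for laws on path space. The only link
  between \<open>W\<close> and the one-sided laws is \<open>markov\<close>: given state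
  \<open>i\<close> at time \<open>0\<close>, the future has law \<open>L i\<close> whatever the past
  was.\<close>

locale stationary_walk =
  fixes p :: "'a::countable \<Rightarrow> 'a \<Rightarrow> real" and \<pi> :: "'a \<Rightarrow> ennreal"
    and W :: "(int \<Rightarrow> 'a \<times> real) measure" and L :: "'a \<Rightarrow> (nat \<Rightarrow> 'a \<times> real) measure"
  assumes sets_W [measurable_cong]: "sets W = sets path_space"
    and sets_L [measurable_cong]: "\<And>i. sets (L i) = sets path_space"
    and prob_L: "\<And>i. prob_space (L i)"
    and distr_shift: "\<And>m. distr W path_space (path_shift m) = W"
    and start: "\<And>i. emeasure W {\<omega>. fst (\<omega> 0) = i} = \<pi> i"
    and \<pi>_pos: "\<And>i. 0 < \<pi> i" and \<pi>_fin: "\<And>i. \<pi> i < \<infinity>"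
    and markov: "\<And>i H B. H \<in> sets path_space \<Longrightarrow> B \<in> sets path_space \<Longrightarrow>
      emeasure W {\<omega>. fst (\<omega> 0) = i \<and> past \<omega> \<in> H \<and> fut \<omega> \<in> B} =
      emeasure W {\<omega>. fst (\<omega> 0) = i \<and> past \<omega> \<in> H} * emeasure (L i) B"
    and first_step: "\<And>i j. emeasure (L i) {\<eta>. fst (\<eta> 1) = j} = ennreal (p i j)"
    and returns: "\<And>i. AE \<eta> in L i. \<exists>n\<ge>1. fst (\<eta> n) = i"
    and ess_unique: "ess_unique_stationary_measure p \<pi>"
    and divergent: "AE \<omega> in W. past_divergent \<omega>"
begin

section \<open>Shift invariance, mass transport and the Markov property at time 0\<close>

lemma space_W [simp]: "space W = UNIV"
  using sets_eq_imp_space_eq[OF sets_W] by simp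

lemma space_L [simp]: "space (L i) = UNIV"
  using sets_eq_imp_space_eq[OF sets_L] by simp

lemma emeasure_W_0: "AE \<omega> in W. \<not> P \<omega> \<Longrightarrow> emeasure W {\<omega>. P \<omega>} = 0"
  using emeasure_eq_0_AE[of P W] by simp

lemma AE_path_shift: "AE \<omega> in W. P \<omega> \<Longrightarrow> AE \<omega> in W. \<forall>m. P (path_shift m \<omega>)"
  unfolding AE_all_countable
proof
  fix m assume "AE \<omega> in W. P \<omega>"
  then have "AE \<omega> in distr W path_space (path_shift m). P \<omega>" unfolding distr_shift .
  then show "AE \<omega> in W. P (path_shift m \<omega>)" by (rule AE_distrD[rotated]) measurable
qed

lemma nn_integral_path_shift:
  assumes [measurable]: "f \<in> borel_measurable path_space"
  shows "(\<integral>\<^sup>+ \<omega>. f (path_shift m \<omega>) \<partial>W) = (\<integral>\<^sup>+ \<omega>. f \<omega> \<partial>W)"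
  by (subst (2) distr_shift[of m, symmetric], subst nn_integral_distr) measurable

lemma emeasure_path_shift:
  assumes [measurable]: "Measurable.pred path_space P"
  shows "emeasure W {\<omega>. P (path_shift m \<omega>)} = emeasure W {\<omega>. P \<omega>}"
  using nn_integral_path_shift[of "\<lambda>\<omega>. of_bool (P \<omega>)" m]
  by (simp add: nn_integral_of_bool)

lemma emeasure_cong_AE:
  assumes [measurable]: "Measurable.pred path_space P" "Measurable.pred path_space Q"
    and "AE \<omega> in W. P \<omega> \<longleftrightarrow> Q \<omega>"
  shows "emeasure W {\<omega>. P \<omega>} = emeasure W {\<omega>. Q \<omega>}"
  by (rule emeasure_eq_AE) (use assms(3) in simp, measurable)

text \<open>After interchanging sum and integral, each summand is moved by its own shift.\<close>

lemma mass_transport: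
  fixes f :: "int \<Rightarrow> (int \<Rightarrow> 'a \<times> real) \<Rightarrow> ennreal"
  assumes [measurable]: "\<And>n. f n \<in> borel_measurable path_space"
  shows "(\<integral>\<^sup>+ \<omega>. (\<integral>\<^sup>+ n. f n \<omega> \<partial>count_space UNIV) \<partial>W) =
    (\<integral>\<^sup>+ \<omega>. (\<integral>\<^sup>+ n. f n (path_shift (- n) \<omega>) \<partial>count_space UNIV) \<partial>W)"
  by (subst (1 2) nn_integral_count_space_nn_integral) (simp_all add: nn_integral_path_shift)

text \<open>The case in which every path sends unit mass to at most one time and time
  \<open>0\<close> receives it from at most one: both sums of indicators are then indicators
  themselves.\<close>

lemma emeasure_transport:
  fixes G :: "int \<Rightarrow> (int \<Rightarrow> 'a \<times> real) \<Rightarrow> bool"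
  assumes [measurable]: "\<And>n. Measurable.pred path_space (G n)"
    and "\<And>\<omega> m n. G m \<omega> \<Longrightarrow> G n \<omega> \<Longrightarrow> m = n"
    and "\<And>\<omega> m n. G m (path_shift (- m) \<omega>) \<Longrightarrow> G n (path_shift (- n) \<omega>) \<Longrightarrow> m = n"
  shows "emeasure W {\<omega>. \<exists>n. G n \<omega>} = emeasure W {\<omega>. \<exists>n. G n (path_shift (- n) \<omega>)}"
  using mass_transport[of "\<lambda>n \<omega>. of_bool (G n \<omega>)"]
  by (simp add: nn_integral_count_of_bool_unique[OF assms(2)] nn_integral_count_of_bool_unique[OF assms(3)]
      nn_integral_of_bool[where N = W])

lemma emeasure_start_le:
  assumes [measurable]: "Measurable.pred path_space E" and "\<And>\<omega>. E \<omega> \<Longrightarrow> fst (\<omega> 0) = i"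
  shows "emeasure W {\<omega>. E \<omega>} \<le> \<pi> i" "emeasure W {\<omega>. E \<omega>} < \<infinity>"
proof -
  show "emeasure W {\<omega>. E \<omega>} \<le> \<pi> i"
    unfolding start[symmetric] by (rule emeasure_mono) (use assms(2) in blast, measurable)
  then show "emeasure W {\<omega>. E \<omega>} < \<infinity>" using \<pi>_fin[of i] by (rule le_less_trans)
qed

lemma nn_integral_markov:
  assumes [measurable]: "Measurable.pred path_space H" "f \<in> borel_measurable path_space"
  shows "(\<integral>\<^sup>+ \<omega>. of_bool (fst (\<omega> 0) = i \<and> H (past \<omega>)) * f (fut \<omega>) \<partial>W) =
    emeasure W {\<omega>. fst (\<omega> 0) = i \<and> H (past \<omega>)} * (\<integral>\<^sup>+ \<eta>. f \<eta> \<partial>L i)"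
proof -
  let ?g = "\<lambda>\<omega>. of_bool (fst (\<omega> 0) = i \<and> H (past \<omega>)) :: ennreal"
  let ?c = "emeasure W {\<omega>. fst (\<omega> 0) = i \<and> H (past \<omega>)}"
  have g [measurable]: "?g \<in> borel_measurable W" by measurable
  have "distr (density W ?g) path_space fut = density (L i) (\<lambda>_. ?c)"
  proof (rule measure_eqI)
    fix B assume "B \<in> sets (distr (density W ?g) path_space fut)"
    then have [measurable]: "B \<in> sets path_space" by simp
    have "emeasure (distr (density W ?g) path_space fut) B =
        emeasure W {\<omega>. fst (\<omega> 0) = i \<and> past \<omega> \<in> Collect H \<and> fut \<omega> \<in> B}"
      by (subst emeasure_distr_density_of_bool) auto
    also have "\<dots> = ?c * emeasure (L i) B"
      by (subst markov) auto
    finally show "emeasure (distr (density W ?g) path_space fut) B = emeasure (density (L i) (\<lambda>_. ?c)) B"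
      by (simp add: emeasure_density nn_integral_cmult_indicator)
  qed (simp add: sets_L)
  then have "(\<integral>\<^sup>+ \<eta>. f \<eta> \<partial>distr (density W ?g) path_space fut) = (\<integral>\<^sup>+ \<eta>. f \<eta> \<partial>density (L i) (\<lambda>_. ?c))"
    by simp
  then show ?thesis
    by (simp add: nn_integral_distr nn_integral_density nn_integral_cmult)
qed

lemma emeasure_markov:
  assumes [measurable]: "Measurable.pred path_space H" "Measurable.pred path_space Q"
  shows "emeasure W {\<omega>. fst (\<omega> 0) = i \<and> H (past \<omega>) \<and> Q (fut \<omega>)} =
    emeasure W {\<omega>. fst (\<omega> 0) = i \<and> H (past \<omega>)} * emeasure (L i) {\<eta>. Q \<eta>}"
  using markov[of "Collect H" "Collect Q" i] by simp

lemma emeasure_markov_start: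
  assumes [measurable]: "Measurable.pred path_space Q"
  shows "emeasure W {\<omega>. fst (\<omega> 0) = i \<and> Q (fut \<omega>)} = \<pi> i * emeasure (L i) {\<eta>. Q \<eta>}"
  using emeasure_markov[of "\<lambda>_. True" Q i] by (simp add: start)

text \<open>The route from two-sided records to the ladder chain: \<open>markov\<close> factors the
  exceptional event, and the factor belonging to the past does not vanish.\<close>

lemma AE_L_if_AE_W:
  assumes [measurable]: "Measurable.pred path_space H" "Measurable.pred path_space Q"
    and pos: "0 < emeasure W {\<omega>. fst (\<omega> 0) = i \<and> H (past \<omega>)}"
    and ae: "AE \<omega> in W. fst (\<omega> 0) = i \<and> H (past \<omega>) \<longrightarrow> Q (fut \<omega>)"
  shows "AE \<eta> in L i. Q \<eta>"
proof -
  have "emeasure W {\<omega>. fst (\<omega> 0) = i \<and> H (past \<omega>) \<and> \<not> Q (fut \<omega>)} = 0"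
    using ae by (intro emeasure_W_0) (auto elim: eventually_mono)
  then have "emeasure (L i) {\<eta>. \<not> Q \<eta>} = 0"
    using pos by (subst (asm) emeasure_markov) auto
  then show ?thesis
    by (subst AE_iff_measurable[OF _ refl]) auto
qed

lemma AE_L_if_AE_W_start:
  assumes [measurable]: "Measurable.pred path_space Q"
    and ae: "AE \<omega> in W. Q (fut \<omega>)"
  shows "AE \<eta> in L i. Q \<eta>"
  using assms \<pi>_pos[of i] by (intro AE_L_if_AE_W[of "\<lambda>_. True"]) (auto simp: start)

lemma AE_W_if_AE_L:
  assumes ae: "\<And>i. AE \<eta> in L i. Q i \<eta>" and meas [measurable]: "\<And>i. Measurable.pred path_space (Q i)"
  shows "AE \<omega> in W. Q (fst (\<omega> 0)) (fut \<omega>)"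
proof -
  have "AE \<omega> in W. fst (\<omega> 0) = i \<longrightarrow> Q i (fut \<omega>)" for i
  proof -
    have "emeasure (L i) {\<eta>. \<not> Q i \<eta>} = 0"
      using ae[of i] emeasure_eq_0_AE[of "\<lambda>\<eta>. \<not> Q i \<eta>" "L i"] by simp
    then have "emeasure W {\<omega>. fst (\<omega> 0) = i \<and> \<not> Q i (fut \<omega>)} = 0"
      by (subst emeasure_markov_start) auto
    then show ?thesis
      by (subst AE_iff_measurable[OF _ refl]) auto
  qed
  then have "AE \<omega> in W. \<forall>i. fst (\<omega> 0) = i \<longrightarrow> Q i (fut \<omega>)"
    unfolding AE_all_countable by blast
  then show ?thesis by (rule eventually_mono) blast
qed

text \<open>A single return, required at all shifts simultaneously, means that no visit is the last
  one.\<close>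

lemma AE_infinitely_many_visits:
  "AE \<omega> in W. \<forall>n. \<exists>m>n. fst (\<omega> m) = fst (\<omega> 0)"
proof -
  have "AE \<omega> in W. \<exists>n\<ge>1. fst (fut \<omega> n) = fst (\<omega> 0)"
    by (rule AE_W_if_AE_L[of "\<lambda>i \<eta>. \<exists>n\<ge>1. fst (\<eta> n) = i"]) (use returns in auto)
  then have "AE \<omega> in W. \<exists>m>0. fst (\<omega> m) = fst (\<omega> 0)"
  proof (rule AE_mp, intro AE_I2 impI)
    fix \<omega> assume "\<exists>n\<ge>1. fst (fut \<omega> n) = fst (\<omega> 0)"
    then obtain n where "n \<ge> 1" "fst (\<omega> (int n)) = fst (\<omega> 0)" by (auto simp: fut_def)
    then show "\<exists>m>0. fst (\<omega> m) = fst (\<omega> 0)" by (intro exI[of _ "int n"]) auto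
  qed
  from AE_path_shift[OF this] show ?thesis
  proof (rule AE_mp, intro AE_I2 impI allI)
    fix \<omega> n assume *: "\<forall>m. \<exists>k>0. fst (path_shift m \<omega> k) = fst (path_shift m \<omega> 0)"
    show "\<exists>m>n. fst (\<omega> m) = fst (\<omega> 0)"
    proof (rule unbounded_above_if_no_greatest[of _ 0])
      fix n assume "fst (\<omega> n) = fst (\<omega> 0)"
      moreover obtain k where "k > 0" "fst (\<omega> (k + n)) = fst (\<omega> n)"
        using *[rule_format, of n] by (auto simp: path_shift_apply)
      ultimately show "\<exists>m>n. fst (\<omega> m) = fst (\<omega> 0)" by (intro exI[of _ "k + n"]) auto
    qed simp
  qed
qed

text \<open>The shifts of the event that \<open>E\<close> occurs at time \<open>0\<close> for the last time are disjoint, so by mass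
  transport the expected number of visits to \<open>i\<close> on this event is at most \<open>\<pi> i\<close>. But the chain visits
  \<open>i\<close> infinitely often.\<close>

lemma AE_occurs_later:
  assumes [measurable]: "Measurable.pred path_space E" and E: "\<And>\<omega>. E \<omega> \<Longrightarrow> fst (\<omega> 0) = i"
  shows "AE \<omega> in W. E \<omega> \<longrightarrow> (\<exists>k>0. E (path_shift k \<omega>))"
proof -
  define T where "T \<omega> \<longleftrightarrow> E \<omega> \<and> (\<forall>k>0. \<not> E (path_shift k \<omega>))" for \<omega>
  have [measurable]: "Measurable.pred path_space T" unfolding T_def by measurable
  have T_unique: "m = n" if "T (path_shift m \<omega>)" "T (path_shift n \<omega>)" for m n \<omega>
  proof (rule linorder_cases[of m n])
    assume "m < n"
    then have "\<not> E (path_shift (n - m) (path_shift m \<omega>))" using that(1) unfolding T_def by (metis diff_gt_0_iff_gt)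
    then show ?thesis using that(2) by (simp add: T_def)
  next
    assume "n < m"
    then have "\<not> E (path_shift (m - n) (path_shift n \<omega>))" using that(2) unfolding T_def by (metis diff_gt_0_iff_gt)
    then show ?thesis using that(1) by (simp add: T_def)
  qed
  let ?f = "\<lambda>n \<omega>. of_bool (n \<ge> 0 \<and> fst (\<omega> n) = i \<and> T \<omega>) :: ennreal"
  have "(\<integral>\<^sup>+ \<omega>. (\<integral>\<^sup>+ n. ?f n \<omega> \<partial>count_space UNIV) \<partial>W) =
      (\<integral>\<^sup>+ \<omega>. (\<integral>\<^sup>+ n. ?f n (path_shift (- n) \<omega>) \<partial>count_space UNIV) \<partial>W)"
    by (rule mass_transport) measurable
  also have "\<dots> \<le> (\<integral>\<^sup>+ \<omega>. of_bool (fst (\<omega> 0) = i) \<partial>W)"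
  proof (rule nn_integral_mono)
    fix \<omega>
    have "(\<integral>\<^sup>+ n. ?f n (path_shift (- n) \<omega>) \<partial>count_space UNIV) =
        of_bool (\<exists>n. n \<ge> 0 \<and> fst (path_shift (- n) \<omega> n) = i \<and> T (path_shift (- n) \<omega>))"
      by (rule nn_integral_count_of_bool_unique) (use T_unique in force)
    also have "\<dots> \<le> of_bool (fst (\<omega> 0) = i)" by (auto simp: path_shift_apply)
    finally show "(\<integral>\<^sup>+ n. ?f n (path_shift (- n) \<omega>) \<partial>count_space UNIV) \<le> of_bool (fst (\<omega> 0) = i)" .
  qed
  also have "\<dots> = \<pi> i" by (simp add: nn_integral_of_bool start)
  also have "\<dots> < \<infinity>" by (rule \<pi>_fin)
  finally have fin: "(\<integral>\<^sup>+ \<omega>. (\<integral>\<^sup>+ n. ?f n \<omega> \<partial>count_space UNIV) \<partial>W) < \<infinity>" .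
  have "(\<lambda>\<omega>. \<integral>\<^sup>+ n. ?f n \<omega> \<partial>count_space UNIV) \<in> borel_measurable W"
    by (rule borel_measurable_nn_integral_count) measurable
  with fin have "AE \<omega> in W. (\<integral>\<^sup>+ n. ?f n \<omega> \<partial>count_space UNIV) \<noteq> \<infinity>"
    by (intro nn_integral_PInf_AE) auto
  then show ?thesis using AE_infinitely_many_visits
  proof eventually_elim
    case (elim \<omega>)
    show ?case
    proof (rule ccontr)
      assume "\<not> ?case"
      then have T: "T \<omega>" "fst (\<omega> 0) = i" using E by (auto simp: T_def)
      have "infinite {n. n \<ge> 0 \<and> fst (\<omega> n) = i \<and> T \<omega>}"
        using infinite_if_unbounded_above[of "\<lambda>n. fst (\<omega> n) = i" 0] elim(2) T by simp
      from nn_integral_count_of_bool_infinite[OF this] elim(1) show False by simp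
    qed
  qed
qed

end

section \<open>Consecutive records and their states\<close>

definition consecutive :: "(int \<Rightarrow> bool) \<Rightarrow> int \<Rightarrow> int \<Rightarrow> bool" where
  "consecutive A m n \<longleftrightarrow> m < n \<and> A m \<and> A n \<and> (\<forall>k. m < k \<and> k < n \<longrightarrow> \<not> A k)"

lemma measurable_consecutive [measurable]:
  assumes [measurable]: "\<And>k. Measurable.pred N (\<lambda>\<omega>. A \<omega> k)"
  shows "Measurable.pred N (\<lambda>\<omega>. consecutive (A \<omega>) m n)"
  unfolding consecutive_def by measurable

lemma consecutive_add: "consecutive (\<lambda>k. A (k + a)) m n \<longleftrightarrow> consecutive A (m + a) (n + a)"
proof -
  have "(\<forall>k. m < k \<and> k < n \<longrightarrow> \<not> A (k + a)) \<longleftrightarrow> (\<forall>k. m + a < k \<and> k < n + a \<longrightarrow> \<not> A k)"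
    by (metis add_less_cancel_right diff_add_cancel)
  then show ?thesis by (simp add: consecutive_def)
qed

lemma consecutive_right_unique: "consecutive A m n \<Longrightarrow> consecutive A m n' \<Longrightarrow> n = n'"
  unfolding consecutive_def by (metis linorder_neqE)

lemma consecutive_left_unique: "consecutive A m n \<Longrightarrow> consecutive A m' n \<Longrightarrow> m = m'"
  unfolding consecutive_def by (metis linorder_neqE)

lemma ex_consecutive_right: "(\<exists>n. consecutive A m n) \<longleftrightarrow> A m \<and> (\<exists>n>m. A n)"
proof
  assume *: "A m \<and> (\<exists>n>m. A n)"
  then obtain k where "A k \<and> m < k" by blast
  then obtain l where l: "A l \<and> m < l" "\<And>j. A j \<and> m < j \<Longrightarrow> l \<le> j"
    using ex_least_int[of "\<lambda>k. A k \<and> m < k" k m] by (metis less_le)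
  then have "consecutive A m l" using * unfolding consecutive_def by (meson not_less)
  then show "\<exists>n. consecutive A m n" ..
qed (auto simp: consecutive_def)

lemma ex_consecutive_left: "(\<exists>m. consecutive A m n) \<longleftrightarrow> A n \<and> (\<exists>m<n. A m)"
proof
  assume *: "A n \<and> (\<exists>m<n. A m)"
  then obtain k where "A k \<and> k < n" by blast
  then obtain l where l: "A l \<and> l < n" "\<And>j. A j \<and> j < n \<Longrightarrow> j \<le> l"
    using ex_greatest_int[of "\<lambda>k. A k \<and> k < n" k n] by (metis less_le)
  then have "consecutive A l n" using * unfolding consecutive_def by (meson not_less)
  then show "\<exists>m. consecutive A m n" ..
qed (auto simp: consecutive_def)

lemma ex_uminus_int: "(\<exists>n::int. P (- n)) \<longleftrightarrow> (\<exists>n. P n)"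
  by (metis minus_minus)

definition record_at :: "'a \<Rightarrow> (int \<Rightarrow> 'a \<times> real) \<Rightarrow> int \<Rightarrow> bool" where
  "record_at i \<omega> k \<longleftrightarrow> fst (\<omega> k) = i \<and> strict_record \<omega> k"

lemma measurable_record_at [measurable]:
  "Measurable.pred path_space (\<lambda>\<omega>. record_at i \<omega> k)"
  unfolding record_at_def by measurable

lemma record_at_path_shift [simp]: "record_at i (path_shift m \<omega>) k \<longleftrightarrow> record_at i \<omega> (k + m)"
  by (simp add: record_at_def path_shift_apply)

section \<open>Recurrence of events and records in both directions of time\<close>

context stationary_walk
begin

lemma AE_if_emeasure_le:
  assumes [measurable]: "Measurable.pred path_space P" "Measurable.pred path_space Q"
    and "\<And>\<omega>. Q \<omega> \<Longrightarrow> P \<omega>" "emeasure W {\<omega>. P \<omega>} \<le> emeasure W {\<omega>. Q \<omega>}"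
    and "emeasure W {\<omega>. P \<omega>} < \<infinity>"
  shows "AE \<omega> in W. P \<omega> \<longrightarrow> Q \<omega>"
proof -
  have sub: "{\<omega>. Q \<omega>} \<subseteq> {\<omega>. P \<omega>}" using assms(3) by auto
  have "{\<omega>. Q \<omega>} \<in> sets W" "{\<omega>. P \<omega>} \<in> sets W" by measurable
  then have "emeasure W ({\<omega>. P \<omega>} - {\<omega>. Q \<omega>}) = emeasure W {\<omega>. P \<omega>} - emeasure W {\<omega>. Q \<omega>}"
    using sub assms(4,5) emeasure_mono[OF sub, of W]
    by (intro emeasure_Diff) (auto simp: top_unique)
  also have "\<dots> = 0" using assms(4,5) by (intro diff_eq_0_ennreal) auto
  also have "{\<omega>. P \<omega>} - {\<omega>. Q \<omega>} = {\<omega>. P \<omega> \<and> \<not> Q \<omega>}" by auto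
  finally show ?thesis
    by (subst AE_iff_measurable[OF _ refl]) auto
qed

lemma emeasure_sum_unique:
  fixes P :: "'i::countable \<Rightarrow> _"
  assumes [measurable]: "\<And>m. Measurable.pred path_space (P m)"
    and "\<And>\<omega> m n. P m \<omega> \<Longrightarrow> P n \<omega> \<Longrightarrow> m = n"
  shows "(\<integral>\<^sup>+ m. emeasure W {\<omega>. P m \<omega>} \<partial>count_space UNIV) = emeasure W {\<omega>. \<exists>m. P m \<omega>}"
proof -
  have "(\<integral>\<^sup>+ m. emeasure W {\<omega>. P m \<omega>} \<partial>count_space UNIV) =
      (\<integral>\<^sup>+ m. (\<integral>\<^sup>+ \<omega>. of_bool (P m \<omega>) \<partial>W) \<partial>count_space UNIV)"
    by (subst nn_integral_of_bool[where N = W]) auto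
  also have "\<dots> = (\<integral>\<^sup>+ \<omega>. (\<integral>\<^sup>+ m. of_bool (P m \<omega>) \<partial>count_space UNIV) \<partial>W)"
    by (rule nn_integral_count_space_nn_integral[symmetric]) auto
  also have "\<dots> = (\<integral>\<^sup>+ \<omega>. of_bool (\<exists>m. P m \<omega>) \<partial>W)"
    by (intro nn_integral_cong nn_integral_count_of_bool_unique) (rule assms(2))
  also have "\<dots> = emeasure W {\<omega>. \<exists>m. P m \<omega>}"
    by (subst nn_integral_of_bool[where N = W]) auto
  finally show ?thesis .
qed

lemma emeasure_sum_start:
  assumes [measurable]: "Measurable.pred path_space P"
  shows "(\<integral>\<^sup>+ i. emeasure W {\<omega>. fst (\<omega> k) = i \<and> P \<omega>} \<partial>count_space UNIV) = emeasure W {\<omega>. P \<omega>}"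
  using emeasure_sum_unique[of "\<lambda>i \<omega>. fst (\<omega> k) = i \<and> P \<omega>"] by simp

text \<open>The returns are given for the forward direction only, so the backward one is obtained by
  counting. Each occurrence of \<open>E\<close> sends its mass to the next occurrence, which exists
  almost everywhere. Hence the occurrences that have a predecessor carry the full mass of
  \<open>E\<close>, and as this mass is finite, the others form a null set.\<close>

lemma AE_occurs_earlier:
  assumes [measurable]: "Measurable.pred path_space E" and E: "\<And>\<omega>. E \<omega> \<Longrightarrow> fst (\<omega> 0) = i"
  shows "AE \<omega> in W. E \<omega> \<longrightarrow> (\<exists>k<0. E (path_shift k \<omega>))"
proof -
  let ?A = "\<lambda>\<omega> k. E (path_shift k \<omega>)"
  have A_shift: "consecutive (?A (path_shift a \<omega>)) m n \<longleftrightarrow> consecutive (?A \<omega>) (m + a) (n + a)" for a m n \<omega>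
    using consecutive_add[of "?A \<omega>" a m n] by simp
  have later: "AE \<omega> in W. E \<omega> \<longrightarrow> (\<exists>k>0. E (path_shift k \<omega>))"
    by (rule AE_occurs_later[where i = i]) (auto dest: E)
  have fin: "emeasure W {\<omega>. E \<omega>} < \<infinity>"
    by (rule emeasure_start_le[where i = i]) (auto dest: E)
  have "emeasure W {\<omega>. E \<omega>} = emeasure W {\<omega>. E \<omega> \<and> (\<exists>k>0. E (path_shift k \<omega>))}"
    by (rule emeasure_cong_AE) (measurable, use later in auto)
  also have "\<dots> = emeasure W {\<omega>. \<exists>n. consecutive (?A \<omega>) 0 n}"
    by (simp add: ex_consecutive_right)
  also have "\<dots> = emeasure W {\<omega>. \<exists>n. consecutive (?A (path_shift (- n) \<omega>)) 0 n}"
    by (rule emeasure_transport)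
      (measurable, auto simp only: A_shift add_0 right_minus dest: consecutive_right_unique consecutive_left_unique)
  also have "\<dots> = emeasure W {\<omega>. E \<omega> \<and> (\<exists>k<0. E (path_shift k \<omega>))}"
    using ex_consecutive_left[of "?A _" 0] ex_uminus_int[of "\<lambda>n. consecutive (?A _) n 0"]
    by (simp only: A_shift add_0 right_minus path_shift_0)
  finally have eq: "emeasure W {\<omega>. E \<omega>} = emeasure W {\<omega>. E \<omega> \<and> (\<exists>k<0. E (path_shift k \<omega>))}" .
  with fin have "AE \<omega> in W. E \<omega> \<longrightarrow> E \<omega> \<and> (\<exists>k<0. E (path_shift k \<omega>))"
    by (intro AE_if_emeasure_le[of E "\<lambda>\<omega>. E \<omega> \<and> (\<exists>k<0. E (path_shift k \<omega>))"]) simp_all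
  then show ?thesis by (rule eventually_mono) blast
qed

lemma AE_occurs_both:
  assumes [measurable]: "Measurable.pred path_space E" and E: "\<And>\<omega>. E \<omega> \<Longrightarrow> fst (\<omega> 0) = i"
  shows "AE \<omega> in W. (\<exists>k. E (path_shift k \<omega>)) \<longrightarrow>
    (\<forall>n. (\<exists>m>n. E (path_shift m \<omega>)) \<and> (\<exists>m<n. E (path_shift m \<omega>)))"
proof -
  have later: "AE \<omega> in W. E \<omega> \<longrightarrow> (\<exists>k>0. E (path_shift k \<omega>))"
    by (rule AE_occurs_later[where i = i]) (auto dest: E)
  have earlier: "AE \<omega> in W. E \<omega> \<longrightarrow> (\<exists>k<0. E (path_shift k \<omega>))"
    by (rule AE_occurs_earlier[where i = i]) (auto dest: E)
  show ?thesis
    using AE_path_shift[OF later] AE_path_shift[OF earlier]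
  proof eventually_elim
    case (elim \<omega>)
    show ?case
    proof (intro impI allI)
      fix n assume "\<exists>k. E (path_shift k \<omega>)"
      then obtain k where k: "E (path_shift k \<omega>)" ..
      have "\<exists>m>n. E (path_shift m \<omega>)"
      proof (rule unbounded_above_if_no_greatest[of "\<lambda>m. E (path_shift m \<omega>)", OF k])
        fix n assume "E (path_shift n \<omega>)"
        then obtain k where "k > 0" "E (path_shift (k + n) \<omega>)" using elim(1) by auto
        then show "\<exists>m>n. E (path_shift m \<omega>)" by (intro exI[of _ "k + n"]) auto
      qed
      moreover have "\<exists>m<n. E (path_shift m \<omega>)"
      proof (rule unbounded_below_if_no_least[of "\<lambda>m. E (path_shift m \<omega>)", OF k])
        fix n assume "E (path_shift n \<omega>)"
        then obtain k where "k < 0" "E (path_shift (k + n) \<omega>)" using elim(2) by auto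
        then show "\<exists>m<n. E (path_shift m \<omega>)" by (intro exI[of _ "k + n"]) auto
      qed
      ultimately show "(\<exists>m>n. E (path_shift m \<omega>)) \<and> (\<exists>m<n. E (path_shift m \<omega>))" ..
    qed
  qed
qed

lemma AE_record_at_both:
  "AE \<omega> in W. \<forall>i. (\<exists>k. record_at i \<omega> k) \<longrightarrow>
    (\<forall>n. (\<exists>m>n. record_at i \<omega> m) \<and> (\<exists>m<n. record_at i \<omega> m))"
  unfolding AE_all_countable
proof
  fix i
  show "AE \<omega> in W. (\<exists>k. record_at i \<omega> k) \<longrightarrow>
    (\<forall>n. (\<exists>m>n. record_at i \<omega> m) \<and> (\<exists>m<n. record_at i \<omega> m))"
    using AE_occurs_both[of "\<lambda>\<omega>. record_at i \<omega> 0" i] by (simp add: record_at_def path_shift_apply)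
qed

text \<open>One record is enough: it occurs at some state, and records at that state then recur in
  both directions.\<close>

lemma AE_strict_record_both:
  "AE \<omega> in W. \<forall>n. (\<exists>m>n. strict_record \<omega> m) \<and> (\<exists>m<n. strict_record \<omega> m)"
  using AE_record_at_both divergent
proof eventually_elim
  case (elim \<omega>)
  obtain k where "strict_record \<omega> k" using past_divergent_record[OF elim(2)] by blast
  then have "\<exists>l. record_at (fst (\<omega> k)) \<omega> l" by (auto simp: record_at_def)
  with elim(1) show ?case using record_at_def by metis
qed

text \<open>The ladder measure before normalisation, written \<open>\<rho>\<close> in the overview;
  see \<open>ladder_measure_eq\<close>. Its total mass may be infinite.\<close>

definition record_weight :: "'a \<Rightarrow> ennreal" where
  "record_weight i = emeasure W {\<omega>. record_at i \<omega> 0}"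

definition record_states :: "'a set" where
  "record_states = {i. record_weight i > 0}"

lemma record_weight_finite: "record_weight i < \<infinity>"
  unfolding record_weight_def by (rule emeasure_start_le) (auto simp: record_at_def)

text \<open>The countably many states of weight \<open>0\<close> contribute a null set in total, and
  shift invariance extends this to all times.\<close>

lemma AE_record_at_record_states:
  "AE \<omega> in W. \<forall>k. strict_record \<omega> k \<longrightarrow> fst (\<omega> k) \<in> record_states"
proof -
  have "AE \<omega> in W. \<forall>i. record_at i \<omega> 0 \<longrightarrow> i \<in> record_states"
    unfolding AE_all_countable
  proof
    fix i
    show "AE \<omega> in W. record_at i \<omega> 0 \<longrightarrow> i \<in> record_states"
    proof (cases "i \<in> record_states")
      case False
      then have "emeasure W {\<omega>. record_at i \<omega> 0} = 0"
        by (simp add: record_states_def record_weight_def not_gr_zero)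
      then have "AE \<omega> in W. \<not> record_at i \<omega> 0"
        by (subst AE_iff_measurable[OF _ refl]) auto
      then show ?thesis by (rule eventually_mono) blast
    qed simp
  qed
  from AE_path_shift[OF this] show ?thesis
    by (rule eventually_mono) (auto simp: record_at_def path_shift_apply)
qed

lemma not_AE_False: "\<not> (AE \<omega> in W. False)"
proof
  assume "AE \<omega> in W. False"
  then have "emeasure W {\<omega>. fst (\<omega> 0) = undefined} = 0"
    by (intro emeasure_W_0) (auto elim: eventually_mono)
  with \<pi>_pos[of undefined] show False by (simp add: start)
qed

lemma record_states_nonempty: "record_states \<noteq> {}"
proof
  assume "record_states = {}"
  with AE_record_at_record_states have "AE \<omega> in W. \<forall>k. \<not> strict_record \<omega> k" by simp
  with AE_strict_record_both have "AE \<omega> in W. False" by eventually_elim blast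
  with not_AE_False show False ..
qed

text \<open>The event \<open>D\<close> that some record occurs at state \<open>j\<close> is shift invariant and, as such records have no
  first one, determined by the past up to any time. Hence \<open>l \<mapsto> W(M\<^sub>0 = l, D)\<close> is stationary for \<open>p\<close>,
  thus a multiple of \<open>\<pi>\<close>, which makes \<open>D\<close> independent of every cylinder event and so of its own
  complement.\<close>

lemma AE_ex_record_at:
  assumes j: "j \<in> record_states"
  shows "AE \<omega> in W. \<exists>k. record_at j \<omega> k"
proof -
  define D where "D m \<omega> \<longleftrightarrow> (\<exists>k\<le>m. record_at j \<omega> k)" for m :: int and \<omega>
  \<comment> \<open>The event \<open>D 0\<close> expressed through the past, the form in which the
    Markov property applies to it.\<close>
  define H where "H \<eta> \<longleftrightarrow> (\<exists>n. fst (\<eta> n) = j \<and> (\<forall>m>n. psum \<eta> n < psum \<eta> m))" for \<eta> :: "nat \<Rightarrow> 'a \<times> real"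
  have [measurable]: "Measurable.pred path_space (D m)" for m unfolding D_def by measurable
  have [measurable]: "Measurable.pred path_space H" unfolding H_def by measurable
  have D_H: "D 0 \<omega> \<longleftrightarrow> H (past \<omega>)" for \<omega>
  proof -
    have "D 0 \<omega> \<longleftrightarrow> (\<exists>n. record_at j \<omega> (- int n))"
      unfolding D_def by (metis nonpos_int_cases neg_le_0_iff_le of_nat_0_le_iff)
    then show ?thesis by (simp add: H_def record_at_def strict_record_past) (simp add: past_def)
  qed
  have D_shift: "D 0 (path_shift m \<omega>) \<longleftrightarrow> D m \<omega>" for m \<omega>
    unfolding D_def by (metis (no_types, lifting) add_le_same_cancel2 diff_add_cancel record_at_path_shift)
  have AE_D: "AE \<omega> in W. \<forall>m. D m \<omega> \<longleftrightarrow> (\<exists>k. record_at j \<omega> k)"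
    using AE_record_at_both by eventually_elim (unfold D_def, meson less_imp_le)
  define \<nu> where "\<nu> l = emeasure W {\<omega>. fst (\<omega> 0) = l \<and> H (past \<omega>)}" for l
  have \<nu>_shift: "\<nu> l = emeasure W {\<omega>. fst (\<omega> m) = l \<and> D m \<omega>}" for l m
    using emeasure_path_shift[of "\<lambda>\<omega>. fst (\<omega> 0) = l \<and> D 0 \<omega>" m]
    by (simp add: \<nu>_def D_shift flip: D_H) (simp add: path_shift_apply)
  have "stationary_measure p \<nu>"
    unfolding stationary_measure_def
  proof (intro conjI allI)
    show "\<nu> l < \<infinity>" for l unfolding \<nu>_def by (rule emeasure_start_le) auto
    have "record_weight j \<le> \<nu> j"
      unfolding \<nu>_def record_weight_def by (intro emeasure_mono) (auto simp: record_at_def D_def simp flip: D_H)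
    then show "\<exists>l. \<nu> l \<noteq> 0" using j by (intro exI[of _ j]) (auto simp: record_states_def)
    fix m
    have "(\<integral>\<^sup>+ l. \<nu> l * ennreal (p l m) \<partial>count_space UNIV) =
      (\<integral>\<^sup>+ l. emeasure W {\<omega>. fst (\<omega> 0) = l \<and> D 0 \<omega> \<and> fst (\<omega> 1) = m} \<partial>count_space UNIV)"
      unfolding \<nu>_def first_step[symmetric] D_H
      by (subst emeasure_markov[symmetric]) (auto simp: fut_def)
    also have "\<dots> = emeasure W {\<omega>. D 0 \<omega> \<and> fst (\<omega> 1) = m}"
      by (rule emeasure_sum_start) measurable
    \<comment> \<open>Moving the cutoff from \<open>0\<close> to \<open>1\<close> changes nothing
      almost everywhere, because records at \<open>j\<close> are unbounded below as soon as there is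
      one.\<close>
    also have "\<dots> = emeasure W {\<omega>. fst (\<omega> 1) = m \<and> D 1 \<omega>}"
      by (rule emeasure_cong_AE) (measurable, rule eventually_mono[OF AE_D], blast)
    also have "\<dots> = \<nu> m" by (rule \<nu>_shift[symmetric])
    finally show "(\<integral>\<^sup>+ l. \<nu> l * ennreal (p l m) \<partial>count_space UNIV) = \<nu> m" .
  qed
  then have "\<exists>a>0. \<forall>l. \<nu> l = ennreal a * \<pi> l"
    using ess_unique by (simp add: ess_unique_stationary_measure_def)
  then obtain a where a: "a > 0" "\<And>l. \<nu> l = ennreal a * \<pi> l" by auto
  let ?D = "\<lambda>\<omega>. \<exists>k. record_at j \<omega> k"
  \<comment> \<open>A cylinder whose window starts at \<open>m\<close> is an event of the future of
    \<open>m\<close>, while \<open>D m\<close> belongs to the past of \<open>m\<close>. The relation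
    \<open>\<nu> l = ennreal a * \<pi> l\<close> turns the resulting product into a fixed fraction
    of the mass of the cylinder.\<close>
  have fut: "emeasure W {\<omega>. fst (\<omega> m) = l \<and> Q (fut (path_shift m \<omega>)) \<and> ?D \<omega>} =
      ennreal a * emeasure W {\<omega>. fst (\<omega> m) = l \<and> Q (fut (path_shift m \<omega>))}"
    if [measurable]: "Measurable.pred path_space Q" for Q m l
  proof -
    have "emeasure W {\<omega>. fst (\<omega> m) = l \<and> Q (fut (path_shift m \<omega>)) \<and> ?D \<omega>} =
        emeasure W {\<omega>. fst (\<omega> m) = l \<and> D m \<omega> \<and> Q (fut (path_shift m \<omega>))}"
      by (rule emeasure_cong_AE) (measurable, rule eventually_mono[OF AE_D], blast)
    also have "\<dots> = emeasure W {\<omega>. fst (\<omega> 0) = l \<and> H (past \<omega>) \<and> Q (fut \<omega>)}"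
      using emeasure_path_shift[of "\<lambda>\<omega>. fst (\<omega> 0) = l \<and> H (past \<omega>) \<and> Q (fut \<omega>)" m]
      by (simp add: D_shift path_shift_apply flip: D_H)
    also have "\<dots> = \<nu> l * emeasure (L l) {\<eta>. Q \<eta>}"
      unfolding \<nu>_def by (rule emeasure_markov) measurable
    also have "\<dots> = ennreal a * emeasure W {\<omega>. fst (\<omega> 0) = l \<and> Q (fut \<omega>)}"
      by (subst emeasure_markov_start) (auto simp: a(2) mult.assoc)
    also have "\<dots> = ennreal a * emeasure W {\<omega>. fst (\<omega> m) = l \<and> Q (fut (path_shift m \<omega>))}"
      using emeasure_path_shift[of "\<lambda>\<omega>. fst (\<omega> 0) = l \<and> Q (fut \<omega>)" m]
      by (simp add: path_shift_apply)
    finally show ?thesis .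
  qed
  have "density W (\<lambda>\<omega>. of_bool (?D \<omega>)) = density W (\<lambda>_. ennreal a)"
  proof (rule cylinder_measure_eqI[where K = "\<lambda>n. {- int n..int n}" and J = "\<lambda>n. {1 - int n..int n}"])
    fix n x and B :: "int \<Rightarrow> real set"
    assume B [measurable]: "\<And>k. B k \<in> sets borel"
    \<comment> \<open>The window from \<open>- n\<close> to \<open>n\<close>, read as a future that
      starts at \<open>- n\<close>. Coordinate \<open>k\<close> of that future carries the increment
      of the following time, whence \<open>int k + 1 - int n\<close>.\<close>
    define Q where "Q \<eta> \<longleftrightarrow> (\<forall>k\<le>2 * n. fst (\<eta> k) = x (int k - int n)) \<and>
      (\<forall>k<2 * n. snd (\<eta> k) \<in> B (int k + 1 - int n))" for \<eta> :: "nat \<Rightarrow> 'a \<times> real"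
    have [measurable]: "Measurable.pred path_space Q" unfolding Q_def by measurable
    have cyl: "\<omega> \<in> cylinder {- int n..int n} {1 - int n..int n} x B \<longleftrightarrow>
        fst (\<omega> (- int n)) = x (- int n) \<and> Q (fut (path_shift (- int n) \<omega>))" for \<omega>
    proof -
      have 1: "(\<forall>k\<in>{- int n..int n}. fst (\<omega> k) = x k) \<longleftrightarrow> (\<forall>k\<le>2 * n. fst (\<omega> (int k - int n)) = x (int k - int n))"
      proof safe
        fix k assume *: "\<forall>k\<le>2 * n. fst (\<omega> (int k - int n)) = x (int k - int n)" "k \<in> {- int n..int n}"
        then have "nat (k + int n) \<le> 2 * n" by auto
        then show "fst (\<omega> k) = x k" using * *(1)[rule_format, of "nat (k + int n)"] by simp
      qed auto
      have 2: "(\<forall>k\<in>{1 - int n..int n}. snd (\<omega> k) \<in> B k) \<longleftrightarrow>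
        (\<forall>k<2 * n. snd (\<omega> (int k + 1 - int n)) \<in> B (int k + 1 - int n))"
      proof safe
        fix k assume *: "\<forall>k<2 * n. snd (\<omega> (int k + 1 - int n)) \<in> B (int k + 1 - int n)" "k \<in> {1 - int n..int n}"
        then have "nat (k + int n - 1) < 2 * n" by auto
        then show "snd (\<omega> k) \<in> B k" using * *(1)[rule_format, of "nat (k + int n - 1)"] by simp
      qed auto
      show ?thesis
        unfolding cylinder_def mem_Collect_eq 1 2 Q_def fut_def
        by (auto simp: path_shift_apply dest: spec[of _ 0])
    qed
    then have cyl_eq: "cylinder {- int n..int n} {1 - int n..int n} x B =
        {\<omega>. fst (\<omega> (- int n)) = x (- int n) \<and> Q (fut (path_shift (- int n) \<omega>))}" (is "?C = _")
      by auto
    have [measurable]: "?C \<in> sets W" unfolding cyl_eq by measurable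
    have "emeasure (density W (\<lambda>\<omega>. of_bool (?D \<omega>))) ?C = (\<integral>\<^sup>+ \<omega>. of_bool (\<omega> \<in> ?C \<and> ?D \<omega>) \<partial>W)"
      by (subst emeasure_density) (auto intro!: nn_integral_cong simp: indicator_def)
    also have "\<dots> = emeasure W {\<omega>. \<omega> \<in> ?C \<and> ?D \<omega>}"
      by (subst nn_integral_of_bool[where N = W]) auto
    also have "\<dots> = ennreal a * emeasure W ?C"
      using fut[of Q "- int n" "x (- int n)"] by (simp add: cyl cyl_eq)
    also have "\<dots> = emeasure (density W (\<lambda>_. ennreal a)) ?C"
      by (subst emeasure_density) (auto simp: nn_integral_cmult_indicator)
    finally show "emeasure (density W (\<lambda>\<omega>. of_bool (?D \<omega>))) ?C = emeasure (density W (\<lambda>_. ennreal a)) ?C" .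
  next
    fix x :: "int \<Rightarrow> 'a"
    define C where "C = {\<omega> :: int \<Rightarrow> 'a \<times> real. fst (\<omega> 0) = x 0}"
    have cyl: "cylinder {- int 0..int 0} {1 - int 0..int 0} x (\<lambda>_. UNIV) = C"
      by (auto simp: cylinder_def C_def)
    have [measurable]: "C \<in> sets W" unfolding C_def by measurable
    have "emeasure (density W (\<lambda>\<omega>. of_bool (?D \<omega>))) C = (\<integral>\<^sup>+ \<omega>. of_bool (?D \<omega>) * indicator C \<omega> \<partial>W)"
      by (subst emeasure_density) auto
    also have "\<dots> \<le> (\<integral>\<^sup>+ \<omega>. indicator C \<omega> \<partial>W)"
      by (intro nn_integral_mono) (auto simp: indicator_def)
    also have "\<dots> = \<pi> (x 0)" by (simp add: C_def start)
    finally show "emeasure (density W (\<lambda>\<omega>. of_bool (?D \<omega>)))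
        (cylinder {- int 0..int 0} {1 - int 0..int 0} x (\<lambda>_. UNIV)) \<noteq> \<infinity>"
      unfolding cyl using \<pi>_fin[of "x 0"] by (auto simp: top_unique)
  qed (auto simp: incseq_def sets_W UN_symmetric_int)
  then have "emeasure (density W (\<lambda>\<omega>. of_bool (?D \<omega>))) {\<omega>. \<not> ?D \<omega>} =
      emeasure (density W (\<lambda>_. ennreal a)) {\<omega>. \<not> ?D \<omega>}"
    by simp
  moreover have "emeasure (density W (\<lambda>\<omega>. of_bool (?D \<omega>))) {\<omega>. \<not> ?D \<omega>} = 0"
    by (subst emeasure_density) (auto simp: nn_integral_0_iff_AE indicator_def)
  moreover have "emeasure (density W (\<lambda>_. ennreal a)) {\<omega>. \<not> ?D \<omega>} = ennreal a * emeasure W {\<omega>. \<not> ?D \<omega>}"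
    by (subst emeasure_density) (auto simp: nn_integral_cmult_indicator)
  ultimately have "emeasure W {\<omega>. \<not> ?D \<omega>} = 0" using a(1) by simp
  then show ?thesis by (subst AE_iff_measurable[OF _ refl]) auto
qed

end

section \<open>Ladder epochs\<close>

lemma Inf_enat_Collect:
  "Inf {enat k | k. P k} = (if \<exists>k. P k then enat (LEAST k. P k) else \<infinity>)"
proof (cases "\<exists>k. P k")
  case True
  then have "P (LEAST k. P k)" by (rule LeastI_ex)
  then have "Inf {enat k | k. P k} = enat (LEAST k. P k)"
    by (intro cInf_eq_minimum) (auto intro: Least_le)
  with True show ?thesis by simp
next
  case False
  then have "{enat k | k. P k} = {}" by blast
  with False show ?thesis by (simp add: Inf_enat_def)
qed

lemma Inf_enat_Collect_eq_enat:
  "Inf {enat k | k. P k} = enat k \<longleftrightarrow> P k \<and> (\<forall>l<k. \<not> P l)"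
  unfolding Inf_enat_Collect
  by (auto intro: LeastI dest: not_less_Least) (metis LeastI linorder_neqE_nat not_less_Least)

lemma enat_less_Inf_Collect:
  "enat m < Inf {enat k | k. P k} \<longleftrightarrow> (\<forall>k\<le>m. \<not> P k)"
proof (cases "\<exists>k. P k")
  case True
  have "m < (LEAST k. P k) \<longleftrightarrow> (\<forall>k\<le>m. \<not> P k)"
    by (metis LeastI_ex[OF True] Least_le le_trans not_less)
  with True show ?thesis by (simp add: Inf_enat_Collect)
qed (auto simp: Inf_enat_Collect top_enat_def)

text \<open>The graph of one recursion step of \<open>ladder_epoch\<close>; as a relation it can be
  shifted and compared with records without an infimum in \<open>enat\<close>.\<close>

definition next_above :: "(nat \<Rightarrow> real) \<Rightarrow> nat \<Rightarrow> nat \<Rightarrow> bool" where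
  "next_above s m k \<longleftrightarrow> m < k \<and> s m < s k \<and> (\<forall>l. m < l \<and> l < k \<longrightarrow> s l \<le> s m)"

definition prefix_record :: "(nat \<Rightarrow> real) \<Rightarrow> nat \<Rightarrow> bool" where
  "prefix_record s k \<longleftrightarrow> (\<forall>j<k. s j < s k)"

lemma ladder_epoch_Suc_eq_enat:
  "ladder_epoch s (Suc n) = enat k \<longleftrightarrow> (\<exists>m. ladder_epoch s n = enat m \<and> next_above s m k)"
proof (cases "ladder_epoch s n")
  case (enat m)
  then show ?thesis
    by (auto simp: Inf_enat_Collect_eq_enat next_above_def)
qed simp

lemma ladder_epoch_1_eq_enat: "ladder_epoch s (Suc 0) = enat k \<longleftrightarrow> next_above s 0 k"
  unfolding ladder_epoch_Suc_eq_enat by (simp add: zero_enat_def)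

lemma ex_next_above: "m < k \<Longrightarrow> s m < s k \<Longrightarrow> \<exists>l\<le>k. next_above s m l"
proof -
  assume *: "m < k" "s m < s k"
  let ?P = "\<lambda>l. m < l \<and> s m < s l"
  have "?P (LEAST l. ?P l)" using * by (intro LeastI[of ?P k]) auto
  moreover have "(LEAST l. ?P l) \<le> k" using * by (intro Least_le) auto
  moreover have "s l \<le> s m" if "m < l" "l < (LEAST l. ?P l)" for l
    using not_less_Least[OF that(2)] that(1) by auto
  ultimately show ?thesis unfolding next_above_def by blast
qed

lemma prefix_record_next_above:
  assumes "prefix_record s m" "next_above s m k"
  shows "prefix_record s k"
  unfolding prefix_record_def
proof (intro allI impI)
  fix j assume "j < k"
  have "s j \<le> s m"
    using assms \<open>j < k\<close> by (cases j m rule: linorder_cases) (auto simp: prefix_record_def next_above_def)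
  then show "s j < s k" using assms(2) by (auto simp: next_above_def)
qed

text \<open>Once \<open>s m\<close> exceeds everything before it, the first value above
  \<open>s m\<close> is the next record. This identifies ladder epochs with records.\<close>

lemma next_above_iff:
  assumes "prefix_record s m"
  shows "next_above s m k \<longleftrightarrow>
    m < k \<and> prefix_record s k \<and> (\<forall>l. m < l \<and> l < k \<longrightarrow> \<not> prefix_record s l)"
proof
  assume n: "next_above s m k"
  then show "m < k \<and> prefix_record s k \<and> (\<forall>l. m < l \<and> l < k \<longrightarrow> \<not> prefix_record s l)"
    using prefix_record_next_above[OF assms n] by (force simp: next_above_def prefix_record_def)
next
  assume *: "m < k \<and> prefix_record s k \<and> (\<forall>l. m < l \<and> l < k \<longrightarrow> \<not> prefix_record s l)"
  then obtain l where "l \<le> k" "next_above s m l"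
    using ex_next_above[of m k s] by (auto simp: prefix_record_def)
  moreover from this have "prefix_record s l" "m < l"
    using prefix_record_next_above[OF assms] by (auto simp: next_above_def)
  ultimately show "next_above s m k" using * by (metis le_neq_implies_less)
qed

lemma prefix_record_ladder_epoch: "ladder_epoch s n = enat k \<Longrightarrow> prefix_record s k"
proof (induction n arbitrary: k)
  case 0
  then show ?case by (simp add: zero_enat_def prefix_record_def)
next
  case (Suc n)
  then obtain m where "ladder_epoch s n = enat m" "next_above s m k"
    unfolding ladder_epoch_Suc_eq_enat by blast
  with Suc.IH show ?case using prefix_record_next_above by blast
qed

text \<open>Induction along records: the greatest record below \<open>k\<close> is an epoch, and
  \<open>k\<close> is its successor. The start is \<open>0\<close>, which is vacuously a
  record.\<close>

lemma ex_ladder_epoch: "prefix_record s k \<Longrightarrow> \<exists>n. ladder_epoch s n = enat k"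
proof (induction k rule: less_induct)
  case (less k)
  show ?case
  proof (cases k)
    case 0
    then show ?thesis by (intro exI[of _ 0]) (simp add: zero_enat_def)
  next
    case (Suc k')
    let ?P = "\<lambda>m. m < k \<and> prefix_record s m"
    define m where "m = (GREATEST m. ?P m)"
    have "?P 0" using Suc by (simp add: prefix_record_def)
    then have m: "?P m" unfolding m_def by (rule GreatestI_nat[where b = k]) auto
    have le: "l \<le> m" if "?P l" for l
      unfolding m_def using that by (rule Greatest_le_nat[where b = k]) auto
    have "\<not> prefix_record s l" if "m < l" "l < k" for l
      using le[of l] that by auto
    then have "next_above s m k"
      using m less.prems by (subst next_above_iff) auto
    moreover obtain n where "ladder_epoch s n = enat m" using less.IH m by blast
    ultimately have "ladder_epoch s (Suc n) = enat k" unfolding ladder_epoch_Suc_eq_enat by blast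
    then show ?thesis ..
  qed
qed

lemma ladder_epoch_less:
  "n < n' \<Longrightarrow> ladder_epoch s n' = enat k' \<Longrightarrow> \<exists>k<k'. ladder_epoch s n = enat k"
proof (induction n' arbitrary: k')
  case (Suc n')
  then obtain m where m: "ladder_epoch s n' = enat m" "m < k'"
    unfolding ladder_epoch_Suc_eq_enat next_above_def by blast
  show ?case
  proof (cases "n = n'")
    case False
    then show ?thesis using Suc.IH[OF _ m(1)] Suc.prems(1) m(2) by (metis less_antisym less_trans)
  qed (use m in auto)
qed simp

lemma ladder_epoch_finite:
  assumes "\<And>m. \<exists>k>m. prefix_record s k"
  shows "\<exists>k. ladder_epoch s n = enat k"
proof (induction n)
  case (Suc n)
  then obtain m where m: "ladder_epoch s n = enat m" by blast
  obtain k where "k > m" "prefix_record s k" using assms by blast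
  then obtain l where "next_above s m l" using ex_next_above[of m k s] by (auto simp: prefix_record_def)
  with m show ?case unfolding ladder_epoch_Suc_eq_enat by blast
qed (simp add: zero_enat_def)

lemma next_above_plus: "next_above (\<lambda>l. s (m + l) - c) a b \<longleftrightarrow> next_above s (m + a) (m + b)"
proof -
  have "(\<forall>l. a < l \<and> l < b \<longrightarrow> s (m + l) \<le> s (m + a)) \<longleftrightarrow>
      (\<forall>l. m + a < l \<and> l < m + b \<longrightarrow> s l \<le> s (m + a))"
  proof (intro iffI allI impI)
    fix l assume *: "\<forall>l. a < l \<and> l < b \<longrightarrow> s (m + l) \<le> s (m + a)" "m + a < l \<and> l < m + b"
    then have "a < l - m \<and> l - m < b" "m + (l - m) = l" by auto
    with *(1) show "s l \<le> s (m + a)" by metis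
  qed auto
  then show ?thesis by (simp add: next_above_def)
qed

text \<open>The pathwise half of the Markov property of the ladder chain: after the first epoch, the
  construction restarts with the shifted and recentred walk.\<close>

lemma ladder_epoch_plus:
  assumes "ladder_epoch s (Suc 0) = enat m"
  shows "ladder_epoch s (Suc n) = enat k \<longleftrightarrow>
    (\<exists>l. k = m + l \<and> ladder_epoch (\<lambda>l. s (m + l) - s m) n = enat l)"
proof (induction n arbitrary: k)
  case 0
  show ?case unfolding assms by (auto simp: zero_enat_def)
next
  case (Suc n)
  have "ladder_epoch s (Suc (Suc n)) = enat k \<longleftrightarrow>
      (\<exists>l. ladder_epoch (\<lambda>l. s (m + l) - s m) n = enat l \<and> next_above s (m + l) k)"
    unfolding ladder_epoch_Suc_eq_enat[of s "Suc n"] Suc.IH by auto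
  also have "\<dots> \<longleftrightarrow> (\<exists>l l'. ladder_epoch (\<lambda>l. s (m + l) - s m) n = enat l \<and>
      k = m + l' \<and> next_above s (m + l) (m + l'))"
  proof -
    have "next_above s (m + l) k \<longleftrightarrow> (\<exists>l'. k = m + l' \<and> next_above s (m + l) (m + l'))" for l
    proof
      assume "next_above s (m + l) k"
      moreover from this have "k = m + (k - m)" by (simp add: next_above_def)
      ultimately show "\<exists>l'. k = m + l' \<and> next_above s (m + l) (m + l')" by metis
    qed auto
    then show ?thesis by simp
  qed
  finally show ?case
    unfolding ladder_epoch_Suc_eq_enat[of "\<lambda>l. s (m + l) - s m" n] next_above_plus[of s m] by auto
qed

text \<open>A one-sided path stores the \<open>k\<close>-th increment in coordinate
  \<open>k - 1\<close>, whence the change of index.\<close>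

definition path_ladder :: "nat \<Rightarrow> (nat \<Rightarrow> 'a \<times> real) \<Rightarrow> 'a option" where
  "path_ladder = ladder_chain (\<lambda>k \<eta>. fst (\<eta> k)) (\<lambda>k \<eta>. snd (\<eta> (k - 1)))"

lemma path_ladder_eq_Some:
  "path_ladder n \<eta> = Some j \<longleftrightarrow> (\<exists>k. ladder_epoch (psum \<eta>) n = enat k \<and> fst (\<eta> k) = j)"
proof -
  have "walk (\<lambda>k \<eta>. snd (\<eta> (k - 1))) k \<eta> = psum \<eta> k" for k
    by (simp add: walk_def psum_def sum.atLeast1_atMost_eq)
  then show ?thesis
    by (cases "ladder_epoch (psum \<eta>) n") (auto simp: path_ladder_def ladder_chain_def)
qed

lemma pred_next_above: "Measurable.pred path_space (\<lambda>\<eta>. next_above (psum \<eta>) m k)"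
  unfolding next_above_def not_less[symmetric] by measurable

lemma pred_ladder_epoch: "Measurable.pred path_space (\<lambda>\<eta>. ladder_epoch (psum \<eta>) n = enat k)"
proof (induction n arbitrary: k)
  case 0
  show ?case unfolding ladder_epoch.simps by (rule measurable_const) simp
next
  case (Suc n)
  show ?case
    unfolding ladder_epoch_Suc_eq_enat
    by (intro pred_intros_countable pred_intros_logic Suc.IH pred_next_above)
qed

text \<open>The exceptional value is one that is awkward to describe directly, such as
  \<open>\<infinity>\<close> or \<open>None\<close>; its preimage is what the countably many other
  preimages leave over.\<close>

lemma measurable_count_space_except:
  fixes f :: "'b \<Rightarrow> 'c::countable"
  assumes "\<And>x. x \<noteq> c \<Longrightarrow> Measurable.pred N (\<lambda>w. f w = x)"
  shows "f \<in> measurable N (count_space UNIV)"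
proof -
  have *: "f -` {x} \<inter> space N \<in> sets N" if "x \<noteq> c" for x
    using assms[OF that] by (auto simp: pred_def vimage_def Int_def conj_commute)
  have "f -` {x} \<inter> space N \<in> sets N" for x
  proof (cases "x = c")
    case True
    have "f -` {c} \<inter> space N = space N - (\<Union>x\<in>-{c}. f -` {x} \<inter> space N)" by auto
    also have "\<dots> \<in> sets N"
      using * by (intro sets.Diff sets.top sets.countable_UN'') auto
    finally show ?thesis using True by simp
  qed (rule *)
  then show ?thesis by (auto simp: measurable_count_space_eq_countable)
qed

lemma measurable_ladder_epoch [measurable]:
  "(\<lambda>\<eta>. ladder_epoch (psum \<eta>) n) \<in> measurable path_space (count_space UNIV)"
  by (rule measurable_count_space_except[where c = \<infinity>]) (auto intro: pred_ladder_epoch)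

lemma measurable_path_ladder [measurable]:
  "(path_ladder n :: _ \<Rightarrow> 'a::countable option) \<in> measurable path_space (count_space UNIV)"
proof (rule measurable_count_space_except[where c = None])
  fix x :: "'a option" assume "x \<noteq> None"
  then obtain j where "x = Some j" by blast
  then show "Measurable.pred path_space (\<lambda>\<eta>. path_ladder n \<eta> = x)"
    by (simp only: path_ladder_eq_Some) measurable
qed

lemma prefix_record_fut:
  assumes "strict_record \<omega> (int k)"
  shows "prefix_record (psum (fut \<omega>)) k"
  using assms by (auto simp: strict_record_def prefix_record_def simp flip: level_fut)

text \<open>Prefix records have level at least \<open>0\<close>, and a record at time
  \<open>0\<close> keeps everything before it below \<open>0\<close>.\<close>

lemma strict_record_iff_prefix_record:
  assumes "strict_record \<omega> 0"
  shows "strict_record \<omega> (int k) \<longleftrightarrow> prefix_record (psum (fut \<omega>)) k"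
proof
  assume p: "prefix_record (psum (fut \<omega>)) k"
  show "strict_record \<omega> (int k)"
    unfolding strict_record_def
  proof (intro allI impI)
    fix j assume j: "j < int k"
    have "0 \<le> level \<omega> (int k)"
    proof (cases "k = 0")
      case False
      then have "psum (fut \<omega>) 0 < psum (fut \<omega>) k" using p by (simp add: prefix_record_def)
      then show ?thesis unfolding level_fut by (simp add: psum_def)
    qed simp
    show "level \<omega> j < level \<omega> (int k)"
    proof (cases "0 \<le> j")
      case True
      then have "level \<omega> (int (nat j)) < level \<omega> (int k)"
        using p j unfolding level_fut by (auto simp: prefix_record_def)
      with True show ?thesis by simp
    next
      case False
      then have "level \<omega> j < level \<omega> 0" using assms by (simp add: strict_record_def)
      with \<open>0 \<le> level \<omega> (int k)\<close> show ?thesis by simp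
    qed
  qed
qed (rule prefix_record_fut)

lemma path_ladder_1_fut:
  assumes "strict_record \<omega> 0"
  shows "path_ladder (Suc 0) (fut \<omega>) = Some j \<longleftrightarrow>
    (\<exists>n. consecutive (strict_record \<omega>) 0 n \<and> fst (\<omega> n) = j)"
proof -
  have "next_above (psum (fut \<omega>)) 0 k \<longleftrightarrow> consecutive (strict_record \<omega>) 0 (int k)" for k
  proof -
    have "(\<forall>l. 0 < l \<and> l < k \<longrightarrow> \<not> strict_record \<omega> (int l)) \<longleftrightarrow>
        (\<forall>l. 0 < l \<and> l < int k \<longrightarrow> \<not> strict_record \<omega> l)"
      by (auto dest!: zero_less_imp_eq_int)
    moreover have "prefix_record (psum (fut \<omega>)) 0" by (simp add: prefix_record_def)
    ultimately show ?thesis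
      by (simp add: next_above_iff consecutive_def assms flip: strict_record_iff_prefix_record)
  qed
  then have "path_ladder (Suc 0) (fut \<omega>) = Some j \<longleftrightarrow>
      (\<exists>k. consecutive (strict_record \<omega>) 0 (int k) \<and> fst (\<omega> (int k)) = j)"
    unfolding path_ladder_eq_Some ladder_epoch_1_eq_enat by (simp add: fut_def)
  also have "\<dots> \<longleftrightarrow> (\<exists>n. consecutive (strict_record \<omega>) 0 n \<and> fst (\<omega> n) = j)"
  proof
    assume "\<exists>n. consecutive (strict_record \<omega>) 0 n \<and> fst (\<omega> n) = j"
    then obtain n where n: "consecutive (strict_record \<omega>) 0 n" "fst (\<omega> n) = j" by blast
    then have "n = int (nat n)" by (simp add: consecutive_def)
    with n show "\<exists>k. consecutive (strict_record \<omega>) 0 (int k) \<and> fst (\<omega> (int k)) = j" by metis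
  qed auto
  finally show ?thesis .
qed

text \<open>Time \<open>0\<close> need not be a record here. Any later two-sided record is a prefix
  record of the future and hence a ladder epoch. This is why the conclusion reaches the ladder chain
  from every starting state, not only from states that carry records.\<close>

lemma infinite_path_ladder_fut:
  assumes "\<And>n. \<exists>m>n. record_at j \<omega> m"
  shows "infinite {n. path_ladder n (fut \<omega>) = Some j}"
proof -
  have "\<exists>n\<ge>N. path_ladder n (fut \<omega>) = Some j" for N
  proof -
    have "\<exists>m>k. prefix_record (psum (fut \<omega>)) m" for k
    proof -
      obtain m where "m > int k" "record_at j \<omega> m" using assms by blast
      then show ?thesis
        using prefix_record_fut[of \<omega> "nat m"] by (intro exI[of _ "nat m"]) (auto simp: record_at_def)
    qed
    from ladder_epoch_finite[OF this] obtain k where k: "ladder_epoch (psum (fut \<omega>)) N = enat k" by blast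
    obtain m where m: "m > int k" "record_at j \<omega> m" using assms by blast
    then obtain n where n: "ladder_epoch (psum (fut \<omega>)) n = enat (nat m)"
      using ex_ladder_epoch[OF prefix_record_fut[of \<omega> "nat m"]] by (auto simp: record_at_def)
    have "N \<le> n"
    proof (rule ccontr)
      assume "\<not> N \<le> n"
      then obtain l where "l < k" "ladder_epoch (psum (fut \<omega>)) n = enat l"
        using ladder_epoch_less[OF _ k, of n] by auto
      with n m(1) show False by auto
    qed
    moreover have "path_ladder n (fut \<omega>) = Some j"
      unfolding path_ladder_eq_Some using n m by (auto simp: record_at_def fut_def)
    ultimately show ?thesis by blast
  qed
  then show ?thesis unfolding infinite_nat_iff_unbounded_le by simp
qed

section \<open>The ladder chain\<close>

lemma return_time_finite_iff:
  "return_time Y A w < \<infinity> \<longleftrightarrow> (\<exists>n\<ge>1. Y n w \<in> Some ` A)"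
  unfolding return_time_def Inf_enat_Collect by auto

lemma enat_less_return_time_iff:
  "enat m < return_time Y A w \<longleftrightarrow> (\<forall>l. 1 \<le> l \<and> l \<le> m \<longrightarrow> Y l w \<notin> Some ` A)"
  unfolding return_time_def enat_less_Inf_Collect by auto

text \<open>The tail sum formula before integration: a mean return time becomes a sum over
  \<open>m\<close> of the probabilities of no return up to ladder index \<open>m\<close>.\<close>

lemma ennreal_of_enat_eq_count:
  "ennreal_of_enat t = (\<integral>\<^sup>+ m. of_bool (enat m < t) \<partial>count_space UNIV)"
proof (cases t)
  case (enat n)
  have "(\<integral>\<^sup>+ m. of_bool (enat m < t) \<partial>count_space UNIV) = (\<integral>\<^sup>+ m. indicator {..<n} m \<partial>count_space (UNIV :: nat set))"
    by (simp add: enat indicator_def)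
  then show ?thesis by (simp add: enat)
next
  case infinity
  then show ?thesis by (subst nn_integral_count_of_bool_infinite) auto
qed

section \<open>Stationarity, recurrence and transition probabilities of the ladder chain\<close>

context stationary_walk
begin

abbreviation prob_ladder :: "nat \<Rightarrow> 'a \<Rightarrow> 'a \<Rightarrow> ennreal" where
  "prob_ladder n i j \<equiv> emeasure (L i) {\<eta>. path_ladder n \<eta> = Some j}"

lemma record_weight_markov:
  assumes [measurable]: "Measurable.pred path_space Q"
  shows "emeasure W {\<omega>. record_at i \<omega> 0 \<and> Q (fut \<omega>)} = record_weight i * emeasure (L i) {\<eta>. Q \<eta>}"
  using emeasure_markov[of "\<lambda>\<eta>. \<forall>m>0. 0 < psum \<eta> m" Q i]
  by (simp add: record_weight_def record_at_def strict_record_past_0 conj_assoc)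

lemma AE_L_if_AE_record:
  assumes [measurable]: "Measurable.pred path_space Q"
    and i: "i \<in> record_states"
    and ae: "AE \<omega> in W. record_at i \<omega> 0 \<longrightarrow> Q (fut \<omega>)"
  shows "AE \<eta> in L i. Q \<eta>"
  using i ae by (intro AE_L_if_AE_W[of "\<lambda>\<eta>. \<forall>m>0. 0 < psum \<eta> m"])
    (auto simp: record_states_def record_weight_def record_at_def strict_record_past_0)

text \<open>Stationarity is transport along consecutive records: every record sends its mass to the
  next one, and almost every record has a predecessor from which it receives mass. The sum over
  \<open>i\<close> forgets the state of the predecessor.\<close>

lemma record_weight_stationary:
  "(\<integral>\<^sup>+ i. record_weight i * prob_ladder 1 i j \<partial>count_space UNIV) = record_weight j"
proof -
  let ?R = "strict_record"
  have sh: "consecutive (?R (path_shift (- n) \<omega>)) 0 n \<longleftrightarrow> consecutive (?R \<omega>) (- n) 0"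
    for n :: int and \<omega> :: "int \<Rightarrow> 'a \<times> real"
    using consecutive_add[of "?R \<omega>" "- n" 0 n] by (simp add: strict_record_shift[abs_def])
  have "(\<integral>\<^sup>+ i. record_weight i * prob_ladder 1 i j \<partial>count_space UNIV) =
    (\<integral>\<^sup>+ i. emeasure W {\<omega>. record_at i \<omega> 0 \<and> path_ladder 1 (fut \<omega>) = Some j} \<partial>count_space UNIV)"
    by (subst record_weight_markov) auto
  also have "\<dots> = emeasure W {\<omega>. \<exists>i. record_at i \<omega> 0 \<and> path_ladder 1 (fut \<omega>) = Some j}"
    by (rule emeasure_sum_unique) (auto simp: record_at_def)
  also have "\<dots> = emeasure W {\<omega>. \<exists>n. consecutive (?R \<omega>) 0 n \<and> fst (\<omega> n) = j}"
    by (rule arg_cong[where f = "emeasure W"])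
      (auto simp: record_at_def path_ladder_1_fut consecutive_def)
  also have "\<dots> = emeasure W {\<omega>. \<exists>n. consecutive (?R (path_shift (- n) \<omega>)) 0 n \<and> fst (path_shift (- n) \<omega> n) = j}"
  proof (rule emeasure_transport)
    show "Measurable.pred path_space (\<lambda>\<omega>. consecutive (?R \<omega>) 0 n \<and> fst (\<omega> n) = j)" for n
      by measurable
    show "m = n" if "consecutive (?R \<omega>) 0 m \<and> fst (\<omega> m) = j"
      "consecutive (?R \<omega>) 0 n \<and> fst (\<omega> n) = j" for m n \<omega>
      using that by (metis consecutive_right_unique)
    show "m = n" if "consecutive (?R (path_shift (- m) \<omega>)) 0 m \<and> fst (path_shift (- m) \<omega> m) = j"
      "consecutive (?R (path_shift (- n) \<omega>)) 0 n \<and> fst (path_shift (- n) \<omega> n) = j" for m n \<omega>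
      using that unfolding sh by (metis consecutive_left_unique neg_equal_iff_equal)
  qed
  also have "\<dots> = emeasure W {\<omega>. \<exists>n. consecutive (?R \<omega>) (- n) 0 \<and> fst (\<omega> 0) = j}"
    unfolding sh by (simp add: path_shift_apply)
  also have "\<dots> = record_weight j"
    unfolding record_weight_def
  proof (rule emeasure_cong_AE)
    show "AE \<omega> in W. (\<exists>n. consecutive (?R \<omega>) (- n) 0 \<and> fst (\<omega> 0) = j) \<longleftrightarrow> record_at j \<omega> 0"
      using AE_strict_record_both
    proof eventually_elim
      case (elim \<omega>)
      have "(\<exists>n. consecutive (?R \<omega>) (- n) 0) \<longleftrightarrow> ?R \<omega> 0"
        unfolding ex_uminus_int[of "\<lambda>n. consecutive (?R \<omega>) n 0"] ex_consecutive_left using elim by blast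
      then show ?case by (auto simp: record_at_def)
    qed
  qed measurable
  finally show ?thesis .
qed

lemma AE_infinite_path_ladder:
  assumes j: "j \<in> record_states"
  shows "AE \<eta> in L i. infinite {n. path_ladder n \<eta> = Some j}"
proof -
  have [measurable]: "Measurable.pred path_space (\<lambda>\<eta>. infinite {n. path_ladder n \<eta> = Some j})"
    unfolding infinite_nat_iff_unbounded_le mem_Collect_eq by measurable
  have "AE \<omega> in W. infinite {n. path_ladder n (fut \<omega>) = Some j}"
    using AE_record_at_both AE_ex_record_at[OF j]
  proof eventually_elim
    case (elim \<omega>)
    then have "\<exists>m>n. record_at j \<omega> m" for n by auto
    then show ?case by (rule infinite_path_ladder_fut)
  qed
  then show ?thesis by (intro AE_L_if_AE_W_start) measurable
qed

lemma prob_ladder_sum_infinite: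
  assumes j: "j \<in> record_states"
  shows "(\<Sum>n. prob_ladder n i j) = \<infinity>"
proof -
  have "(\<Sum>n. prob_ladder n i j) = (\<integral>\<^sup>+ n. (\<integral>\<^sup>+ \<eta>. of_bool (path_ladder n \<eta> = Some j) \<partial>L i) \<partial>count_space UNIV)"
    by (simp add: nn_integral_count_space_nat nn_integral_of_bool[where N = "L i"])
  also have "\<dots> = (\<integral>\<^sup>+ \<eta>. (\<integral>\<^sup>+ n. of_bool (path_ladder n \<eta> = Some j) \<partial>count_space UNIV) \<partial>L i)"
    by (rule nn_integral_count_space_nn_integral[symmetric]) auto
  also have "\<dots> = (\<integral>\<^sup>+ \<eta>. \<infinity> \<partial>L i)"
  proof (rule nn_integral_cong_AE)
    show "AE \<eta> in L i. (\<integral>\<^sup>+ n. of_bool (path_ladder n \<eta> = Some j) \<partial>count_space UNIV) = (\<infinity> :: ennreal)"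
      using AE_infinite_path_ladder[OF j, of i]
      by (rule eventually_mono) (rule nn_integral_count_of_bool_infinite)
  qed
  also have "\<dots> = \<infinity>"
    using prob_space.emeasure_space_1[OF prob_L[of i]] by simp
  finally show ?thesis .
qed

lemma AE_return_state:
  assumes j: "j \<in> record_states"
  shows "AE \<eta> in L i. \<exists>n\<ge>1. path_ladder n \<eta> = Some j"
  using AE_infinite_path_ladder[OF j, of i]
  by (rule eventually_mono) (simp add: infinite_nat_iff_unbounded_le)

lemma AE_return_record_states:
  "AE \<eta> in L i. \<exists>n\<ge>1. path_ladder n \<eta> \<in> Some ` record_states"
proof -
  obtain j where "j \<in> record_states" using record_states_nonempty by blast
  then show ?thesis
    using AE_return_state[of j i] by (auto elim!: eventually_mono)
qed

text \<open>Started at a record, the first ladder epoch is the next record, and records occur only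
  at states of positive weight.\<close>

lemma AE_ladder_closed:
  assumes i: "i \<in> record_states"
  shows "AE \<eta> in L i. path_ladder 1 \<eta> \<in> Some ` record_states"
proof (rule AE_L_if_AE_record[OF _ i])
  show "Measurable.pred path_space (\<lambda>\<eta>. path_ladder 1 \<eta> \<in> Some ` record_states)"
    by measurable
  show "AE \<omega> in W. record_at i \<omega> 0 \<longrightarrow> path_ladder 1 (fut \<omega>) \<in> Some ` record_states"
    using AE_strict_record_both AE_record_at_record_states
  proof eventually_elim
    case (elim \<omega>)
    show ?case
    proof
      assume r: "record_at i \<omega> 0"
      then have "\<exists>n. consecutive (strict_record \<omega>) 0 n"
        unfolding ex_consecutive_right using elim(1) by (auto simp: record_at_def)
      then obtain n where n: "consecutive (strict_record \<omega>) 0 n" ..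
      then have "path_ladder (Suc 0) (fut \<omega>) = Some (fst (\<omega> n))"
        using r by (subst path_ladder_1_fut) (auto simp: record_at_def)
      moreover have "fst (\<omega> n) \<in> record_states" using n elim(2) by (simp add: consecutive_def)
      ultimately show "path_ladder 1 (fut \<omega>) \<in> Some ` record_states" by simp
    qed
  qed
qed

text \<open>The increments between \<open>- m\<close> and \<open>0\<close> are read forwards from
  \<open>- m\<close> on one side and backwards from \<open>0\<close> on the other.\<close>

lemma psum_fut_path_shift:
  assumes "l \<le> m"
  shows "psum (fut (path_shift (- int m) \<omega>)) l = psum (past \<omega>) m - psum (past \<omega>) (m - l)"
proof -
  have "psum (fut (path_shift (- int m) \<omega>)) l = level \<omega> (int l - int m) - level \<omega> (- int m)"
    by (simp add: level_shift flip: level_fut)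
  moreover have "int l - int m = - int (m - l)" using assms by simp
  ultimately show ?thesis by (simp only: level_past)
qed

text \<open>A strong Markov property obtained from \<open>markov\<close> at time \<open>0\<close>.
  Multiplying by \<open>\<pi> i\<close> moves the statement to \<open>W\<close>; for each value
  \<open>m\<close> of the first epoch, a shift by \<open>m\<close> makes that epoch the origin, so
  that what precedes it is an event of the past. In the end \<open>\<pi> i\<close>, being positive
  and finite, is cancelled.\<close>

lemma prob_ladder_Suc:
  "prob_ladder (Suc n) i j = (\<integral>\<^sup>+ k. prob_ladder 1 i k * prob_ladder n k j \<partial>count_space UNIV)"
proof -
  let ?e = "\<lambda>m \<eta>. ladder_epoch (psum \<eta>) (Suc 0) = enat m"
  \<comment> \<open>Seen from time \<open>0\<close>: the path is in state \<open>i\<close> at time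
    \<open>- m\<close> and first exceeds its level there at time \<open>0\<close>. Levels in the
    past are the negatives of \<open>psum\<close>, which reverses the inequalities.\<close>
  define H where "H m \<eta> \<longleftrightarrow> fst (\<eta> m) = i \<and> 0 < m \<and> 0 < psum \<eta> m \<and>
    (\<forall>l. 0 < l \<and> l < m \<longrightarrow> \<not> psum \<eta> l < psum \<eta> m)" for m and \<eta> :: "nat \<Rightarrow> 'a \<times> real"
  have H_meas [measurable]: "Measurable.pred path_space (H m)" for m unfolding H_def by measurable
  have H: "H m (past \<omega>) \<longleftrightarrow> fst (\<omega> (- int m)) = i \<and> ?e m (fut (path_shift (- int m) \<omega>))"
    for m and \<omega> :: "int \<Rightarrow> 'a \<times> real"
  proof -
    have "(\<forall>l. 0 < l \<and> l < m \<longrightarrow> psum (past \<omega>) m - psum (past \<omega>) (m - l) \<le> 0) \<longleftrightarrow>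
        (\<forall>l. 0 < l \<and> l < m \<longrightarrow> psum (past \<omega>) l \<ge> psum (past \<omega>) m)"
    proof (intro iffI allI impI)
      fix l assume *: "\<forall>l. 0 < l \<and> l < m \<longrightarrow> psum (past \<omega>) m - psum (past \<omega>) (m - l) \<le> 0" "0 < l \<and> l < m"
      then show "psum (past \<omega>) l \<ge> psum (past \<omega>) m" using *(1)[rule_format, of "m - l"] by simp
    qed auto
    moreover have "psum (past \<omega>) 0 = 0" by (simp add: psum_def)
    ultimately have "next_above (psum (fut (path_shift (- int m) \<omega>))) 0 m \<longleftrightarrow>
        0 < m \<and> 0 < psum (past \<omega>) m \<and> (\<forall>l. 0 < l \<and> l < m \<longrightarrow> psum (past \<omega>) m \<le> psum (past \<omega>) l)"
      unfolding next_above_def by (simp add: psum_fut_path_shift cong: conj_cong imp_cong)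
    then show ?thesis
      unfolding H_def ladder_epoch_1_eq_enat by (auto simp: past_def not_less)
  qed
  have split: "path_ladder (Suc n) (fut \<omega>) = Some j \<longleftrightarrow>
      (\<exists>m. ?e m (fut \<omega>) \<and> path_ladder n (fut (path_shift (int m) \<omega>)) = Some j)" for \<omega>
  proof -
    have s: "(\<lambda>l. psum (fut \<omega>) (m + l) - psum (fut \<omega>) m) = psum (fut (path_shift (int m) \<omega>))" for m
      by (rule ext) (simp add: level_shift add.commute flip: level_fut)
    have f: "fst (fut \<omega> (m + l)) = fst (fut (path_shift (int m) \<omega>) l)" for m l
      by (simp add: fut_def path_shift_apply add.commute)
    have ex: "\<exists>m. ?e m (fut \<omega>)" if "ladder_epoch (psum (fut \<omega>)) (Suc n) = enat k" for k
      using that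
    proof (cases n)
      case (Suc n')
      then show ?thesis using that ladder_epoch_less[of "Suc 0" "Suc n"] by blast
    qed blast
    show ?thesis
    proof
      assume "path_ladder (Suc n) (fut \<omega>) = Some j"
      then obtain k where k: "ladder_epoch (psum (fut \<omega>)) (Suc n) = enat k" "fst (fut \<omega> k) = j"
        unfolding path_ladder_eq_Some by blast
      obtain m where m: "?e m (fut \<omega>)" using ex[OF k(1)] by blast
      from k ladder_epoch_plus[OF m, of n k]
      obtain l where "k = m + l" "ladder_epoch (psum (fut (path_shift (int m) \<omega>))) n = enat l"
        unfolding s by blast
      then have "path_ladder n (fut (path_shift (int m) \<omega>)) = Some j"
        unfolding path_ladder_eq_Some using k(2) f by auto
      with m show "\<exists>m. ?e m (fut \<omega>) \<and> path_ladder n (fut (path_shift (int m) \<omega>)) = Some j" by blast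
    next
      assume "\<exists>m. ?e m (fut \<omega>) \<and> path_ladder n (fut (path_shift (int m) \<omega>)) = Some j"
      then obtain m l where m: "?e m (fut \<omega>)" "ladder_epoch (psum (fut (path_shift (int m) \<omega>))) n = enat l"
        "fst (fut (path_shift (int m) \<omega>) l) = j"
        unfolding path_ladder_eq_Some by blast
      then have "ladder_epoch (psum (fut \<omega>)) (Suc n) = enat (m + l)"
        unfolding ladder_epoch_plus[OF m(1)] s by blast
      with m(3) show "path_ladder (Suc n) (fut \<omega>) = Some j"
        unfolding path_ladder_eq_Some f[symmetric] by blast
    qed
  qed
  define C where "C m \<omega> \<longleftrightarrow> fst (\<omega> 0) = i \<and> ?e m (fut \<omega>)" for m and \<omega> :: "int \<Rightarrow> 'a \<times> real"
  have C_meas [measurable]: "Measurable.pred path_space (C m)" for m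
    unfolding C_def by measurable
  have C_unique: "C m \<omega> \<Longrightarrow> C m' \<omega> \<Longrightarrow> m = m'" for m m' \<omega>
    by (simp add: C_def)
  have shift: "emeasure W {\<omega>. fst (\<omega> (int m)) = k \<and> C m \<omega> \<and> Q (fut (path_shift (int m) \<omega>))} =
      emeasure W {\<omega>. fst (\<omega> 0) = k \<and> H m (past \<omega>) \<and> Q (fut \<omega>)}"
    if [measurable]: "Measurable.pred path_space Q" for m k Q
  proof -
    let ?P = "\<lambda>\<omega>. fst (\<omega> (int m)) = k \<and> C m \<omega> \<and> Q (fut (path_shift (int m) \<omega>))"
    have "emeasure W {\<omega>. ?P \<omega>} = emeasure W {\<omega>. ?P (path_shift (- int m) \<omega>)}"
      by (rule emeasure_path_shift[symmetric]) measurable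
    also have "\<dots> = emeasure W {\<omega>. fst (\<omega> 0) = k \<and> H m (past \<omega>) \<and> Q (fut \<omega>)}"
      unfolding H C_def by (rule arg_cong[where f = "emeasure W"]) (auto simp: path_shift_apply)
    finally show ?thesis .
  qed
  have B: "emeasure W {\<omega>. fst (\<omega> (int m)) = k \<and> C m \<omega> \<and> path_ladder n (fut (path_shift (int m) \<omega>)) = Some j} =
      emeasure W {\<omega>. fst (\<omega> (int m)) = k \<and> C m \<omega>} * prob_ladder n k j" for m k
  proof -
    have "emeasure W {\<omega>. fst (\<omega> (int m)) = k \<and> C m \<omega> \<and> path_ladder n (fut (path_shift (int m) \<omega>)) = Some j} =
        emeasure W {\<omega>. fst (\<omega> 0) = k \<and> H m (past \<omega>) \<and> path_ladder n (fut \<omega>) = Some j}"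
      by (rule shift) measurable
    also have "\<dots> = emeasure W {\<omega>. fst (\<omega> 0) = k \<and> H m (past \<omega>)} * prob_ladder n k j"
      by (rule emeasure_markov) measurable
    also have "emeasure W {\<omega>. fst (\<omega> 0) = k \<and> H m (past \<omega>)} = emeasure W {\<omega>. fst (\<omega> (int m)) = k \<and> C m \<omega>}"
      using shift[of "\<lambda>_. True" m k] by simp
    finally show ?thesis .
  qed
  have sum_k: "(\<integral>\<^sup>+ m. emeasure W {\<omega>. fst (\<omega> (int m)) = k \<and> C m \<omega>} \<partial>count_space UNIV) = \<pi> i * prob_ladder 1 i k" for k
  proof -
    have "(\<integral>\<^sup>+ m. emeasure W {\<omega>. fst (\<omega> (int m)) = k \<and> C m \<omega>} \<partial>count_space UNIV) =
        emeasure W {\<omega>. \<exists>m. fst (\<omega> (int m)) = k \<and> C m \<omega>}"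
    proof (rule emeasure_sum_unique)
      show "Measurable.pred path_space (\<lambda>\<omega>. fst (\<omega> (int m)) = k \<and> C m \<omega>)" for m by measurable
    qed (metis C_unique)
    also have "\<dots> = emeasure W {\<omega>. fst (\<omega> 0) = i \<and> path_ladder 1 (fut \<omega>) = Some k}"
      by (rule arg_cong[where f = "emeasure W"]) (auto simp: C_def path_ladder_eq_Some fut_def)
    also have "\<dots> = \<pi> i * prob_ladder 1 i k"
      by (rule emeasure_markov_start) measurable
    finally show ?thesis .
  qed
  have "\<pi> i * prob_ladder (Suc n) i j = emeasure W {\<omega>. fst (\<omega> 0) = i \<and> path_ladder (Suc n) (fut \<omega>) = Some j}"
    by (rule emeasure_markov_start[symmetric]) measurable
  also have "\<dots> = emeasure W {\<omega>. \<exists>m. C m \<omega> \<and> path_ladder n (fut (path_shift (int m) \<omega>)) = Some j}"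
    by (rule arg_cong[where f = "emeasure W"]) (auto simp: split C_def)
  also have "\<dots> = (\<integral>\<^sup>+ m. emeasure W {\<omega>. C m \<omega> \<and> path_ladder n (fut (path_shift (int m) \<omega>)) = Some j} \<partial>count_space UNIV)"
  proof (rule emeasure_sum_unique[symmetric])
    show "Measurable.pred path_space (\<lambda>\<omega>. C m \<omega> \<and> path_ladder n (fut (path_shift (int m) \<omega>)) = Some j)" for m
      by measurable
  qed (metis C_unique)
  also have "\<dots> = (\<integral>\<^sup>+ m. (\<integral>\<^sup>+ k. emeasure W {\<omega>. fst (\<omega> (int m)) = k \<and> C m \<omega>} * prob_ladder n k j \<partial>count_space UNIV) \<partial>count_space UNIV)"
    unfolding B[symmetric]
  proof (intro nn_integral_cong emeasure_sum_start[symmetric])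
    show "Measurable.pred path_space (\<lambda>\<omega>. C m \<omega> \<and> path_ladder n (fut (path_shift (int m) \<omega>)) = Some j)" for m
      by measurable
  qed
  also have "\<dots> = (\<integral>\<^sup>+ k. (\<integral>\<^sup>+ m. emeasure W {\<omega>. fst (\<omega> (int m)) = k \<and> C m \<omega>} * prob_ladder n k j \<partial>count_space UNIV) \<partial>count_space UNIV)"
    by (rule nn_integral_count_space_nn_integral) auto
  also have "\<dots> = (\<integral>\<^sup>+ k. \<pi> i * (prob_ladder 1 i k * prob_ladder n k j) \<partial>count_space UNIV)"
    by (simp add: nn_integral_multc sum_k mult.assoc)
  also have "\<dots> = \<pi> i * (\<integral>\<^sup>+ k. prob_ladder 1 i k * prob_ladder n k j \<partial>count_space UNIV)"
    by (rule nn_integral_cmult) auto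
  finally show ?thesis
    using \<pi>_pos[of i] \<pi>_fin[of i] by (auto simp: ennreal_mult_cancel_left)
qed

end

section \<open>Uniqueness of the stationary measure and mean return times\<close>

text \<open>Here \<open>G n i j\<close> is the \<open>n\<close>-step weight
  \<open>q\<^sup>n i j\<close> into one fixed state \<open>j\<close>. The expected number of visits
  to \<open>j\<close> is infinite from every \<open>i\<close>, so uniqueness will hold on the whole
  state space and not merely on a recurrent class.\<close>

locale recurrent_kernel =
  fixes q :: "'a::countable \<Rightarrow> 'a \<Rightarrow> ennreal" and G :: "nat \<Rightarrow> 'a \<Rightarrow> 'a \<Rightarrow> ennreal" and j :: 'a
  assumes G_0: "\<And>i. G 0 i j = of_bool (i = j)"
    and G_Suc: "\<And>n i. G (Suc n) i j = (\<integral>\<^sup>+ k. q i k * G n k j \<partial>count_space UNIV)"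
    and G_sum: "\<And>i. (\<Sum>n. G n i j) = \<infinity>"
begin

lemma sum_G_0: "(\<integral>\<^sup>+ k. \<mu> k * G 0 k j \<partial>count_space UNIV) = \<mu> j"
proof -
  have "(\<integral>\<^sup>+ k. \<mu> k * G 0 k j \<partial>count_space UNIV) = (\<integral>\<^sup>+ k. \<mu> j * indicator {j} k \<partial>count_space UNIV)"
    by (rule nn_integral_cong) (simp add: G_0 indicator_def)
  then show ?thesis by (simp add: nn_integral_cmult)
qed

text \<open>Associativity of kernels: the first step is charged to the measure instead of the
  iterated kernel.\<close>

lemma sum_G_Suc:
  "(\<integral>\<^sup>+ i. \<mu> i * G (Suc n) i j \<partial>count_space UNIV) =
    (\<integral>\<^sup>+ k. (\<integral>\<^sup>+ i. \<mu> i * q i k \<partial>count_space UNIV) * G n k j \<partial>count_space UNIV)"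
proof -
  have "(\<integral>\<^sup>+ i. \<mu> i * G (Suc n) i j \<partial>count_space UNIV) =
      (\<integral>\<^sup>+ i. (\<integral>\<^sup>+ k. \<mu> i * q i k * G n k j \<partial>count_space UNIV) \<partial>count_space UNIV)"
    by (simp add: G_Suc nn_integral_cmult mult.assoc)
  also have "\<dots> = (\<integral>\<^sup>+ k. (\<integral>\<^sup>+ i. \<mu> i * q i k * G n k j \<partial>count_space UNIV) \<partial>count_space UNIV)"
    by (rule nn_integral_count_space_nn_integral) auto
  finally show ?thesis by (simp add: nn_integral_multc)
qed

text \<open>The defect \<open>\<delta> = \<mu> - \<mu> q\<close> satisfies \<open>\<Sum>\<^sub>n \<delta> q\<^sup>n \<le> \<mu>\<close>, while \<open>\<Sum>\<^sub>n q\<^sup>n\<close> is infinite at \<open>j\<close>.\<close>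

lemma excessive_imp_invariant:
  assumes fin: "\<And>k. \<mu> k < \<infinity>"
    and exc: "\<And>k. (\<integral>\<^sup>+ i. \<mu> i * q i k \<partial>count_space UNIV) \<le> \<mu> k"
  shows "(\<integral>\<^sup>+ i. \<mu> i * q i k \<partial>count_space UNIV) = \<mu> k"
proof -
  define \<delta> where "\<delta> k = \<mu> k - (\<integral>\<^sup>+ i. \<mu> i * q i k \<partial>count_space UNIV)" for k
  have \<mu>: "\<mu> k = \<delta> k + (\<integral>\<^sup>+ i. \<mu> i * q i k \<partial>count_space UNIV)" for k
    unfolding \<delta>_def using exc[of k] by (rule diff_add_cancel_ennreal[symmetric])
  have step: "(\<integral>\<^sup>+ k. \<mu> k * G n k j \<partial>count_space UNIV) =
      (\<integral>\<^sup>+ k. \<delta> k * G n k j \<partial>count_space UNIV) + (\<integral>\<^sup>+ k. \<mu> k * G (Suc n) k j \<partial>count_space UNIV)" for n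
  proof -
    have "(\<integral>\<^sup>+ k. \<mu> k * G n k j \<partial>count_space UNIV) =
        (\<integral>\<^sup>+ k. \<delta> k * G n k j + (\<integral>\<^sup>+ i. \<mu> i * q i k \<partial>count_space UNIV) * G n k j \<partial>count_space UNIV)"
      by (rule nn_integral_cong) (subst \<mu>, rule distrib_right)
    also have "\<dots> = (\<integral>\<^sup>+ k. \<delta> k * G n k j \<partial>count_space UNIV) +
        (\<integral>\<^sup>+ k. (\<integral>\<^sup>+ i. \<mu> i * q i k \<partial>count_space UNIV) * G n k j \<partial>count_space UNIV)"
      by (rule nn_integral_add) auto
    finally show ?thesis by (simp only: sum_G_Suc)
  qed
  have telescope: "(\<Sum>n<N. \<integral>\<^sup>+ k. \<delta> k * G n k j \<partial>count_space UNIV) +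
      (\<integral>\<^sup>+ k. \<mu> k * G N k j \<partial>count_space UNIV) = \<mu> j" for N
  proof (induction N)
    case (Suc N)
    then show ?case by (simp add: step[of N] add.assoc)
  qed (simp add: sum_G_0)
  have "\<delta> k = 0" for k
  proof (rule ccontr)
    assume pos: "\<delta> k \<noteq> 0"
    have "(\<Sum>n<N. \<delta> k * G n k j) \<le> \<mu> j" for N
    proof -
      have "\<delta> k * G n k j \<le> (\<integral>\<^sup>+ k. \<delta> k * G n k j \<partial>count_space UNIV)" for n
        by (rule nn_integral_ge_point) simp
      then have "(\<Sum>n<N. \<delta> k * G n k j) \<le> (\<Sum>n<N. \<integral>\<^sup>+ k. \<delta> k * G n k j \<partial>count_space UNIV)"
        by (intro sum_mono)
      also have "\<dots> \<le> \<mu> j" unfolding telescope[of N, symmetric] by simp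
      finally show ?thesis .
    qed
    then have "(\<Sum>n. \<delta> k * G n k j) \<le> \<mu> j" by (intro suminf_le_const summableI)
    moreover have "(\<Sum>n. \<delta> k * G n k j) = \<infinity>"
      using pos G_sum[of k] by (simp add: ennreal_suminf_cmult ennreal_mult_top)
    ultimately show False using fin[of j] by (simp add: top_unique)
  qed
  then show ?thesis using \<mu>[of k] by simp
qed

text \<open>Invariance passes to all powers of \<open>q\<close>, so \<open>\<mu> q\<^sup>n\<close>
  vanishes at \<open>j\<close> for each \<open>n\<close>; but every state reaches \<open>j\<close>
  with positive weight for some \<open>n\<close>.\<close>

lemma invariant_eq_0:
  assumes inv: "\<And>k. (\<integral>\<^sup>+ i. \<mu> i * q i k \<partial>count_space UNIV) = \<mu> k" and "\<mu> j = 0"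
  shows "\<mu> i = 0"
proof (rule ccontr)
  assume pos: "\<mu> i \<noteq> 0"
  have "(\<integral>\<^sup>+ k. \<mu> k * G n k j \<partial>count_space UNIV) = 0" for n
  proof (induction n)
    case 0
    then show ?case by (simp add: sum_G_0 assms(2))
  next
    case (Suc n)
    then show ?case by (simp add: sum_G_Suc inv)
  qed
  moreover have "\<mu> i * G n i j \<le> (\<integral>\<^sup>+ k. \<mu> k * G n k j \<partial>count_space UNIV)" for n
    by (rule nn_integral_ge_point) simp
  ultimately have "\<mu> i * G n i j = 0" for n by (metis le_zero_eq)
  then have "G n i j = 0" for n using pos by simp
  then show False using G_sum[of i] by simp
qed

text \<open>The difference is again invariant and vanishes at \<open>j\<close>. Finiteness is what
  makes subtraction and cancellation legitimate in \<open>ennreal\<close>.\<close>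

lemma invariant_dominated_eq:
  assumes fin: "\<And>k. \<mu> k < \<infinity>"
    and \<mu>: "\<And>k. (\<integral>\<^sup>+ i. \<mu> i * q i k \<partial>count_space UNIV) = \<mu> k"
    and \<kappa>: "\<And>k. (\<integral>\<^sup>+ i. \<kappa> i * q i k \<partial>count_space UNIV) = \<kappa> k"
    and le: "\<And>k. \<kappa> k \<le> \<mu> k" and eq: "\<kappa> j = \<mu> j"
  shows "\<kappa> i = \<mu> i"
proof -
  define D where "D k = \<mu> k - \<kappa> k" for k
  have \<mu>_D: "\<mu> k = \<kappa> k + D k" for k
    using diff_add_cancel_ennreal[OF le[of k]] unfolding D_def by (metis add.commute)
  have "(\<integral>\<^sup>+ i. D i * q i k \<partial>count_space UNIV) = D k" for k
  proof -
    have "\<mu> k = (\<integral>\<^sup>+ i. \<kappa> i * q i k + D i * q i k \<partial>count_space UNIV)"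
      unfolding \<mu>[of k, symmetric] by (rule nn_integral_cong) (subst \<mu>_D, rule distrib_right)
    also have "\<dots> = \<kappa> k + (\<integral>\<^sup>+ i. D i * q i k \<partial>count_space UNIV)"
      by (subst nn_integral_add) (auto simp: \<kappa>)
    finally have "\<kappa> k + (\<integral>\<^sup>+ i. D i * q i k \<partial>count_space UNIV) = \<kappa> k + D k"
      using \<mu>_D[of k] by (rule subst)
    moreover have "\<kappa> k < \<infinity>" using le[of k] fin[of k] by (rule le_less_trans)
    ultimately show ?thesis by (auto simp: ennreal_add_left_cancel)
  qed
  moreover have "D j = 0" using eq fin[of j] by (simp add: D_def)
  ultimately have "D i = 0" by (rule invariant_eq_0)
  then show ?thesis using \<mu>_D[of i] by simp
qed

text \<open>Scale \<open>\<rho>\<close> to agree with \<open>\<nu>\<close> at \<open>j\<close> and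
  take the pointwise minimum. It is excessive, hence invariant; it lies below both measures and
  agrees with both at \<open>j\<close>, so it equals both.\<close>

lemma invariant_unique:
  assumes \<rho>_fin: "\<And>k. \<rho> k < \<infinity>" and \<rho>: "\<And>k. (\<integral>\<^sup>+ i. \<rho> i * q i k \<partial>count_space UNIV) = \<rho> k"
    and \<rho>_j: "\<rho> j > 0"
    and \<nu>_fin: "\<And>k. \<nu> k < \<infinity>" and \<nu>: "\<And>k. (\<integral>\<^sup>+ i. \<nu> i * q i k \<partial>count_space UNIV) = \<nu> k"
    and \<nu>_nz: "\<nu> i0 \<noteq> 0"
  shows "\<exists>a>0. \<forall>i. \<nu> i = ennreal a * \<rho> i"
proof -
  have "\<nu> j \<noteq> 0" using invariant_eq_0[of \<nu> i0] \<nu> \<nu>_nz by blast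
  \<comment> \<open>The only candidate for the ratio, forced by the value at
    \<open>j\<close>.\<close>
  define r where "r = \<nu> j / \<rho> j"
  have r: "r * \<rho> j = \<nu> j" unfolding r_def
    using \<rho>_j \<rho>_fin[of j] by (simp add: ennreal_divide_times ennreal_mult_divide_eq)
  have r_fin: "r < \<infinity>" unfolding r_def
    using \<rho>_j \<nu>_fin[of j] by (auto simp: ennreal_divide_eq_top_iff simp flip: less_top)
  define a where "a = enn2real r"
  have a: "ennreal a = r" unfolding a_def using r_fin by (simp add: less_top)
  have "r \<noteq> 0" using r \<open>\<nu> j \<noteq> 0\<close> by auto
  then have a_pos: "a > 0" using a enn2real_nonneg[of r] unfolding a_def[symmetric] by (cases "a = 0") auto
  define \<mu> where "\<mu> k = r * \<rho> k" for k
  have \<mu>_fin: "\<mu> k < \<infinity>" for k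
    unfolding \<mu>_def using r_fin \<rho>_fin[of k] by (simp add: ennreal_mult_less_top)
  have \<mu>: "(\<integral>\<^sup>+ i. \<mu> i * q i k \<partial>count_space UNIV) = \<mu> k" for k
    unfolding \<mu>_def by (simp add: mult.assoc nn_integral_cmult \<rho>)
  define \<kappa> where "\<kappa> k = min (\<nu> k) (\<mu> k)" for k
  have \<kappa>: "(\<integral>\<^sup>+ i. \<kappa> i * q i k \<partial>count_space UNIV) = \<kappa> k" for k
  proof (rule excessive_imp_invariant)
    show "\<kappa> k < \<infinity>" for k unfolding \<kappa>_def using \<nu>_fin[of k] by (simp add: min_less_iff_disj)
    fix k
    have "(\<integral>\<^sup>+ i. \<kappa> i * q i k \<partial>count_space UNIV) \<le> (\<integral>\<^sup>+ i. \<nu> i * q i k \<partial>count_space UNIV)"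
      "(\<integral>\<^sup>+ i. \<kappa> i * q i k \<partial>count_space UNIV) \<le> (\<integral>\<^sup>+ i. \<mu> i * q i k \<partial>count_space UNIV)"
      by (auto intro!: nn_integral_mono mult_right_mono simp: \<kappa>_def)
    then show "(\<integral>\<^sup>+ i. \<kappa> i * q i k \<partial>count_space UNIV) \<le> \<kappa> k"
      by (simp add: \<nu> \<mu> \<kappa>_def)
  qed
  have "\<kappa> j = \<nu> j" "\<kappa> j = \<mu> j" using r by (simp_all add: \<kappa>_def \<mu>_def)
  then have "\<kappa> i = \<nu> i" "\<kappa> i = \<mu> i" for i
    using invariant_dominated_eq[of \<nu> \<kappa> i, OF \<nu>_fin \<nu> \<kappa>]
      invariant_dominated_eq[of \<mu> \<kappa> i, OF \<mu>_fin \<mu> \<kappa>] by (auto simp: \<kappa>_def)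
  then have "\<nu> i = ennreal a * \<rho> i" for i unfolding a by (simp add: \<mu>_def)
  with a_pos show ?thesis by blast
qed

end

section \<open>Uniqueness for the ladder chain and Kac's formula\<close>

context stationary_walk
begin

lemma prob_ladder_unique:
  assumes \<nu>_fin: "\<And>k. \<nu> k < \<infinity>"
    and \<nu>: "\<And>k. (\<integral>\<^sup>+ i. \<nu> i * prob_ladder 1 i k \<partial>count_space UNIV) = \<nu> k"
    and \<nu>_nz: "\<nu> i0 \<noteq> 0"
  shows "\<exists>a>0. \<forall>i. \<nu> i = ennreal a * record_weight i"
proof -
  obtain j where j: "j \<in> record_states" using record_states_nonempty by blast
  have "prob_ladder 0 i j = of_bool (i = j)" for i
  proof -
    have "AE \<omega> in W. fst (\<omega> 0) = i \<longrightarrow> fst (fut \<omega> 0) = i" by (simp add: fut_def)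
    then have "AE \<eta> in L i. fst (\<eta> 0) = i"
      using \<pi>_pos[of i] by (intro AE_L_if_AE_W[of "\<lambda>_. True"]) (auto simp: start)
    then have "emeasure (L i) {\<eta>. path_ladder 0 \<eta> = Some j} = emeasure (L i) {\<eta>. i = j}"
      using sets.top[of "L i"] by (intro emeasure_eq_AE) (auto simp: path_ladder_eq_Some zero_enat_def)
    then show ?thesis
      using prob_space.emeasure_space_1[OF prob_L[of i]] by (cases "i = j") auto
  qed
  then interpret recurrent_kernel "prob_ladder 1" prob_ladder j
    by unfold_locales (simp_all only: prob_ladder_Suc prob_ladder_sum_infinite[OF j])
  show ?thesis
    by (rule invariant_unique[OF _ _ _ \<nu>_fin \<nu> \<nu>_nz])
      (use j record_weight_finite record_weight_stationary in \<open>auto simp: record_states_def\<close>)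
qed

text \<open>On \<open>record_at i \<omega> 0\<close> the return time counts the records from time \<open>0\<close> up to the next record at
  state \<open>i\<close>. Transporting each of them to time \<open>0\<close> yields every record exactly once.\<close>

lemma kac_formula:
  assumes i: "i \<in> record_states"
  shows "record_weight i * (\<integral>\<^sup>+ \<eta>. ennreal_of_enat (return_time path_ladder {i} \<eta>) \<partial>L i) =
    emeasure W {\<omega>. strict_record \<omega> 0}"
proof -
  define N where "N m \<eta> \<longleftrightarrow> (\<forall>l. 1 \<le> l \<and> l \<le> m \<longrightarrow> path_ladder l \<eta> \<noteq> Some i)" for m and \<eta> :: "nat \<Rightarrow> 'a \<times> real"
  have N_meas [measurable]: "Measurable.pred path_space (N m)" for m unfolding N_def by measurable
  \<comment> \<open>The time \<open>k\<close> is a record in the cycle that a record at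
    \<open>i\<close> opens at time \<open>0\<close> and that the next record at \<open>i\<close>
    closes; the opening record counts, the closing one does not.\<close>
  define U where "U k \<omega> \<longleftrightarrow> record_at i \<omega> 0 \<and> 0 \<le> k \<and> strict_record \<omega> k \<and>
    (\<forall>l. 0 < l \<and> l \<le> k \<longrightarrow> \<not> record_at i \<omega> l)" for k :: int and \<omega>
  have U_meas [measurable]: "Measurable.pred path_space (U k)" for k unfolding U_def by measurable
  have count: "(\<integral>\<^sup>+ k. of_bool (U k \<omega>) \<partial>count_space UNIV) =
      of_bool (record_at i \<omega> 0) * (\<integral>\<^sup>+ m. of_bool (N m (fut \<omega>)) \<partial>count_space UNIV)"
    if inf: "\<And>n. \<exists>m>n. strict_record \<omega> m" for \<omega>
  proof (cases "record_at i \<omega> 0")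
    case True
    then have r0: "strict_record \<omega> 0" by (simp add: record_at_def)
    let ?s = "psum (fut \<omega>)"
    have "\<exists>k>m. prefix_record ?s k" for m
    proof -
      obtain k where "k > int m" "strict_record \<omega> k" using inf by blast
      then show ?thesis using prefix_record_fut[of \<omega> "nat k"] by (intro exI[of _ "nat k"]) auto
    qed
    then have "\<exists>e. \<forall>n. ladder_epoch ?s n = enat (e n)"
      by (intro choice allI ladder_epoch_finite)
    then obtain e where e: "\<And>n. ladder_epoch ?s n = enat (e n)" by blast
    have e_rec: "strict_record \<omega> (int (e n))" for n
      using prefix_record_ladder_epoch[OF e] strict_record_iff_prefix_record[OF r0] by blast
    have e_surj: "\<exists>n. k = int (e n)" if "strict_record \<omega> k" "0 \<le> k" for k
    proof -
      have "prefix_record ?s (nat k)" using prefix_record_fut[of \<omega> "nat k"] that by simp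
      then obtain n where "ladder_epoch ?s n = enat (nat k)" using ex_ladder_epoch by blast
      with e[of n] that show ?thesis by (intro exI[of _ n]) simp
    qed
    have e_mono: "e m < e n \<longleftrightarrow> m < n" for m n
    proof -
      have *: "e m < e n" if "m < n" for m n using ladder_epoch_less[OF that e] e by auto
      show ?thesis using *[of m n] *[of n m] by (cases m n rule: linorder_cases) auto
    qed
    have e_0: "e 0 = 0" using e[of 0] by (simp add: zero_enat_def)
    have U_e: "U (int (e m)) \<omega> \<longleftrightarrow> N m (fut \<omega>)" for m
    proof -
      have lad: "path_ladder l (fut \<omega>) = Some i \<longleftrightarrow> record_at i \<omega> (int (e l))" for l
        unfolding path_ladder_eq_Some using e e_rec by (auto simp: record_at_def fut_def)
      have "(\<forall>l. 0 < l \<and> l \<le> int (e m) \<longrightarrow> \<not> record_at i \<omega> l) \<longleftrightarrow>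
          (\<forall>l. 1 \<le> l \<and> l \<le> m \<longrightarrow> \<not> record_at i \<omega> (int (e l)))"
      proof (intro iffI allI impI notI)
        fix l assume "\<forall>l. 0 < l \<and> l \<le> int (e m) \<longrightarrow> \<not> record_at i \<omega> l" "1 \<le> l \<and> l \<le> m"
          "record_at i \<omega> (int (e l))"
        moreover have "e 0 < e l" "e l \<le> e m" using e_mono[of 0 l] e_mono[of m l] \<open>1 \<le> l \<and> l \<le> m\<close> by auto
        ultimately show False by (simp add: e_0)
      next
        fix l assume *: "\<forall>l. 1 \<le> l \<and> l \<le> m \<longrightarrow> \<not> record_at i \<omega> (int (e l))" "0 < l \<and> l \<le> int (e m)"
          "record_at i \<omega> l"
        then obtain n where n: "l = int (e n)" using e_surj[of l] by (auto simp: record_at_def)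
        then have "e 0 < e n" "\<not> e m < e n" using * by (auto simp: e_0)
        then have "1 \<le> n" "n \<le> m" unfolding e_mono by auto
        with * n show False by blast
      qed
      then show ?thesis using True e_rec by (simp add: U_def N_def lad)
    qed
    \<comment> \<open>The double sum matches record times \<open>k\<close> with ladder indices
      \<open>m\<close> through the enumeration \<open>k = int (e m)\<close>.\<close>
    have "(\<integral>\<^sup>+ k. of_bool (U k \<omega>) \<partial>count_space UNIV) =
        (\<integral>\<^sup>+ k. (\<integral>\<^sup>+ m. of_bool (U k \<omega> \<and> k = int (e m)) \<partial>count_space UNIV) \<partial>count_space UNIV)"
    proof (rule nn_integral_cong)
      fix k
      have "m = n" if "int (e m) = int (e n)" for m n
        using that e_mono[of m n] e_mono[of n m] by (cases m n rule: linorder_cases) auto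
      then have "(\<integral>\<^sup>+ m. of_bool (U k \<omega> \<and> k = int (e m)) \<partial>count_space UNIV) =
          (of_bool (\<exists>m. U k \<omega> \<and> k = int (e m)) :: ennreal)"
        by (intro nn_integral_count_of_bool_unique) auto
      moreover have "(\<exists>m. U k \<omega> \<and> k = int (e m)) \<longleftrightarrow> U k \<omega>"
        using e_surj[of k] by (auto simp: U_def)
      ultimately show "of_bool (U k \<omega>) = (\<integral>\<^sup>+ m. of_bool (U k \<omega> \<and> k = int (e m)) \<partial>count_space UNIV)"
        by simp
    qed
    also have "\<dots> = (\<integral>\<^sup>+ m. (\<integral>\<^sup>+ k. of_bool (U k \<omega> \<and> k = int (e m)) \<partial>count_space UNIV) \<partial>count_space UNIV)"
      by (rule nn_integral_count_space_nn_integral) auto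
    also have "\<dots> = (\<integral>\<^sup>+ m. of_bool (N m (fut \<omega>)) \<partial>count_space UNIV)"
      by (intro nn_integral_cong, subst nn_integral_count_of_bool_unique) (auto simp: U_e)
    finally show ?thesis using True by simp
  qed (simp add: U_def)
  have "record_weight i * (\<integral>\<^sup>+ \<eta>. ennreal_of_enat (return_time path_ladder {i} \<eta>) \<partial>L i) =
      record_weight i * (\<integral>\<^sup>+ \<eta>. (\<integral>\<^sup>+ m. of_bool (N m \<eta>) \<partial>count_space UNIV) \<partial>L i)"
    unfolding ennreal_of_enat_eq_count enat_less_return_time_iff N_def by simp
  also have "\<dots> = (\<integral>\<^sup>+ \<omega>. of_bool (record_at i \<omega> 0) * (\<integral>\<^sup>+ m. of_bool (N m (fut \<omega>)) \<partial>count_space UNIV) \<partial>W)"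
    using nn_integral_markov[of "\<lambda>\<eta>. \<forall>m>0. 0 < psum \<eta> m" "\<lambda>\<eta>. \<integral>\<^sup>+ m. of_bool (N m \<eta>) \<partial>count_space UNIV" i]
    by (simp add: record_weight_def record_at_def strict_record_past_0 borel_measurable_nn_integral_count)
  also have "\<dots> = (\<integral>\<^sup>+ \<omega>. (\<integral>\<^sup>+ k. of_bool (U k \<omega>) \<partial>count_space UNIV) \<partial>W)"
  proof (rule nn_integral_cong_AE)
    show "AE \<omega> in W. of_bool (record_at i \<omega> 0) * (\<integral>\<^sup>+ m. of_bool (N m (fut \<omega>)) \<partial>count_space UNIV) =
        (\<integral>\<^sup>+ k. of_bool (U k \<omega>) \<partial>count_space UNIV :: ennreal)"
      using AE_strict_record_both by (rule eventually_mono) (subst count, auto)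
  qed
  also have "\<dots> = (\<integral>\<^sup>+ \<omega>. (\<integral>\<^sup>+ k. of_bool (U k (path_shift (- k) \<omega>)) \<partial>count_space UNIV) \<partial>W)"
    by (rule mass_transport) measurable
  also have "\<dots> = (\<integral>\<^sup>+ \<omega>. of_bool (strict_record \<omega> 0) \<partial>W)"
  proof (rule nn_integral_cong_AE)
    show "AE \<omega> in W. (\<integral>\<^sup>+ k. of_bool (U k (path_shift (- k) \<omega>)) \<partial>count_space UNIV) =
        (of_bool (strict_record \<omega> 0) :: ennreal)"
      using AE_record_at_both AE_ex_record_at[OF i]
    proof eventually_elim
      case (elim \<omega>)
      \<comment> \<open>After the transport, \<open>- k\<close> is the latest record at
        \<open>i\<close> up to time \<open>0\<close>. Such a latest record exists and is unique, so
        a record at time \<open>0\<close> is charged to exactly one cycle.\<close>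
      have U_shift: "U k (path_shift (- k) \<omega>) \<longleftrightarrow> record_at i \<omega> (- k) \<and> 0 \<le> k \<and> strict_record \<omega> 0 \<and>
          (\<forall>l. - k < l \<and> l \<le> 0 \<longrightarrow> \<not> record_at i \<omega> l)" for k
      proof -
        have "(\<forall>l. 0 < l \<and> l \<le> k \<longrightarrow> \<not> record_at i \<omega> (l + - k)) \<longleftrightarrow>
            (\<forall>l. - k < l \<and> l \<le> 0 \<longrightarrow> \<not> record_at i \<omega> l)"
        proof (intro iffI allI impI)
          fix l assume *: "\<forall>l. 0 < l \<and> l \<le> k \<longrightarrow> \<not> record_at i \<omega> (l + - k)" "- k < l \<and> l \<le> 0"
          then show "\<not> record_at i \<omega> l" using *(1)[rule_format, of "l + k"] by simp
        qed auto
        then show ?thesis by (simp add: U_def)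
      qed
      have "(\<integral>\<^sup>+ k. of_bool (U k (path_shift (- k) \<omega>)) \<partial>count_space UNIV) =
          (of_bool (\<exists>k. U k (path_shift (- k) \<omega>)) :: ennreal)"
      proof (rule nn_integral_count_of_bool_unique)
        fix m n assume "U m (path_shift (- m) \<omega>)" "U n (path_shift (- n) \<omega>)"
        then show "m = n" unfolding U_shift
          by (cases m n rule: linorder_cases) auto
      qed
      also have "(\<exists>k. U k (path_shift (- k) \<omega>)) \<longleftrightarrow> strict_record \<omega> 0"
      proof
        assume r: "strict_record \<omega> 0"
        obtain k where "record_at i \<omega> k" "k \<le> 0" using elim by (meson less_imp_le)
        then obtain l where l: "record_at i \<omega> l \<and> l \<le> 0" "\<And>j. record_at i \<omega> j \<and> j \<le> 0 \<Longrightarrow> j \<le> l"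
          using ex_greatest_int[of "\<lambda>k. record_at i \<omega> k \<and> k \<le> 0" k 0] by metis
        then have "U (- l) (path_shift (- (- l)) \<omega>)" unfolding U_shift using r by force
        then show "\<exists>k. U k (path_shift (- k) \<omega>)" ..
      qed (auto simp: U_shift)
      finally show ?case .
    qed
  qed
  also have "\<dots> = emeasure W {\<omega>. strict_record \<omega> 0}"
    by (simp add: nn_integral_of_bool[where N = W])
  finally show ?thesis .
qed

end

section \<open>The gap between consecutive records\<close>

abbreviation coord_step :: "int \<Rightarrow> (int \<Rightarrow> 'a \<times> real) \<Rightarrow> real" where
  "coord_step \<equiv> \<lambda>k \<omega>. snd (\<omega> k)"

lemma sigma_eq:
  assumes "past_divergent \<omega>" "consecutive (strict_record \<omega>) m n" "m \<le> 0" "0 < n"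
  shows "sigma0 coord_step \<omega> = m" "sigma1 coord_step \<omega> = n"
proof -
  have between: "\<not> strict_record \<omega> k" if "m < k" "k < n" for k
    using assms(2) that by (simp add: consecutive_def)
  have ends: "strict_record \<omega> m" "strict_record \<omega> n"
    using assms(2) by (auto simp: consecutive_def)
  show "sigma0 coord_step \<omega> = m"
    unfolding sigma0_def is_record_iff_strict_record[OF assms(1)]
  proof (rule cSup_eq_maximum)
    show "k \<le> m" if "k \<in> {k. k \<le> 0 \<and> strict_record \<omega> k}" for k
      using between[of k] that assms(4) by (cases "k \<le> m") auto
  qed (use ends assms in auto)
  show "sigma1 coord_step \<omega> = n"
    unfolding sigma1_def is_record_iff_strict_record[OF assms(1)]
  proof (rule cInf_eq_minimum)
    show "n \<le> k" if "k \<in> {k. 1 \<le> k \<and> strict_record \<omega> k}" for k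
      using between[of k] that assms(3) by (cases "n \<le> k") auto
  qed (use ends assms in auto)
qed

text \<open>Describes the value even for the empty set, where \<open>Sup {}\<close> is a fixed
  integer: \<open>sigma0\<close> has to be measurable everywhere, not only where records
  exist.\<close>

lemma Sup_int_eq_iff:
  fixes b :: int
  shows "Sup {k. k \<le> b \<and> A k} = n \<longleftrightarrow>
    n \<le> b \<and> A n \<and> (\<forall>k. n < k \<and> k \<le> b \<longrightarrow> \<not> A k) \<or> (\<forall>k\<le>b. \<not> A k) \<and> Sup {} = n"
proof (cases "\<exists>k\<le>b. A k")
  case True
  then obtain k where "A k \<and> k \<le> b" by blast
  then obtain l where l: "A l \<and> l \<le> b" "\<And>j. A j \<and> j \<le> b \<Longrightarrow> j \<le> l"
    using ex_greatest_int[of "\<lambda>k. A k \<and> k \<le> b" k b] by metis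
  then have "Sup {k. k \<le> b \<and> A k} = l" by (intro cSup_eq_maximum) auto
  moreover have "l = n \<longleftrightarrow> n \<le> b \<and> A n \<and> (\<forall>k. n < k \<and> k \<le> b \<longrightarrow> \<not> A k)"
    using l by (metis linorder_neqE order.strict_trans1 less_irrefl)
  ultimately show ?thesis using True by blast
next
  case False
  then have "{k. k \<le> b \<and> A k} = {}" by blast
  with False show ?thesis by metis
qed

lemma Inf_int_eq_iff:
  fixes b :: int
  shows "Inf {k. b \<le> k \<and> A k} = n \<longleftrightarrow>
    b \<le> n \<and> A n \<and> (\<forall>k. b \<le> k \<and> k < n \<longrightarrow> \<not> A k) \<or> (\<forall>k\<ge>b. \<not> A k) \<and> Inf {} = n"
proof (cases "\<exists>k\<ge>b. A k")
  case True
  then obtain k where "A k \<and> b \<le> k" by blast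
  then obtain l where l: "A l \<and> b \<le> l" "\<And>j. A j \<and> b \<le> j \<Longrightarrow> l \<le> j"
    using ex_least_int[of "\<lambda>k. A k \<and> b \<le> k" k b] by metis
  then have "Inf {k. b \<le> k \<and> A k} = l" by (intro cInf_eq_minimum) auto
  moreover have "l = n \<longleftrightarrow> b \<le> n \<and> A n \<and> (\<forall>k. b \<le> k \<and> k < n \<longrightarrow> \<not> A k)"
    using l by (metis linorder_neqE order.strict_trans1 less_irrefl)
  ultimately show ?thesis using True by blast
next
  case False
  then have "{k. b \<le> k \<and> A k} = {}" by blast
  with False show ?thesis by metis
qed

lemma measurable_is_record [measurable]:
  "Measurable.pred path_space (\<lambda>\<omega>. is_record coord_step k \<omega>)"
  unfolding is_record_def level_def[symmetric] by measurable

lemma measurable_sigma0 [measurable]: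
  "(\<lambda>\<omega>. sigma0 coord_step \<omega>) \<in> measurable path_space (count_space UNIV)"
proof -
  have "Measurable.pred path_space (\<lambda>\<omega>. sigma0 coord_step \<omega> = n)" for n
    unfolding sigma0_def Sup_int_eq_iff by measurable
  then show ?thesis by (intro measurable_count_space_except[where c = 0])
qed

lemma measurable_sigma1 [measurable]:
  "(\<lambda>\<omega>. sigma1 coord_step \<omega>) \<in> measurable path_space (count_space UNIV)"
proof -
  have "Measurable.pred path_space (\<lambda>\<omega>. sigma1 coord_step \<omega> = n)" for n
    unfolding sigma1_def Inf_int_eq_iff by measurable
  then show ?thesis by (intro measurable_count_space_except[where c = 0])
qed

section \<open>The mean inverse gap as the mass of records at time 0\<close>

context stationary_walk
begin

lemma AE_ex_straddling_records:
  "AE \<omega> in W. \<exists>m n. consecutive (strict_record \<omega>) m n \<and> m \<le> 0 \<and> 0 < n"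
  using AE_strict_record_both
proof eventually_elim
  case (elim \<omega>)
  obtain k where "strict_record \<omega> k \<and> k \<le> 0" using elim less_imp_le by blast
  then obtain m where m: "strict_record \<omega> m \<and> m \<le> 0" "\<And>j. strict_record \<omega> j \<and> j \<le> 0 \<Longrightarrow> j \<le> m"
    using ex_greatest_int[of "\<lambda>k. strict_record \<omega> k \<and> k \<le> 0" k 0] by metis
  then obtain n where n: "consecutive (strict_record \<omega>) m n"
    using elim ex_consecutive_right[of "strict_record \<omega>" m] by auto
  moreover have "0 < n"
    using n m(2)[of n] by (auto simp: consecutive_def)
  ultimately show ?case using m(1) by blast
qed

lemma emeasure_sigma0:
  "emeasure W {\<omega>. T (fst (\<omega> 0)) \<and> sigma0 coord_step \<omega> = 0} = emeasure W {\<omega>. T (fst (\<omega> 0)) \<and> strict_record \<omega> 0}"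
proof (rule emeasure_cong_AE)
  show "AE \<omega> in W. (T (fst (\<omega> 0)) \<and> sigma0 coord_step \<omega> = 0) \<longleftrightarrow> (T (fst (\<omega> 0)) \<and> strict_record \<omega> 0)"
    using AE_ex_straddling_records divergent
  proof eventually_elim
    case (elim \<omega>)
    then obtain m n where mn: "consecutive (strict_record \<omega>) m n" "m \<le> 0" "0 < n" by blast
    have "\<not> (m < 0 \<and> strict_record \<omega> 0)" "m = 0 \<longrightarrow> strict_record \<omega> 0"
      using mn by (auto simp: consecutive_def)
    then have "m = 0 \<longleftrightarrow> strict_record \<omega> 0" using mn(2) by auto
    with sigma_eq(1)[OF elim(2) mn] show ?case by auto
  qed
qed measurable

text \<open>The integrand spreads the unit mass of a record evenly over the times up to the next
  record; transport gathers it again at the left end, where a gap of length \<open>d\<close>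
  collects \<open>d\<close> portions of \<open>1 / d\<close>. The predicate \<open>T\<close> covers
  both the total mass and the mass at a single state.\<close>

lemma nn_integral_gap:
  "(\<integral>\<^sup>+ \<omega>. ennreal (1 / real_of_int (sigma1 coord_step \<omega> - sigma0 coord_step \<omega>)) *
      of_bool (T (fst (\<omega> (sigma0 coord_step \<omega>)))) \<partial>W) =
    emeasure W {\<omega>. T (fst (\<omega> 0)) \<and> strict_record \<omega> 0}"
proof -
  let ?R = "strict_record"
  let ?h = "\<lambda>d :: int. ennreal (1 / real_of_int d)"
  \<comment> \<open>Time \<open>0\<close> lies in the gap from \<open>m\<close> to
    \<open>m + d\<close>, whose left end is included and whose right end is not.\<close>
  define V where "V m d \<omega> \<longleftrightarrow> consecutive (?R \<omega>) m (m + d) \<and> m \<le> 0 \<and> 0 < m + d \<and> T (fst (\<omega> m))"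
    for m d :: int and \<omega> :: "int \<Rightarrow> 'a \<times> real"
  have [measurable]: "Measurable.pred path_space (V m d)" for m d
    unfolding V_def by measurable
  define K where "K d \<omega> \<longleftrightarrow> consecutive (?R \<omega>) 0 d \<and> T (fst (\<omega> 0))"
    for d :: int and \<omega> :: "int \<Rightarrow> 'a \<times> real"
  have V_shift: "V m d (path_shift (- m) \<omega>) \<longleftrightarrow> K d \<omega> \<and> - d < m \<and> m \<le> 0" for m d \<omega>
  proof -
    have "consecutive (?R (path_shift (- m) \<omega>)) m (m + d) \<longleftrightarrow> consecutive (?R \<omega>) 0 d"
      using consecutive_add[of "?R \<omega>" "- m" m "m + d"] by (simp add: strict_record_shift[abs_def])
    then show ?thesis by (auto simp: V_def K_def path_shift_apply)
  qed
  have "(\<integral>\<^sup>+ \<omega>. ?h (sigma1 coord_step \<omega> - sigma0 coord_step \<omega>) * of_bool (T (fst (\<omega> (sigma0 coord_step \<omega>)))) \<partial>W) =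
      (\<integral>\<^sup>+ \<omega>. (\<integral>\<^sup>+ m. (\<integral>\<^sup>+ d. ?h d * of_bool (V m d \<omega>) \<partial>count_space UNIV) \<partial>count_space UNIV) \<partial>W)"
  proof (rule nn_integral_cong_AE)
    show "AE \<omega> in W. ?h (sigma1 coord_step \<omega> - sigma0 coord_step \<omega>) * of_bool (T (fst (\<omega> (sigma0 coord_step \<omega>)))) =
        (\<integral>\<^sup>+ m. (\<integral>\<^sup>+ d. ?h d * of_bool (V m d \<omega>) \<partial>count_space UNIV) \<partial>count_space UNIV)"
      using AE_ex_straddling_records divergent
    proof eventually_elim
      case (elim \<omega>)
      then obtain m0 n0 where mn: "consecutive (?R \<omega>) m0 n0" "m0 \<le> 0" "0 < n0" by blast
      let ?c = "?h (n0 - m0) * of_bool (T (fst (\<omega> m0)))"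
      have V: "V m d \<omega> \<longleftrightarrow> T (fst (\<omega> m0)) \<and> m = m0 \<and> d = n0 - m0" for m d
      proof
        assume v: "V m d \<omega>"
        then have s: "sigma0 coord_step \<omega> = m" "sigma1 coord_step \<omega> = m + d"
          using sigma_eq[OF elim(2), of m "m + d"] by (auto simp: V_def)
        then show "T (fst (\<omega> m0)) \<and> m = m0 \<and> d = n0 - m0"
          using v sigma_eq[OF elim(2) mn] by (auto simp: V_def)
      qed (use mn in \<open>auto simp: V_def\<close>)
      have "(\<integral>\<^sup>+ m. (\<integral>\<^sup>+ d. ?h d * of_bool (V m d \<omega>) \<partial>count_space UNIV) \<partial>count_space UNIV) =
          (\<integral>\<^sup>+ m. (\<integral>\<^sup>+ d. ?c * indicator {m0} m * indicator {n0 - m0} d \<partial>count_space UNIV) \<partial>count_space UNIV)"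
        unfolding V by (intro nn_integral_cong) (auto simp: indicator_def)
      also have "\<dots> = ?c" by (simp add: nn_integral_cmult)
      finally show ?case using sigma_eq[OF elim(2) mn] by simp
    qed
  qed
  also have "\<dots> = (\<integral>\<^sup>+ \<omega>. (\<integral>\<^sup>+ m. (\<integral>\<^sup>+ d. ?h d * of_bool (V m d (path_shift (- m) \<omega>)) \<partial>count_space UNIV) \<partial>count_space UNIV) \<partial>W)"
    by (rule mass_transport) (intro borel_measurable_nn_integral_count, measurable)
  also have "\<dots> = (\<integral>\<^sup>+ \<omega>. of_bool (T (fst (\<omega> 0)) \<and> ?R \<omega> 0) \<partial>W)"
  proof (rule nn_integral_cong_AE)
    show "AE \<omega> in W. (\<integral>\<^sup>+ m. (\<integral>\<^sup>+ d. ?h d * of_bool (V m d (path_shift (- m) \<omega>)) \<partial>count_space UNIV) \<partial>count_space UNIV) =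
        (of_bool (T (fst (\<omega> 0)) \<and> ?R \<omega> 0) :: ennreal)"
      using AE_strict_record_both
    proof eventually_elim
      case (elim \<omega>)
      have "(\<integral>\<^sup>+ m. (\<integral>\<^sup>+ d. ?h d * of_bool (V m d (path_shift (- m) \<omega>)) \<partial>count_space UNIV) \<partial>count_space UNIV) =
          (\<integral>\<^sup>+ d. (\<integral>\<^sup>+ m. ?h d * of_bool (V m d (path_shift (- m) \<omega>)) \<partial>count_space UNIV) \<partial>count_space UNIV)"
        by (rule nn_integral_count_space_nn_integral) auto
      also have "\<dots> = (\<integral>\<^sup>+ d. of_bool (K d \<omega>) \<partial>count_space UNIV)"
      proof (rule nn_integral_cong)
        fix d :: int
        show "(\<integral>\<^sup>+ m. ?h d * of_bool (V m d (path_shift (- m) \<omega>)) \<partial>count_space UNIV) = of_bool (K d \<omega>)"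
        proof (cases "K d \<omega>")
          case True
          then have d: "d > 0" by (simp add: K_def consecutive_def)
          have "(\<integral>\<^sup>+ m. ?h d * of_bool (V m d (path_shift (- m) \<omega>)) \<partial>count_space UNIV) =
              (\<integral>\<^sup>+ m. ?h d * indicator {- d<..0} m \<partial>count_space UNIV)"
            unfolding V_shift using True by (intro nn_integral_cong) (auto simp: indicator_def)
          also have "\<dots> = ?h d * of_nat (nat d)" by (simp add: nn_integral_cmult)
          also have "\<dots> = ennreal (1 / real_of_int d * real (nat d))"
            unfolding ennreal_of_nat_eq_real_of_nat using d by (intro ennreal_mult[symmetric]) auto
          also have "\<dots> = 1" using d by simp
          finally show ?thesis using True by simp
        qed (simp add: V_shift)
      qed
      also have "\<dots> = of_bool (\<exists>d. K d \<omega>)"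
        by (rule nn_integral_count_of_bool_unique) (auto simp: K_def dest: consecutive_right_unique)
      also have "(\<exists>d. K d \<omega>) \<longleftrightarrow> T (fst (\<omega> 0)) \<and> ?R \<omega> 0"
        using elim ex_consecutive_right[of "?R \<omega>" 0] by (auto simp: K_def)
      finally show ?case .
    qed
  qed
  also have "\<dots> = emeasure W {\<omega>. T (fst (\<omega> 0)) \<and> ?R \<omega> 0}"
    by (subst nn_integral_of_bool[where N = W]) auto
  finally show ?thesis .
qed

end

section \<open>Laws of the path processes\<close>

locale mrw_two_sided =
  fixes p :: "'a::countable \<Rightarrow> 'a \<Rightarrow> real" and F :: "'a \<Rightarrow> 'a \<Rightarrow> real measure"
    and P :: "'a \<Rightarrow> 'w measure" and M :: "nat \<Rightarrow> 'w \<Rightarrow> 'a" and X :: "nat \<Rightarrow> 'w \<Rightarrow> real"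
    and \<pi> :: "'a \<Rightarrow> ennreal" and Q :: "'v measure"
    and M2 :: "int \<Rightarrow> 'v \<Rightarrow> 'a" and X2 :: "int \<Rightarrow> 'v \<Rightarrow> real"
  assumes mrw: "markov_random_walk p F P M X"
    and rec: "null_recurrent_on P (\<lambda>n w. Some (M n w)) UNIV"
    and ess: "ess_unique_stationary_measure p \<pi>"
    and \<pi>_pos': "\<forall>i. 0 < \<pi> i"
    and tss: "two_sided_stationary p F \<pi> Q M2 X2"
    and dual: "dual_positive_divergent Q M2 X2"
begin

abbreviation edge_weight :: "'a \<Rightarrow> 'a \<Rightarrow> real set \<Rightarrow> ennreal" where
  "edge_weight a b B \<equiv> ennreal (p a b) * emeasure (F a b) B"

lemma p_nonneg: "0 \<le> p i j"
  using mrw by (simp add: markov_random_walk_def stochastic_matrix_def)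

lemma prob_F: "prob_space (F i j)" and sets_F: "sets (F i j) = sets borel"
  using mrw by (simp_all add: markov_random_walk_def)

lemma prob_P: "prob_space (P i)"
  using mrw by (simp add: markov_random_walk_def)

lemma measurable_M [measurable]: "M n \<in> measurable (P i) (count_space UNIV)"
  using mrw by (simp add: markov_random_walk_def)

lemma measurable_X [measurable]: "X n \<in> borel_measurable (P i)"
  using mrw by (simp add: markov_random_walk_def)

lemma measurable_M2 [measurable]: "M2 n \<in> measurable Q (count_space UNIV)"
  using tss by (simp add: two_sided_stationary_def)

lemma measurable_X2 [measurable]: "X2 n \<in> borel_measurable Q"
  using tss by (simp add: two_sided_stationary_def)

text \<open>The event \<open>A\<close> that prescribes the states belongs to the
  \<open>\<sigma>\<close>-algebra generated by the chain, and the conditional probability of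
  \<open>E\<close> is constant on it. Integrating over \<open>A\<close> gives the product.\<close>

lemma P_cylinder:
  assumes B: "\<And>k. B k \<in> sets borel"
  shows "emeasure (P i) {w \<in> space (P i). (\<forall>k\<le>n. M k w = x k) \<and> (\<forall>k\<in>{1..n}. X k w \<in> B k)} =
    of_bool (x 0 = i) * (\<Prod>k=1..n. edge_weight (x (k - 1)) (x k) (B k))"
proof -
  interpret prob_space "P i" by (rule prob_P)
  define VA where "VA = vimage_algebra (space (P i)) (\<lambda>w k. M k w) (Pi\<^sub>M UNIV (\<lambda>_. count_space UNIV))"
  define A where "A = {w \<in> space (P i). \<forall>k\<le>n. M k w = x k}"
  define E where "E = {w \<in> space (P i). \<forall>k\<in>{1..n}. X k w \<in> B k}"
  have [measurable]: "B k \<in> sets borel" for k by (rule B)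
  have meas: "(\<lambda>w k. M k w) \<in> P i \<rightarrow>\<^sub>M Pi\<^sub>M UNIV (\<lambda>_. count_space UNIV)"
    by (rule measurable_PiM_single') auto
  have "subalgebra (P i) VA"
    unfolding subalgebra_def VA_def
    using measurable_iff_sets[THEN iffD1, OF meas] by auto
  then interpret finite_measure_subalgebra "P i" VA
    by unfold_locales
  have A_VA: "A \<in> sets VA"
  proof -
    have "{f. \<forall>k\<le>n. f k = x k} \<in> sets (Pi\<^sub>M UNIV (\<lambda>_. count_space UNIV) :: (nat \<Rightarrow> 'a) measure)"
    proof -
      have "{f \<in> space (Pi\<^sub>M UNIV (\<lambda>_. count_space UNIV)). \<forall>k\<le>n. f k = x k} \<in>
          sets (Pi\<^sub>M UNIV (\<lambda>_. count_space UNIV) :: (nat \<Rightarrow> 'a) measure)"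
        by measurable
      then show ?thesis by (simp add: space_PiM)
    qed
    then have "(\<lambda>w k. M k w) -` {f. \<forall>k\<le>n. f k = x k} \<inter> space (P i) \<in> sets VA"
      unfolding VA_def by (rule in_vimage_algebra)
    also have "(\<lambda>w k. M k w) -` {f. \<forall>k\<le>n. f k = x k} \<inter> space (P i) = A" by (auto simp: A_def)
    finally show ?thesis .
  qed
  have [measurable]: "A \<in> sets (P i)" "E \<in> sets (P i)" unfolding A_def E_def by measurable
  let ?c = "\<Prod>k=1..n. measure (F (x (k - 1)) (x k)) (B k)"
  have ce: "AE w in P i. real_cond_exp (P i) VA (indicator E) w = (\<Prod>k=1..n. measure (F (M (k - 1) w) (M k w)) (B k))"
    using mrw B by (simp add: markov_random_walk_def VA_def E_def)
  have "measure (P i) (A \<inter> E) = (\<integral>w\<in>A. indicator E w \<partial>P i)"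
    by (simp add: set_lebesgue_integral_def indicator_inter_arith[symmetric])
  also have "\<dots> = (\<integral>w\<in>A. real_cond_exp (P i) VA (indicator E) w \<partial>P i)"
    by (rule real_cond_exp_intA[OF _ A_VA], rule integrable_real_indicator) (auto simp: less_top[symmetric])
  also have "\<dots> = (\<integral>w\<in>A. ?c \<partial>P i)"
    unfolding set_lebesgue_integral_def
  proof (rule integral_cong_AE)
    show "AE w in P i. indicator A w *\<^sub>R real_cond_exp (P i) VA (indicator E) w = indicator A w *\<^sub>R ?c"
      using ce
    proof eventually_elim
      case (elim w)
      show ?case
      proof (cases "w \<in> A")
        case True
        then have "(\<Prod>k=1..n. measure (F (M (k - 1) w) (M k w)) (B k)) = ?c"
          by (intro prod.cong) (auto simp: A_def)
        then show ?thesis using elim by simp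
      qed simp
    qed
  qed auto
  also have "\<dots> = measure (P i) A * ?c"
    by (simp add: set_lebesgue_integral_def)
  also have "measure (P i) A = (if x 0 = i then \<Prod>k=1..n. p (x (k - 1)) (x k) else 0)"
    using mrw by (simp add: markov_random_walk_def A_def)
  finally have "measure (P i) (A \<inter> E) = of_bool (x 0 = i) * (\<Prod>k=1..n. p (x (k - 1)) (x k) * measure (F (x (k - 1)) (x k)) (B k))"
    by (simp add: prod.distrib)
  then have "emeasure (P i) (A \<inter> E) = of_bool (x 0 = i) *
      (\<Prod>k=1..n. ennreal (p (x (k - 1)) (x k) * measure (F (x (k - 1)) (x k)) (B k)))"
    by (subst prod_ennreal) (auto simp: emeasure_eq_measure p_nonneg)
  also have "\<dots> = of_bool (x 0 = i) * (\<Prod>k=1..n. edge_weight (x (k - 1)) (x k) (B k))"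
    by (simp add: ennreal_mult p_nonneg finite_measure.emeasure_eq_measure[OF prob_space.finite_measure[OF prob_F]])
  also have "A \<inter> E = {w \<in> space (P i). (\<forall>k\<le>n. M k w = x k) \<and> (\<forall>k\<in>{1..n}. X k w \<in> B k)}"
    by (auto simp: A_def E_def)
  finally show ?thesis .
qed

section \<open>The laws of the given processes on path space\<close>

definition one_sided_path :: "'w \<Rightarrow> nat \<Rightarrow> 'a \<times> real" where
  "one_sided_path w = (\<lambda>n. (M n w, X (Suc n) w))"

definition two_sided_path :: "'v \<Rightarrow> int \<Rightarrow> 'a \<times> real" where
  "two_sided_path w = (\<lambda>k. (M2 k w, X2 k w))"

lemma measurable_one_sided_path [measurable]: "one_sided_path \<in> measurable (P i) path_space"
  by (rule measurable_path_spaceI) (simp_all add: one_sided_path_def)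

lemma measurable_two_sided_path [measurable]: "two_sided_path \<in> measurable Q path_space"
  by (rule measurable_path_spaceI) (simp_all add: two_sided_path_def)

definition W :: "(int \<Rightarrow> 'a \<times> real) measure" where
  "W = distr Q path_space two_sided_path"

definition L :: "'a \<Rightarrow> (nat \<Rightarrow> 'a \<times> real) measure" where
  "L i = distr (P i) path_space one_sided_path"

lemma sets_W [measurable_cong]: "sets W = sets path_space" and space_W [simp]: "space W = UNIV"
  by (simp_all add: W_def)

lemma sets_L [measurable_cong]: "sets (L i) = sets path_space" and space_L [simp]: "space (L i) = UNIV"
  by (simp_all add: L_def)

lemma emeasure_W:
  assumes [measurable]: "Measurable.pred path_space R"
  shows "emeasure W {\<omega>. R \<omega>} = emeasure Q {w \<in> space Q. R (two_sided_path w)}"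
proof -
  have "{\<omega>. R \<omega>} \<in> sets path_space" by measurable
  then show ?thesis by (simp add: W_def emeasure_distr vimage_def Int_def conj_commute)
qed

lemma emeasure_L:
  assumes [measurable]: "Measurable.pred path_space R"
  shows "emeasure (L i) {\<omega>. R \<omega>} = emeasure (P i) {w \<in> space (P i). R (one_sided_path w)}"
proof -
  have "{\<omega>. R \<omega>} \<in> sets path_space" by measurable
  then show ?thesis by (simp add: L_def emeasure_distr vimage_def Int_def conj_commute)
qed

lemma pred_cylinder [measurable]:
  assumes [measurable]: "\<And>k. B k \<in> sets borel" and [simp]: "finite K" "finite J"
  shows "Measurable.pred path_space (\<lambda>\<omega>. \<omega> \<in> cylinder K J x B)"
proof -
  have "Measurable.pred path_space (\<lambda>\<omega>. (\<forall>k\<in>K. fst (\<omega> k) = x k) \<and> (\<forall>k\<in>J. snd (\<omega> k) \<in> B k))"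
    by measurable
  then show ?thesis by (simp add: cylinder_def)
qed

lemma W_cylinder:
  assumes "a \<le> b" "\<And>k. B k \<in> sets borel"
  shows "emeasure W (cylinder {a..b} {a + 1..b} x B) =
    \<pi> (x a) * (\<Prod>k\<in>{a + 1..b}. edge_weight (x (k - 1)) (x k) (B k))"
proof -
  have "emeasure W {\<omega>. \<omega> \<in> cylinder {a..b} {a + 1..b} x B} =
      emeasure Q {w \<in> space Q. two_sided_path w \<in> cylinder {a..b} {a + 1..b} x B}"
    by (rule emeasure_W, rule pred_cylinder) (use assms(2) in auto)
  also have "{w \<in> space Q. two_sided_path w \<in> cylinder {a..b} {a + 1..b} x B} =
      {w \<in> space Q. (\<forall>k\<in>{a..b}. M2 k w = x k) \<and> (\<forall>k\<in>{a + 1..b}. X2 k w \<in> B k)}"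
    by (simp add: cylinder_def two_sided_path_def)
  finally show ?thesis
    using tss assms by (simp add: two_sided_stationary_def)
qed

lemma L_cylinder:
  assumes "\<And>k. B k \<in> sets borel"
  shows "emeasure (L i) (cylinder {..n} {..<n} x B) =
    of_bool (x 0 = i) * (\<Prod>k<n. edge_weight (x k) (x (Suc k)) (B k))"
proof -
  have "emeasure (L i) {\<omega>. \<omega> \<in> cylinder {..n} {..<n} x B} =
      emeasure (P i) {w \<in> space (P i). one_sided_path w \<in> cylinder {..n} {..<n} x B}"
    by (rule emeasure_L, rule pred_cylinder) (use assms in auto)
  also have "{w \<in> space (P i). one_sided_path w \<in> cylinder {..n} {..<n} x B} =
      {w \<in> space (P i). (\<forall>k\<le>n. M k w = x k) \<and> (\<forall>k\<in>{1..n}. X k w \<in> B (k - 1))}"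
  proof -
    have "(\<forall>k\<in>{..<n}. X (Suc k) w \<in> B k) \<longleftrightarrow> (\<forall>k\<in>{1..n}. X k w \<in> B (k - 1))" for w
    proof (intro iffI ballI)
      fix k assume *: "\<forall>k\<in>{..<n}. X (Suc k) w \<in> B k" "k \<in> {1..n}"
      then show "X k w \<in> B (k - 1)" using *(1)[rule_format, of "k - 1"] by auto
    next
      fix k assume *: "\<forall>k\<in>{1..n}. X k w \<in> B (k - 1)" "k \<in> {..<n}"
      then show "X (Suc k) w \<in> B k" using *(1)[rule_format, of "Suc k"] by auto
    qed
    then show ?thesis by (simp add: cylinder_def one_sided_path_def atMost_def)
  qed
  also have "emeasure (P i) \<dots> = of_bool (x 0 = i) * (\<Prod>k=1..n. edge_weight (x (k - 1)) (x k) (B (k - 1)))"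
    by (rule P_cylinder) (rule assms)
  also have "(\<Prod>k=1..n. edge_weight (x (k - 1)) (x k) (B (k - 1))) = (\<Prod>k<n. edge_weight (x k) (x (Suc k)) (B k))"
    by (simp add: prod.atLeast1_atMost_eq)
  finally show ?thesis by simp
qed

lemma \<pi>_finite: "\<pi> i < \<infinity>"
  using ess by (simp add: ess_unique_stationary_measure_def stationary_measure_def)

lemma W_start: "emeasure W {\<omega>. fst (\<omega> 0) = i} = \<pi> i"
proof -
  have "{\<omega>. fst (\<omega> 0) = i} = cylinder {0..0 :: int} {0 + 1..0} (\<lambda>_. i) (\<lambda>_. UNIV :: real set)"
    by (simp add: cylinder_def)
  then show ?thesis using W_cylinder[of 0 0 "\<lambda>_. UNIV" "\<lambda>_. i"] by simp
qed

text \<open>The cylinder formula uses the same initial weight \<open>\<pi>\<close> for windows at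
  every position, and this encodes stationarity.\<close>

lemma W_shift: "distr W path_space (path_shift m) = W"
proof (rule cylinder_measure_eqI[where K = "\<lambda>n. {- int n..int n}" and J = "\<lambda>n. {1 - int n..int n}"])
  have eq: "emeasure (distr W path_space (path_shift m)) (cylinder {- int n..int n} {1 - int n..int n} x B) =
      emeasure W (cylinder {- int n..int n} {1 - int n..int n} x B)"
    if B: "\<And>k. B k \<in> sets borel" for n x and B :: "int \<Rightarrow> real set"
  proof -
    let ?C = "cylinder {- int n..int n} {1 - int n..int n} x B"
    let ?x = "\<lambda>k. x (k - m)" and ?B = "\<lambda>k. B (k - m)"
    have "Measurable.pred path_space (\<lambda>\<omega>. \<omega> \<in> ?C)" by (rule pred_cylinder) (use B in auto)
    then have "?C \<in> sets path_space" by (simp add: pred_def)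
    then have "emeasure (distr W path_space (path_shift m)) ?C = emeasure W (path_shift m -` ?C)"
      by (simp add: emeasure_distr)
    also have "path_shift m -` ?C = cylinder {m - int n..m + int n} {m - int n + 1..m + int n} ?x ?B"
    proof -
      have "(\<forall>k\<in>{- int n..int n}. fst (\<omega> (k + m)) = x k) \<longleftrightarrow>
          (\<forall>k\<in>{m - int n..m + int n}. fst (\<omega> k) = x (k - m))" for \<omega> :: "int \<Rightarrow> 'a \<times> real"
      proof (intro iffI ballI)
        fix k assume *: "\<forall>k\<in>{- int n..int n}. fst (\<omega> (k + m)) = x k" "k \<in> {m - int n..m + int n}"
        then show "fst (\<omega> k) = x (k - m)" using *(1)[rule_format, of "k - m"] by simp
      qed auto
      moreover have "(\<forall>k\<in>{1 - int n..int n}. snd (\<omega> (k + m)) \<in> B k) \<longleftrightarrow>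
          (\<forall>k\<in>{m - int n + 1..m + int n}. snd (\<omega> k) \<in> B (k - m))" for \<omega> :: "int \<Rightarrow> 'a \<times> real"
      proof (intro iffI ballI)
        fix k assume *: "\<forall>k\<in>{1 - int n..int n}. snd (\<omega> (k + m)) \<in> B k" "k \<in> {m - int n + 1..m + int n}"
        then show "snd (\<omega> k) \<in> B (k - m)" using *(1)[rule_format, of "k - m"] by simp
      next
        fix k assume *: "\<forall>k\<in>{m - int n + 1..m + int n}. snd (\<omega> k) \<in> B (k - m)" "k \<in> {1 - int n..int n}"
        then show "snd (\<omega> (k + m)) \<in> B k" using *(1)[rule_format, of "k + m"] by simp
      qed
      ultimately show ?thesis unfolding cylinder_def by (simp add: path_shift_apply)
    qed
    also have "emeasure W \<dots> = \<pi> (?x (m - int n)) *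
        (\<Prod>k\<in>{m - int n + 1..m + int n}. edge_weight (?x (k - 1)) (?x k) (?B k))"
      by (rule W_cylinder) (use B in auto)
    also have "(\<Prod>k\<in>{m - int n + 1..m + int n}. edge_weight (?x (k - 1)) (?x k) (?B k)) =
        (\<Prod>k\<in>{- int n + 1..int n}. edge_weight (x (k - 1)) (x k) (B k))"
      by (rule prod.reindex_bij_witness[of _ "\<lambda>k. k + m" "\<lambda>k. k - m"]) (auto simp: algebra_simps)
    also have "\<pi> (?x (m - int n)) * \<dots> = emeasure W ?C"
      using W_cylinder[of "- int n" "int n" B x] B by simp
    finally show ?thesis .
  qed
  then show "\<And>n x B. (\<And>k. B k \<in> sets borel) \<Longrightarrow>
    emeasure (distr W path_space (path_shift m)) (cylinder {- int n..int n} {1 - int n..int n} x B) =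
    emeasure W (cylinder {- int n..int n} {1 - int n..int n} x B)" .
  show "emeasure (distr W path_space (path_shift m)) (cylinder {- int 0..int 0} {1 - int 0..int 0} x (\<lambda>_. UNIV)) \<noteq> \<infinity>" for x
  proof -
    have "cylinder {- int 0..int 0} {1 - int 0..int 0} x (\<lambda>_. UNIV) = {\<omega>. fst (\<omega> 0) = x 0}"
      by (auto simp: cylinder_def)
    then have "emeasure W (cylinder {- int 0..int 0} {1 - int 0..int 0} x (\<lambda>_. UNIV)) = \<pi> (x 0)"
      by (simp add: W_start)
    then show ?thesis using eq[of "\<lambda>_. UNIV" 0 x] \<pi>_finite[of "x 0"] by simp
  qed
qed (auto simp: incseq_def sets_W UN_symmetric_int)

text \<open>The product over the edges of a window splits at time \<open>0\<close>. Past and future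
  share the state at that time; if it conflicts with \<open>i\<close>, both sides vanish.\<close>

lemma W_markov_cylinder:
  assumes A: "\<And>k. A k \<in> sets borel" and B: "\<And>k. B k \<in> sets borel"
  shows "emeasure W {\<omega>. fst (\<omega> 0) = i \<and> past \<omega> \<in> cylinder {..n} {..<n} x A \<and> fut \<omega> \<in> cylinder {..m} {..<m} y B} =
    emeasure W {\<omega>. fst (\<omega> 0) = i \<and> past \<omega> \<in> cylinder {..n} {..<n} x A} * emeasure (L i) (cylinder {..m} {..<m} y B)"
proof (cases "x 0 = i \<and> y 0 = i")
  case False
  have past: "fst (\<omega> 0) = x 0" if "past \<omega> \<in> cylinder {..n} {..<n} x A" for \<omega>
    using that by (auto simp: cylinder_def past_def dest!: bspec[of "{..n}" _ 0])
  have fut: "fst (\<omega> 0) = y 0" if "fut \<omega> \<in> cylinder {..m} {..<m} y B" for \<omega>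
    using that by (auto simp: cylinder_def fut_def dest!: bspec[of "{..m}" _ 0])
  have "{\<omega>. fst (\<omega> 0) = i \<and> past \<omega> \<in> cylinder {..n} {..<n} x A \<and> fut \<omega> \<in> cylinder {..m} {..<m} y B} = {}"
  proof -
    have "\<not> (fst (\<omega> 0) = i \<and> past \<omega> \<in> cylinder {..n} {..<n} x A \<and> fut \<omega> \<in> cylinder {..m} {..<m} y B)" for \<omega>
      using False past[of \<omega>] fut[of \<omega>] by auto
    then show ?thesis by simp
  qed
  moreover have "{\<omega>. fst (\<omega> 0) = i \<and> past \<omega> \<in> cylinder {..n} {..<n} x A} = {} \<or>
      emeasure (L i) (cylinder {..m} {..<m} y B) = 0"
    using False past L_cylinder[of B i m y] B by auto
  ultimately show ?thesis
    by (elim disjE) (simp_all only: emeasure_empty mult_zero_left mult_zero_right)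
next
  case True
  \<comment> \<open>The two words are glued into one two-sided word. The shared state at time
    \<open>0\<close> may be taken from either, but the increment at time \<open>0\<close> lies on
    the edge from \<open>-1\<close> to \<open>0\<close> and belongs to the past; hence
    \<open>Z\<close> switches at \<open>1\<close>, not at \<open>0\<close>.\<close>
  define z where "z k = (if k \<ge> 0 then y (nat k) else x (nat (- k)))" for k :: int
  define Z where "Z k = (if k \<ge> 1 then B (nat (k - 1)) else A (nat (- k)))" for k :: int
  have Z: "Z k \<in> sets borel" for k unfolding Z_def using A B by auto
  have past_C: "fst (\<omega> 0) = i \<and> past \<omega> \<in> cylinder {..n} {..<n} x A \<longleftrightarrow>
      (\<forall>k\<in>{- int n..0}. fst (\<omega> k) = z k) \<and> (\<forall>k\<in>{- int n + 1..0}. snd (\<omega> k) \<in> Z k)" for \<omega>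
  proof -
    have "(\<forall>k\<le>n. fst (\<omega> (- int k)) = x k) \<longleftrightarrow> (\<forall>k\<in>{- int n..0}. fst (\<omega> k) = z k)"
    proof (intro iffI ballI allI impI)
      fix k assume *: "\<forall>k\<le>n. fst (\<omega> (- int k)) = x k" "k \<in> {- int n..0}"
      then have "nat (- k) \<le> n" "- int (nat (- k)) = k" by auto
      with *(1) have "fst (\<omega> k) = x (nat (- k))" by metis
      then show "fst (\<omega> k) = z k" using * True by (auto simp: z_def)
    next
      fix k assume *: "\<forall>k\<in>{- int n..0}. fst (\<omega> k) = z k" "k \<le> n"
      then show "fst (\<omega> (- int k)) = x k" using *(1)[rule_format, of "- int k"] True by (auto simp: z_def split: if_splits)
    qed
    moreover have "(\<forall>k<n. snd (\<omega> (- int k)) \<in> A k) \<longleftrightarrow> (\<forall>k\<in>{- int n + 1..0}. snd (\<omega> k) \<in> Z k)"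
    proof (intro iffI ballI allI impI)
      fix k assume *: "\<forall>k<n. snd (\<omega> (- int k)) \<in> A k" "k \<in> {- int n + 1..0}"
      then have "nat (- k) < n" "- int (nat (- k)) = k" by auto
      with *(1) have "snd (\<omega> k) \<in> A (nat (- k))" by metis
      then show "snd (\<omega> k) \<in> Z k" using * by (auto simp: Z_def)
    next
      fix k assume *: "\<forall>k\<in>{- int n + 1..0}. snd (\<omega> k) \<in> Z k" "k < n"
      then show "snd (\<omega> (- int k)) \<in> A k" using *(1)[rule_format, of "- int k"] by (auto simp: Z_def)
    qed
    moreover have "(\<forall>k\<le>n. fst (\<omega> (- int k)) = x k) \<longrightarrow> fst (\<omega> 0) = i"
      using True by (auto dest: spec[of _ 0])
    ultimately show ?thesis by (auto simp: cylinder_def past_def)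
  qed
  have fut_C: "fst (\<omega> 0) = i \<and> fut \<omega> \<in> cylinder {..m} {..<m} y B \<longleftrightarrow>
      (\<forall>k\<in>{0..int m}. fst (\<omega> k) = z k) \<and> (\<forall>k\<in>{1..int m}. snd (\<omega> k) \<in> Z k)" for \<omega>
  proof -
    have "(\<forall>k\<le>m. fst (\<omega> (int k)) = y k) \<longleftrightarrow> (\<forall>k\<in>{0..int m}. fst (\<omega> k) = z k)"
    proof (intro iffI ballI allI impI)
      fix k assume *: "\<forall>k\<le>m. fst (\<omega> (int k)) = y k" "k \<in> {0..int m}"
      then have "nat k \<le> m" "int (nat k) = k" by auto
      with *(1) have "fst (\<omega> k) = y (nat k)" by metis
      then show "fst (\<omega> k) = z k" using * by (auto simp: z_def)
    next
      fix k assume *: "\<forall>k\<in>{0..int m}. fst (\<omega> k) = z k" "k \<le> m"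
      then show "fst (\<omega> (int k)) = y k" using *(1)[rule_format, of "int k"] by (auto simp: z_def)
    qed
    moreover have "(\<forall>k<m. snd (\<omega> (int k + 1)) \<in> B k) \<longleftrightarrow> (\<forall>k\<in>{1..int m}. snd (\<omega> k) \<in> Z k)"
    proof (intro iffI ballI allI impI)
      fix k assume *: "\<forall>k<m. snd (\<omega> (int k + 1)) \<in> B k" "k \<in> {1..int m}"
      then have "nat (k - 1) < m" "int (nat (k - 1)) + 1 = k" by auto
      with *(1) have "snd (\<omega> k) \<in> B (nat (k - 1))" by metis
      then show "snd (\<omega> k) \<in> Z k" using * by (auto simp: Z_def)
    next
      fix k assume *: "\<forall>k\<in>{1..int m}. snd (\<omega> k) \<in> Z k" "k < m"
      then show "snd (\<omega> (int k + 1)) \<in> B k" using *(1)[rule_format, of "int k + 1"] by (auto simp: Z_def)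
    qed
    moreover have "(\<forall>k\<le>m. fst (\<omega> (int k)) = y k) \<longrightarrow> fst (\<omega> 0) = i"
      using True by (auto dest: spec[of _ 0])
    ultimately show ?thesis by (auto simp: cylinder_def fut_def)
  qed
  have 1: "{\<omega>. fst (\<omega> 0) = i \<and> past \<omega> \<in> cylinder {..n} {..<n} x A} = cylinder {- int n..0} {- int n + 1..0} z Z"
    by (simp only: past_C cylinder_def[of "{- int n..0}"])
  have "fst (\<omega> 0) = i \<and> past \<omega> \<in> cylinder {..n} {..<n} x A \<and> fut \<omega> \<in> cylinder {..m} {..<m} y B \<longleftrightarrow>
      \<omega> \<in> cylinder {- int n..int m} {- int n + 1..int m} z Z" for \<omega>
  proof -
    have "{- int n..int m} = {- int n..0} \<union> {0..int m}" "{- int n + 1..int m} = {- int n + 1..0} \<union> {1..int m}" by auto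
    then have "\<omega> \<in> cylinder {- int n..int m} {- int n + 1..int m} z Z \<longleftrightarrow>
      (fst (\<omega> 0) = i \<and> past \<omega> \<in> cylinder {..n} {..<n} x A) \<and> (fst (\<omega> 0) = i \<and> fut \<omega> \<in> cylinder {..m} {..<m} y B)"
      unfolding past_C fut_C unfolding cylinder_def by (simp add: ball_Un) blast
    then show ?thesis by blast
  qed
  then have 2: "{\<omega>. fst (\<omega> 0) = i \<and> past \<omega> \<in> cylinder {..n} {..<n} x A \<and> fut \<omega> \<in> cylinder {..m} {..<m} y B} =
      cylinder {- int n..int m} {- int n + 1..int m} z Z" by blast
  have "(\<Prod>k\<in>{- int n + 1..int m}. edge_weight (z (k - 1)) (z k) (Z k)) =
      (\<Prod>k\<in>{- int n + 1..0}. edge_weight (z (k - 1)) (z k) (Z k)) * (\<Prod>k\<in>{1..int m}. edge_weight (z (k - 1)) (z k) (Z k))"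
  proof -
    have "{- int n + 1..int m} = {- int n + 1..0} \<union> {1..int m}" by auto
    then show ?thesis by (simp only:) (rule prod.union_disjoint, auto)
  qed
  moreover have "(\<Prod>k\<in>{1..int m}. edge_weight (z (k - 1)) (z k) (Z k)) = (\<Prod>k<m. edge_weight (y k) (y (Suc k)) (B k))"
    by (rule prod.reindex_bij_witness[of _ "\<lambda>k. int k + 1" "\<lambda>k. nat (k - 1)"])
      (auto simp: z_def Z_def Suc_nat_eq_nat_zadd1 nat_diff_distrib)
  ultimately show ?thesis
    unfolding 1 2
    using True W_cylinder[of "- int n" "int m" Z z] W_cylinder[of "- int n" 0 Z z] L_cylinder[of B i m y] Z B
    by (simp add: mult.assoc)
qed

end

section \<open>Markov property, recurrence and divergence of the path laws\<close>

context mrw_two_sided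
begin

lemma prob_L: "prob_space (L i)"
  unfolding L_def by (rule prob_space.prob_space_distr[OF prob_P]) measurable

lemma emeasure_W_start_le:
  assumes [measurable]: "Measurable.pred path_space R"
  shows "emeasure W {\<omega>. fst (\<omega> 0) = i \<and> R \<omega>} < \<infinity>"
proof -
  have "emeasure W {\<omega>. fst (\<omega> 0) = i \<and> R \<omega>} \<le> \<pi> i"
    unfolding W_start[symmetric] by (rule emeasure_mono) auto
  then show ?thesis using \<pi>_finite[of i] by (rule le_less_trans)
qed

lemma W_distr_density:
  assumes [measurable]: "Measurable.pred path_space C" "f \<in> measurable path_space path_space" "D \<in> sets path_space"
  shows "emeasure (distr (density W (\<lambda>\<omega>. of_bool (C \<omega>))) path_space f) D = emeasure W {\<omega>. C \<omega> \<and> f \<omega> \<in> D}"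
  by (subst emeasure_distr_density_of_bool) auto

lemma cylinder_sets:
  "(\<And>k. B k \<in> sets borel) \<Longrightarrow> finite K \<Longrightarrow> finite J \<Longrightarrow> cylinder K J x B \<in> sets path_space"
  using pred_cylinder[of B K J x] by (simp add: pred_def)

text \<open>The extension from cylinders takes two rounds. Here the past event stays a cylinder, and
  both sides are measures in the future event \<open>B\<close>.\<close>

lemma W_markov_past_cylinder:
  assumes A: "\<And>k. A k \<in> sets borel" and B: "B \<in> sets path_space"
  shows "emeasure W {\<omega>. fst (\<omega> 0) = i \<and> past \<omega> \<in> cylinder {..n} {..<n} x A \<and> fut \<omega> \<in> B} =
    emeasure W {\<omega>. fst (\<omega> 0) = i \<and> past \<omega> \<in> cylinder {..n} {..<n} x A} * emeasure (L i) B"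
proof -
  let ?H = "cylinder {..n} {..<n} x A"
  let ?C = "\<lambda>\<omega>. fst (\<omega> 0) = i \<and> past \<omega> \<in> ?H"
  have [measurable]: "?H \<in> sets path_space" by (rule cylinder_sets) (auto intro: A)
  let ?\<mu> = "distr (density W (\<lambda>\<omega>. of_bool (?C \<omega>))) path_space fut"
  let ?\<nu> = "density (L i) (\<lambda>_. emeasure W {\<omega>. ?C \<omega>})"
  have \<mu>: "emeasure ?\<mu> D = emeasure W {\<omega>. ?C \<omega> \<and> fut \<omega> \<in> D}" if [measurable]: "D \<in> sets path_space" for D
    by (rule W_distr_density) measurable
  have \<nu>: "emeasure ?\<nu> D = emeasure W {\<omega>. ?C \<omega>} * emeasure (L i) D" if "D \<in> sets path_space" for D
    using that by (simp add: emeasure_density nn_integral_cmult_indicator sets_L)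
  have "?\<mu> = ?\<nu>"
  proof (rule cylinder_measure_eqI[where K = "\<lambda>n. {..n}" and J = "\<lambda>n. {..<n}"])
    fix m and y :: "nat \<Rightarrow> 'a" and D :: "nat \<Rightarrow> real set" assume D: "\<And>k. D k \<in> sets borel"
    have [measurable]: "cylinder {..m} {..<m} y D \<in> sets path_space" by (rule cylinder_sets) (auto intro: D)
    show "emeasure ?\<mu> (cylinder {..m} {..<m} y D) = emeasure ?\<nu> (cylinder {..m} {..<m} y D)"
      using W_markov_cylinder[of A D i n x m y] A D by (simp add: \<mu> \<nu>)
  next
    fix y :: "nat \<Rightarrow> 'a"
    have [measurable]: "cylinder {..0} {..<0} y (\<lambda>_. UNIV) \<in> sets path_space" by (rule cylinder_sets) auto
    have "emeasure W {\<omega>. fst (\<omega> 0) = i \<and> past \<omega> \<in> ?H \<and> fut \<omega> \<in> cylinder {..0} {..<0} y (\<lambda>_. UNIV)} < \<infinity>"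
      by (rule emeasure_W_start_le) measurable
    then show "emeasure ?\<mu> (cylinder {..0} {..<0} y (\<lambda>_. UNIV)) \<noteq> \<infinity>"
      by (simp add: \<mu> del: lessThan_0 atMost_0)
  qed (auto simp: incseq_def sets_L UN_atMost_nat UN_lessThan_nat)
  then show ?thesis using \<mu>[OF B] \<nu>[OF B] by simp
qed

text \<open>The second round: with the future event fixed, both sides are measures in
  \<open>H\<close>.\<close>

lemma W_markov:
  assumes H: "H \<in> sets path_space" and B [measurable]: "B \<in> sets path_space"
  shows "emeasure W {\<omega>. fst (\<omega> 0) = i \<and> past \<omega> \<in> H \<and> fut \<omega> \<in> B} =
    emeasure W {\<omega>. fst (\<omega> 0) = i \<and> past \<omega> \<in> H} * emeasure (L i) B"
proof -
  let ?C = "\<lambda>\<omega>. fst (\<omega> 0) = i \<and> fut \<omega> \<in> B"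
  let ?\<mu> = "distr (density W (\<lambda>\<omega>. of_bool (?C \<omega>))) path_space past"
  let ?base = "distr (density W (\<lambda>\<omega>. of_bool (fst (\<omega> 0) = i))) path_space past"
  let ?\<nu> = "density ?base (\<lambda>_. emeasure (L i) B)"
  have \<mu>: "emeasure ?\<mu> D = emeasure W {\<omega>. ?C \<omega> \<and> past \<omega> \<in> D}" if [measurable]: "D \<in> sets path_space" for D
    by (rule W_distr_density) measurable
  have base: "emeasure ?base D = emeasure W {\<omega>. fst (\<omega> 0) = i \<and> past \<omega> \<in> D}" if [measurable]: "D \<in> sets path_space" for D
    by (rule W_distr_density) measurable
  have \<nu>: "emeasure ?\<nu> D = emeasure (L i) B * emeasure W {\<omega>. fst (\<omega> 0) = i \<and> past \<omega> \<in> D}"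
    if [measurable]: "D \<in> sets path_space" for D
  proof -
    have "emeasure ?\<nu> D = emeasure (L i) B * emeasure ?base D"
      by (subst emeasure_density) (auto simp: nn_integral_cmult_indicator)
    then show ?thesis by (simp only: base[OF that])
  qed
  have "?\<mu> = ?\<nu>"
  proof (rule cylinder_measure_eqI[where K = "\<lambda>n. {..n}" and J = "\<lambda>n. {..<n}"])
    fix n and x :: "nat \<Rightarrow> 'a" and A :: "nat \<Rightarrow> real set" assume A: "\<And>k. A k \<in> sets borel"
    have C: "cylinder {..n} {..<n} x A \<in> sets path_space" by (rule cylinder_sets) (auto intro: A)
    show "emeasure ?\<mu> (cylinder {..n} {..<n} x A) = emeasure ?\<nu> (cylinder {..n} {..<n} x A)"
      unfolding \<mu>[OF C] \<nu>[OF C]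
      using W_markov_past_cylinder[OF A B, of i n x] by (simp add: conj_ac mult.commute)
  next
    fix y :: "nat \<Rightarrow> 'a"
    have C [measurable]: "cylinder {..0} {..<0} y (\<lambda>_. UNIV) \<in> sets path_space" by (rule cylinder_sets) auto
    have "emeasure W {\<omega>. fst (\<omega> 0) = i \<and> fut \<omega> \<in> B \<and> past \<omega> \<in> cylinder {..0} {..<0} y (\<lambda>_. UNIV)} < \<infinity>"
      by (rule emeasure_W_start_le) measurable
    then show "emeasure ?\<mu> (cylinder {..0} {..<0} y (\<lambda>_. UNIV)) \<noteq> \<infinity>"
      unfolding \<mu>[OF C] by (simp only: conj_assoc infinity_ennreal_def less_irrefl simp_thms)
  qed (auto simp: incseq_def UN_atMost_nat UN_lessThan_nat)
  then have "emeasure ?\<mu> H = emeasure ?\<nu> H" by (rule arg_cong)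
  then show ?thesis unfolding \<mu>[OF H] \<nu>[OF H] by (simp add: conj_ac mult.commute)
qed

lemma L_start: "AE \<eta> in L i. fst (\<eta> 0) = i"
proof -
  have eq: "cylinder {..0} {..<0} (\<lambda>_. i) (\<lambda>_. UNIV) = {\<eta> :: nat \<Rightarrow> 'a \<times> real. fst (\<eta> 0) = i}"
    by (simp add: cylinder_def)
  have "emeasure (L i) {\<eta>. fst (\<eta> 0) = i} = 1"
    using L_cylinder[of "\<lambda>_. UNIV" i 0 "\<lambda>_. i"] unfolding eq by simp
  then have "prob_space.prob (L i) {\<eta> \<in> space (L i). fst (\<eta> 0) = i} = 1"
    by (simp add: measure_def)
  then show ?thesis by (subst (asm) prob_space.prob_Collect_eq_1[OF prob_L]) auto
qed

lemma L_first_step: "emeasure (L i) {\<eta>. fst (\<eta> 1) = j} = ennreal (p i j)"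
proof -
  let ?x = "\<lambda>k :: nat. if k = 0 then i else j"
  have "emeasure (L i) {\<eta>. fst (\<eta> 1) = j} = emeasure (L i) (cylinder {..1} {..<1} ?x (\<lambda>_. UNIV))"
  proof (rule emeasure_eq_AE)
    have eq: "\<eta> \<in> cylinder {..1} {..<1} ?x (\<lambda>_. UNIV) \<longleftrightarrow> fst (\<eta> 0) = i \<and> fst (\<eta> 1) = j" for \<eta> :: "nat \<Rightarrow> 'a \<times> real"
    proof -
      have "{..1 :: nat} = {0, 1}" by auto
      then show ?thesis by (simp add: cylinder_def)
    qed
    show "AE \<eta> in L i. \<eta> \<in> {\<eta>. fst (\<eta> 1) = j} \<longleftrightarrow> \<eta> \<in> cylinder {..1} {..<1} ?x (\<lambda>_. UNIV)"
      unfolding eq using L_start[of i] by (rule eventually_mono) simp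
    show "cylinder {..1} {..<1} ?x (\<lambda>_. UNIV) \<in> sets (L i)"
      unfolding sets_L by (rule cylinder_sets) auto
  qed measurable
  also have "\<dots> = ennreal (p i j)"
  proof -
    have "emeasure (F i j) UNIV = 1"
      using prob_space.emeasure_space_1[OF prob_F[of i j]] sets_eq_imp_space_eq[OF sets_F[of i j]] by simp
    then show ?thesis using L_cylinder[of "\<lambda>_. UNIV" i 1 ?x] by simp
  qed
  finally show ?thesis .
qed

lemma L_returns: "AE \<eta> in L i. \<exists>n\<ge>1. fst (\<eta> n) = i"
proof -
  interpret prob_space "P i" by (rule prob_P)
  have "prob {w \<in> space (P i). \<exists>n\<ge>1. Some (M n w) \<in> Some ` {i}} = 1"
    using rec unfolding null_recurrent_on_def recurrent_on_def return_time_finite_iff by blast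
  from AE_prob_1[OF this] have "AE w in P i. \<exists>n\<ge>1. M n w = i"
    by (rule eventually_mono) blast
  then show ?thesis
    unfolding L_def by (subst AE_distr_iff) (auto simp: one_sided_path_def)
qed

text \<open>The conditioning events have positive finite mass, and countably many of them cover the
  space, so the conditional statements add up to one under \<open>W\<close>.\<close>

lemma W_divergent: "AE \<omega> in W. past_divergent \<omega>"
proof -
  have level: "level (two_sided_path w) k = two_sided_walk X2 k w" for w k
    by (simp add: level_def two_sided_walk_def two_sided_path_def)
  have "AE w in Q. M2 0 w = i \<longrightarrow> past_divergent (two_sided_path w)" for i
  proof -
    let ?S = "{w \<in> space Q. M2 0 w = i}"
    have S: "emeasure Q ?S = \<pi> i"
      using W_start[of i] by (subst (asm) emeasure_W) (auto simp: two_sided_path_def)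
    have "AE w in uniform_measure Q ?S. filterlim (\<lambda>n. dual_walk X2 n w) at_top sequentially"
      using dual unfolding dual_positive_divergent_def cond_start_def by blast
    then have "AE w in Q. w \<in> ?S \<longrightarrow> filterlim (\<lambda>n. dual_walk X2 n w) at_top sequentially"
      by (subst (asm) AE_uniform_measure) (use S \<pi>_pos'[rule_format, of i] \<pi>_finite[of i] in auto)
    then show ?thesis
    proof (rule AE_mp, intro AE_I2 impI)
      fix w assume "w \<in> space Q" "M2 0 w = i"
        "w \<in> ?S \<longrightarrow> filterlim (\<lambda>n. dual_walk X2 n w) at_top sequentially"
      then have lim: "filterlim (\<lambda>n. dual_walk X2 n w) at_top sequentially" by simp
      show "past_divergent (two_sided_path w)"
        unfolding past_divergent_def
      proof
        fix N :: nat
        from lim have "eventually (\<lambda>n. real N < dual_walk X2 n w) sequentially"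
          by (simp add: filterlim_at_top_dense)
        then obtain m where "\<And>n. n \<ge> m \<Longrightarrow> real N < dual_walk X2 n w"
          by (auto simp: eventually_sequentially)
        then show "\<exists>m. \<forall>n\<ge>m. level (two_sided_path w) (- int n) < - real N"
          unfolding level dual_walk_def by (intro exI[of _ m]) force
      qed
    qed
  qed
  then have "AE w in Q. \<forall>i. M2 0 w = i \<longrightarrow> past_divergent (two_sided_path w)"
    unfolding AE_all_countable by blast
  then have "AE w in Q. past_divergent (two_sided_path w)" by (rule eventually_mono) blast
  moreover have [measurable]: "Measurable.pred path_space (past_divergent :: (int \<Rightarrow> 'a \<times> real) \<Rightarrow> bool)"
    unfolding past_divergent_def by measurable
  ultimately show ?thesis unfolding W_def by (subst AE_distr_iff) auto
qed

sublocale walk: stationary_walk p \<pi> W L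
proof (rule stationary_walk.intro)
  show "0 < \<pi> i" for i using \<pi>_pos' by simp
qed (fact sets_W sets_L prob_L W_shift W_start \<pi>_finite W_markov L_first_step L_returns ess W_divergent)+

section \<open>Transfer of the results to the given processes\<close>

lemma path_ladder_one_sided_path: "path_ladder n (one_sided_path w) = ladder_chain M X n w"
proof -
  have "walk (\<lambda>k \<eta>. snd (\<eta> (k - 1))) k (one_sided_path w) = walk X k w" for k
    unfolding walk_def by (intro sum.cong) (auto simp: one_sided_path_def)
  then show ?thesis
    by (auto simp: path_ladder_def ladder_chain_def one_sided_path_def split: enat.split)
qed

lemma return_time_one_sided_path:
  "return_time path_ladder A (one_sided_path w) = return_time (ladder_chain M X) A w"
  by (simp add: return_time_def path_ladder_one_sided_path)

lemma sigma_two_sided_path: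
  "sigma0 coord_step (two_sided_path w) = sigma0 X2 w"
  "sigma1 coord_step (two_sided_path w) = sigma1 X2 w"
proof -
  have "two_sided_walk coord_step k (two_sided_path w) = two_sided_walk X2 k w" for k
    by (simp add: two_sided_walk_def two_sided_path_def)
  then show "sigma0 coord_step (two_sided_path w) = sigma0 X2 w"
    "sigma1 coord_step (two_sided_path w) = sigma1 X2 w"
    by (simp_all add: sigma0_def sigma1_def is_record_def)
qed

lemma prob_eq_1_if_AE:
  assumes [measurable]: "Measurable.pred path_space R" and "AE \<eta> in L i. R \<eta>"
  shows "measure (P i) {w \<in> space (P i). R (one_sided_path w)} = 1"
proof -
  have "AE w in P i. R (one_sided_path w)"
    using assms(2) unfolding L_def by (subst (asm) AE_distr_iff) auto
  then show ?thesis by (subst prob_space.prob_Collect_eq_1[OF prob_P]) auto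
qed

lemma ladder_matrix_eq: "ennreal (ladder_matrix P M X i j) = emeasure (L i) {\<eta>. path_ladder 1 \<eta> = Some j}"
proof -
  interpret prob_space "P i" by (rule prob_P)
  have "emeasure (L i) {\<eta>. path_ladder 1 \<eta> = Some j} =
      emeasure (P i) {w \<in> space (P i). path_ladder 1 (one_sided_path w) = Some j}"
    by (rule emeasure_L) measurable
  then show ?thesis
    by (simp add: ladder_matrix_def path_ladder_one_sided_path emeasure_eq_measure)
qed

lemma gap_integral:
  "(\<integral>\<^sup>+ w. ennreal (1 / real_of_int (sigma1 X2 w - sigma0 X2 w)) * of_bool (T (M2 (sigma0 X2 w) w)) \<partial>Q) =
    emeasure W {\<omega>. T (fst (\<omega> 0)) \<and> strict_record \<omega> 0}"
proof -
  have [measurable]: "(\<lambda>\<omega> :: int \<Rightarrow> 'a \<times> real. fst (\<omega> (sigma0 coord_step \<omega>))) \<in> measurable path_space (count_space UNIV)"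
    by (rule measurable_compose_countable[where f = "\<lambda>k \<omega>. fst (\<omega> k)"]) measurable
  have "(\<integral>\<^sup>+ w. ennreal (1 / real_of_int (sigma1 X2 w - sigma0 X2 w)) * of_bool (T (M2 (sigma0 X2 w) w)) \<partial>Q) =
      (\<integral>\<^sup>+ \<omega>. ennreal (1 / real_of_int (sigma1 coord_step \<omega> - sigma0 coord_step \<omega>)) *
        of_bool (T (fst (\<omega> (sigma0 coord_step \<omega>)))) \<partial>W)"
    unfolding W_def by (subst nn_integral_distr) (auto simp: sigma_two_sided_path, simp add: two_sided_path_def)
  then show ?thesis by (simp only: walk.nn_integral_gap)
qed

lemma emeasure_Q_sigma0:
  "emeasure Q {w \<in> space Q. T (M2 0 w) \<and> sigma0 X2 w = 0} = emeasure W {\<omega>. T (fst (\<omega> 0)) \<and> strict_record \<omega> 0}"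
proof -
  have "emeasure W {\<omega>. T (fst (\<omega> 0)) \<and> sigma0 coord_step \<omega> = 0} =
      emeasure Q {w \<in> space Q. T (fst (two_sided_path w 0)) \<and> sigma0 coord_step (two_sided_path w) = 0}"
    by (rule emeasure_W) measurable
  then show ?thesis
    unfolding walk.emeasure_sigma0 sigma_two_sided_path by (simp add: two_sided_path_def)
qed

lemma mean_inverse_gap_eq: "mean_inverse_gap Q X2 = emeasure W {\<omega>. strict_record \<omega> 0}"
  using gap_integral[of "\<lambda>_. True"] by (simp add: mean_inverse_gap_def)

lemma emeasure_sigma0_eq: "emeasure Q {w \<in> space Q. sigma0 X2 w = 0} = emeasure W {\<omega>. strict_record \<omega> 0}"
  using emeasure_Q_sigma0[of "\<lambda>_. True"] by simp

lemma emeasure_sigma0_start_eq: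
  "emeasure Q {w \<in> space Q. M2 0 w = i \<and> sigma0 X2 w = 0} = walk.record_weight i"
  using emeasure_Q_sigma0[of "\<lambda>l. l = i"] by (simp add: walk.record_weight_def record_at_def)

lemma ladder_measure_eq: "ladder_measure Q M2 X2 i = inverse (ladder_const Q X2) * walk.record_weight i"
  using gap_integral[of "\<lambda>l. l = i"]
  by (simp add: ladder_measure_def walk.record_weight_def record_at_def indicator_def)

lemma record_prob_pos: "emeasure W {\<omega>. strict_record \<omega> 0} \<noteq> 0"
proof -
  obtain j where "j \<in> walk.record_states" using walk.record_states_nonempty by blast
  then have "0 < walk.record_weight j" by (simp add: walk.record_states_def)
  also have "\<dots> \<le> emeasure W {\<omega>. strict_record \<omega> 0}"
    unfolding walk.record_weight_def by (rule emeasure_mono) (auto simp: record_at_def)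
  finally show ?thesis by simp
qed

text \<open>Zero is excluded because records have positive mass, and \<open>\<infinity>\<close> by
  the default value \<open>1\<close>. So normalisation changes neither the support nor
  stationarity.\<close>

lemma ladder_const_pos: "ladder_const Q X2 \<noteq> 0" and ladder_const_finite: "ladder_const Q X2 < \<infinity>"
  using record_prob_pos by (auto simp: ladder_const_def mean_inverse_gap_eq)

lemma ladder_measure_support: "{i. 0 < ladder_measure Q M2 X2 i} = walk.record_states"
  using ladder_const_finite ladder_const_pos
  by (auto simp: ladder_measure_eq walk.record_states_def ennreal_zero_less_mult_iff ennreal_inverse_positive)

lemma ess_unique_ladder_measure:
  "ess_unique_stationary_measure (ladder_matrix P M X) (ladder_measure Q M2 X2)"
proof -
  let ?c = "ladder_const Q X2"
  have c: "?c \<noteq> 0" "?c < \<infinity>" "inverse ?c < \<infinity>" "inverse ?c \<noteq> 0"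
    using ladder_const_pos ladder_const_finite by (auto simp flip: less_top)
  have "stationary_measure (ladder_matrix P M X) (ladder_measure Q M2 X2)"
    unfolding stationary_measure_def
  proof (intro conjI allI)
    show "ladder_measure Q M2 X2 i < \<infinity>" for i
      using c(3) walk.record_weight_finite[of i] by (simp add: ladder_measure_eq ennreal_mult_less_top)
    show "\<exists>i. ladder_measure Q M2 X2 i \<noteq> 0"
      using walk.record_states_nonempty unfolding ladder_measure_support[symmetric] by (auto simp: less_le)
    show "(\<integral>\<^sup>+ i. ladder_measure Q M2 X2 i * ennreal (ladder_matrix P M X i j) \<partial>count_space UNIV) = ladder_measure Q M2 X2 j" for j
      unfolding ladder_measure_eq ladder_matrix_eq mult.assoc
      by (subst nn_integral_cmult) (simp_all only: walk.record_weight_stationary, simp)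
  qed
  moreover have "\<exists>a>0. \<forall>i. \<nu> i = ennreal a * ladder_measure Q M2 X2 i"
    if \<nu>: "stationary_measure (ladder_matrix P M X) \<nu>" for \<nu>
  proof -
    from \<nu> obtain i0 where "\<nu> i0 \<noteq> 0" by (auto simp: stationary_measure_def)
    then obtain a where a: "a > 0" "\<And>i. \<nu> i = ennreal a * walk.record_weight i"
      using walk.prob_ladder_unique[of \<nu> i0] \<nu>
      unfolding stationary_measure_def ladder_matrix_eq by blast
    \<comment> \<open>The factor \<open>r\<close> undoes the normalisation by
      \<open>inverse ?c\<close>, which makes \<open>a * r\<close> the scalar for the normalised
      measure.\<close>
    obtain r where r: "?c = ennreal r" "r > 0"
      using c(1,2) by (cases "?c") (auto simp: less_le)
    have "\<nu> i = ennreal (a * r) * ladder_measure Q M2 X2 i" for i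
    proof -
      have "ennreal r * inverse (ennreal r) = 1"
        using r by (simp add: inverse_ennreal flip: ennreal_mult)
      then have "ennreal a * (ennreal r * inverse (ennreal r)) * walk.record_weight i = \<nu> i"
        by (simp add: a(2))
      then show ?thesis
        using a(1) r by (simp add: ladder_measure_eq ennreal_mult mult.assoc)
    qed
    with a(1) r(2) show ?thesis by (intro exI[of _ "a * r"]) simp
  qed
  ultimately show ?thesis unfolding ess_unique_stationary_measure_def by blast
qed

lemma density_ladder_measure:
  "density (point_measure UNIV \<pi>)
      (\<lambda>i. inverse (ladder_const Q X2) * emeasure (cond_start Q M2 i) {w \<in> space Q. sigma0 X2 w = 0}) =
    point_measure UNIV (ladder_measure Q M2 X2)"
proof -
  have [measurable]: "{w \<in> space Q. sigma0 X2 w = 0} \<in> sets Q"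
  proof -
    have "(\<lambda>w. sigma0 coord_step (two_sided_path w)) \<in> measurable Q (count_space UNIV)" by measurable
    then show ?thesis unfolding sigma_two_sided_path by measurable
  qed
  have "\<pi> i * (inverse (ladder_const Q X2) * emeasure (cond_start Q M2 i) {w \<in> space Q. sigma0 X2 w = 0}) =
      ladder_measure Q M2 X2 i" for i
  proof -
    have "emeasure (cond_start Q M2 i) {w \<in> space Q. sigma0 X2 w = 0} =
        emeasure Q ({w \<in> space Q. M2 0 w = i} \<inter> {w \<in> space Q. sigma0 X2 w = 0}) / emeasure Q {w \<in> space Q. M2 0 w = i}"
      unfolding cond_start_def by (rule emeasure_uniform_measure) measurable
    also have "{w \<in> space Q. M2 0 w = i} \<inter> {w \<in> space Q. sigma0 X2 w = 0} = {w \<in> space Q. M2 0 w = i \<and> sigma0 X2 w = 0}"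
      by auto
    also have "emeasure Q \<dots> = walk.record_weight i" by (rule emeasure_sigma0_start_eq)
    also have "emeasure Q {w \<in> space Q. M2 0 w = i} = \<pi> i"
      using W_start[of i] by (subst (asm) emeasure_W) (auto simp: two_sided_path_def)
    finally have "\<pi> i * emeasure (cond_start Q M2 i) {w \<in> space Q. sigma0 X2 w = 0} = walk.record_weight i"
      using \<pi>_pos'[rule_format, of i] \<pi>_finite[of i]
      by (simp add: ennreal_times_divide mult.commute[of "\<pi> i"] mult_divide_eq_ennreal)
    then show ?thesis unfolding ladder_measure_eq by (metis mult.left_commute)
  qed
  then show ?thesis
    unfolding point_measure_def by (subst density_density_eq) simp_all
qed

lemma ladder_recurrent: "recurrent_on P (ladder_chain M X) walk.record_states"
  unfolding recurrent_on_def
proof (intro conjI ballI)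
  show "walk.record_states \<noteq> {}" by (rule walk.record_states_nonempty)
  fix i assume i: "i \<in> walk.record_states"
  have "measure (P i) {w \<in> space (P i). path_ladder 1 (one_sided_path w) \<in> Some ` walk.record_states} = 1"
    by (rule prob_eq_1_if_AE[OF _ walk.AE_ladder_closed[OF i]]) measurable
  then show "measure (P i) {w \<in> space (P i). ladder_chain M X 1 w \<in> Some ` walk.record_states} = 1"
    by (simp only: path_ladder_one_sided_path)
  have "measure (P i) {w \<in> space (P i). \<exists>n\<ge>1. path_ladder n (one_sided_path w) = Some i} = 1"
    by (rule prob_eq_1_if_AE[OF _ walk.AE_return_state[OF i]]) measurable
  then show "measure (P i) {w \<in> space (P i). return_time (ladder_chain M X) {i} w < \<infinity>} = 1"
    unfolding return_time_finite_iff path_ladder_one_sided_path by simp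
  fix j assume j: "j \<in> walk.record_states"
  interpret prob_space "P i" by (rule prob_P)
  \<comment> \<open>If \<open>j\<close> were never reached from \<open>i\<close>, the expected
    number of visits would be \<open>0\<close> instead of infinite.\<close>
  show "\<exists>n. 0 < measure (P i) {w \<in> space (P i). ladder_chain M X n w = Some j}"
  proof (rule ccontr)
    assume "\<not> ?thesis"
    then have "measure (P i) {w \<in> space (P i). ladder_chain M X n w = Some j} = 0" for n
      by (metis measure_nonneg less_le)
    then have "emeasure (L i) {\<eta>. path_ladder n \<eta> = Some j} = 0" for n
      by (subst emeasure_L) (auto simp: path_ladder_one_sided_path emeasure_eq_measure)
    with walk.prob_ladder_sum_infinite[OF j, of i] show False by simp
  qed
qed

lemma ladder_hits_record_states:
  "measure (P i) {w \<in> space (P i). return_time (ladder_chain M X) walk.record_states w < \<infinity>} = 1"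
proof -
  have "measure (P i) {w \<in> space (P i). \<exists>n\<ge>1. path_ladder n (one_sided_path w) \<in> Some ` walk.record_states} = 1"
    by (rule prob_eq_1_if_AE[OF _ walk.AE_return_record_states]) measurable
  then show ?thesis
    unfolding return_time_finite_iff path_ladder_one_sided_path by simp
qed

text \<open>By Kac's formula, weight times mean return time has the same value for all states of the
  class. The weights are positive and finite, so either all mean return times are finite or none
  is.\<close>

lemma ladder_positive_recurrent_iff:
  "positive_recurrent_on P (ladder_chain M X) walk.record_states \<longleftrightarrow> emeasure W {\<omega>. strict_record \<omega> 0} < \<infinity>"
proof -
  have kac: "walk.record_weight i * mean_return_time P (ladder_chain M X) i = emeasure W {\<omega>. strict_record \<omega> 0}"
    if i: "i \<in> walk.record_states" for i
  proof -
    have "(\<lambda>\<eta>. ennreal_of_enat (return_time path_ladder {i} \<eta>)) \<in> borel_measurable path_space"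
      unfolding ennreal_of_enat_eq_count enat_less_return_time_iff
      by (rule borel_measurable_nn_integral_count) measurable
    then have "(\<integral>\<^sup>+ \<eta>. ennreal_of_enat (return_time path_ladder {i} \<eta>) \<partial>L i) = mean_return_time P (ladder_chain M X) i"
      unfolding L_def mean_return_time_def
      by (subst nn_integral_distr) (simp_all add: return_time_one_sided_path)
    with walk.kac_formula[OF i] show ?thesis by simp
  qed
  have pos: "walk.record_weight i \<noteq> 0" if "i \<in> walk.record_states" for i
    using that by (simp add: walk.record_states_def)
  show ?thesis
  proof
    assume pr: "positive_recurrent_on P (ladder_chain M X) walk.record_states"
    obtain i where i: "i \<in> walk.record_states" using walk.record_states_nonempty by blast
    with pr have "mean_return_time P (ladder_chain M X) i < \<infinity>" by (simp add: positive_recurrent_on_def)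
    then show "emeasure W {\<omega>. strict_record \<omega> 0} < \<infinity>"
      unfolding kac[OF i, symmetric] using walk.record_weight_finite[of i] by (simp add: ennreal_mult_less_top)
  next
    assume fin: "emeasure W {\<omega>. strict_record \<omega> 0} < \<infinity>"
    have "mean_return_time P (ladder_chain M X) i < \<infinity>" if i: "i \<in> walk.record_states" for i
      using fin pos[OF i] unfolding kac[OF i, symmetric] by (auto simp: ennreal_mult_less_top)
    with ladder_recurrent show "positive_recurrent_on P (ladder_chain M X) walk.record_states"
      by (simp add: positive_recurrent_on_def)
  qed
qed

end

theorem theorem5p1:
  fixes p :: "'a::countable \<Rightarrow> 'a \<Rightarrow> real"
    and F :: "'a \<Rightarrow> 'a \<Rightarrow> real measure"
    and P :: "'a \<Rightarrow> 'w measure"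
    and M :: "nat \<Rightarrow> 'w \<Rightarrow> 'a"
    and X :: "nat \<Rightarrow> 'w \<Rightarrow> real"
    and \<pi> :: "'a \<Rightarrow> ennreal"
    and P\<xi> :: "'v measure"
    and M2 :: "int \<Rightarrow> 'v \<Rightarrow> 'a"
    and X2 :: "int \<Rightarrow> 'v \<Rightarrow> real"
    and c :: ennreal
    and \<pi>' :: "'a \<Rightarrow> ennreal"
    and S' :: "'a set"
  assumes "markov_random_walk p F P M X"
    and "null_recurrent_on P (\<lambda>n w. Some (M n w)) UNIV"
    and "ess_unique_stationary_measure p \<pi>"
    and "\<forall>i. 0 < \<pi> i"
    and "(\<integral>\<^sup>+ i. \<pi> i \<partial>count_space UNIV) = \<infinity>"
    and "two_sided_stationary p F \<pi> P\<xi> M2 X2"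
    and "dual_positive_divergent P\<xi> M2 X2"
    and "c = ladder_const P\<xi> X2"
    and "\<pi>' = ladder_measure P\<xi> M2 X2"
    and "S' = {i. \<pi>' i > 0}"
  shows "mean_inverse_gap P\<xi> X2 = emeasure P\<xi> {w \<in> space P\<xi>. sigma0 X2 w = 0}
    \<and> ess_unique_stationary_measure (ladder_matrix P M X) \<pi>'
    \<and> (\<forall>i. \<pi>' i = inverse c * emeasure P\<xi> {w \<in> space P\<xi>. M2 0 w = i \<and> sigma0 X2 w = 0})
    \<and> density (point_measure UNIV \<pi>)
          (\<lambda>i. inverse c * emeasure (cond_start P\<xi> M2 i) {w \<in> space P\<xi>. sigma0 X2 w = 0})
        = point_measure UNIV \<pi>'
    \<and> recurrent_on P (ladder_chain M X) S'
    \<and> (\<forall>i. measure (P i) {w \<in> space (P i). return_time (ladder_chain M X) S' w < \<infinity>} = 1)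
    \<and> (positive_recurrent_on P (ladder_chain M X) S' \<longleftrightarrow> mean_inverse_gap P\<xi> X2 < \<infinity>)
    \<and> (positive_recurrent_on P (ladder_chain M X) S' \<longleftrightarrow>
          emeasure P\<xi> {w \<in> space P\<xi>. sigma0 X2 w = 0} < \<infinity>)"
proof -
  interpret mrw_two_sided p F P M X \<pi> P\<xi> M2 X2
    by unfold_locales (rule assms)+
  have S': "S' = walk.record_states"
    unfolding assms(9,10) by (rule ladder_measure_support)
  show ?thesis
    unfolding S' assms(8,9)
    using mean_inverse_gap_eq emeasure_sigma0_eq ess_unique_ladder_measure ladder_measure_eq
      emeasure_sigma0_start_eq density_ladder_measure ladder_recurrent ladder_hits_record_states
      ladder_positive_recurrent_iff
    by simp
qed

end
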